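(* Let $K$ and $L$ be two star bodies (star-shaped with respect to the origin) in $\mathbb{R}^4$, each having countably many diameters. Assume that there exists $\zeta\in S^3$ such that $K$ has a diameter $d_K(\zeta)$ containing the origin and parallel to $\zeta$, and such that for every $w\in S^3$ with $\zeta\in w^\perp$ the sections $K\cap w^\perp$ and $L\cap w^\perp$ are directly congruent. Assume also that for every such $w$ the sections $K\cap w^\perp$, $L\cap w^\perp$ have no $(\zeta,\pi)$-symmetry and no $(u,\pi)$-symmetry for any $u\in\zeta^\perp\cap w^\perp\cap S^3$. Then $K=L+b$ or $K=\mathcal{O}L+b$ for some $b\in\mathbb{R}^4$ parallel to $\zeta$, where $\mathcal{O}=\mathcal{O}_\zeta\in O(4)$ is the orthogonal transformation with $\mathcal{O}|_{\zeta^\perp}=-I$ and $\mathcal{O}(\zeta)=\zeta$.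
   Context: A body in $\mathbb{R}^n$ is a compact set equal to the closure of its non-empty interior. A set $S$ is star-shaped with respect to the origin if the segment from the origin to any point of $S$ is contained in $S$. A star body is a body $K$ that is star-shaped with respect to the origin and whose radial function $\rho_K(x)=\max\{c: cx\in K\}$, $x\ne0$, is continuous. A segment $[z,y]\subset K$ is a diameter of a star body $K$ if $|z-y|=\max_{[a,b]\subset K}|a-b|$ (maximum over segments contained in $K$); $K$ has countably many diameters if the set of such segments is countable. A diameter of $K$ containing the origin and parallel to $\zeta\in S^{n-1}$ is denoted $d_K(\zeta)$. $w^\perp$ is the hyperplane through the origin orthogonal to $w$. For a subspace $H$ of dimension $k$, sets $A,B\subset H$ are directly congruent if there is a rotation $\varphi\in SO(k,H)$ of $H$ such that $\varphi(A)$ is a translate of $B$. If $\dim H=3$ and $\xi\in H\cap S^{n-1}$, then $D\subset H$ has a $(\xi,\pi)$-symmetry if $\varphi(D)=D+a$ for some $a\in H$, where $\varphi\in SO(3,H)$ is the rotation by the angle $\pi$ with $\varphi(\xi)=\xi$. *)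

theory Defs
  imports "HOL-Analysis.Analysis"
begin

definition body :: "'a::euclidean_space set \<Rightarrow> bool" where
  "body K \<longleftrightarrow> compact K \<and> interior K \<noteq> {} \<and> K = closure (interior K)"

definition star_shaped :: "'a::real_vector set \<Rightarrow> bool" where
  "star_shaped S \<longleftrightarrow> (\<forall>x\<in>S. closed_segment 0 x \<subseteq> S)"

(* The greatest such c exists whenever K is compact, 0 \<in> K and x \<noteq> 0; the value at x = 0 is irrelevant. *)
definition radial_function :: "'a::real_vector set \<Rightarrow> 'a \<Rightarrow> real" where
  "radial_function K x = (GREATEST c. c *\<^sub>R x \<in> K)"

definition star_body :: "'a::euclidean_space set \<Rightarrow> bool" where
  "star_body K \<longleftrightarrow> body K \<and> star_shaped K \<and> continuous_on (- {0}) (radial_function K)"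

definition diameters :: "'a::euclidean_space set \<Rightarrow> 'a set set" where
  "diameters K =
     {closed_segment z y | z y. closed_segment z y \<subseteq> K \<and>
        (\<forall>a b. closed_segment a b \<subseteq> K \<longrightarrow> dist a b \<le> dist z y)}"

(* \<open>central_diameter K \<zeta> d\<close>: d is a diameter of K containing the origin and parallel to \<zeta>.
   If K has non-empty interior then z \<noteq> y, so the scalar t is automatically non-zero. *)
definition central_diameter :: "'a::euclidean_space set \<Rightarrow> 'a \<Rightarrow> 'a set \<Rightarrow> bool" where
  "central_diameter K \<zeta> d \<longleftrightarrow>
     d \<in> diameters K \<and> 0 \<in> d \<and>
     (\<exists>z y t. d = closed_segment z y \<and> y - z = t *\<^sub>R \<zeta>)"

abbreviation perp :: "'a::real_inner \<Rightarrow> 'a set" where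
  "perp w \<equiv> {x. w \<bullet> x = 0}"

(* SO(k,H) for a k-dimensional subspace H: an orthogonal map of H is identified with its extension
   to the whole space that is the identity on the orthogonal complement of H.  The extension has
   the same determinant as the map of H, so no determinant on H itself is needed. *)
definition SO_on :: "(real ^ 'n) set \<Rightarrow> (real ^ 'n \<Rightarrow> real ^ 'n) set" where
  "SO_on H = {\<phi>. orthogonal_transformation \<phi> \<and> \<phi> ` H = H \<and>
                 (\<forall>x\<in>orthogonal_comp H. \<phi> x = x) \<and> det (matrix \<phi>) = 1}"

definition directly_congruent_in ::
    "(real ^ 'n) set \<Rightarrow> (real ^ 'n) set \<Rightarrow> (real ^ 'n) set \<Rightarrow> bool" where
  "directly_congruent_in H A B \<longleftrightarrow>
     (\<exists>\<phi>\<in>SO_on H. \<exists>a\<in>H. \<phi> ` A = (\<lambda>x. x + a) ` B)"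

(* For a 3-dimensional subspace H and a unit vector \<xi> in H, the rotation of H by the angle pi
   fixing \<xi> is the one acting as -id on the plane of H orthogonal to \<xi>. *)
definition pi_symmetric_in :: "(real ^ 'n) set \<Rightarrow> real ^ 'n \<Rightarrow> (real ^ 'n) set \<Rightarrow> bool" where
  "pi_symmetric_in H \<xi> D \<longleftrightarrow>
     (\<exists>\<phi>\<in>SO_on H. \<phi> \<xi> = \<xi> \<and> (\<forall>x\<in>H \<inter> perp \<xi>. \<phi> x = - x) \<and>
        (\<exists>a\<in>H. \<phi> ` D = (\<lambda>x. x + a) ` D))"

end

theory Submission
  imports Defs
begin

text \<open>
  All diameters of \<open>L\<close> have the length of \<open>d_K(\<zeta>)\<close>, and for all \<open>w\<close> outside countably many great
  circles the only ones in \<open>w\<^sup>\<bottom>\<close> lie on the axis \<open>\<real> \<zeta>\<close>. Hence the congruence of the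
  sections by \<open>w\<^sup>\<bottom>\<close> maps the axis to itself. After centring the axial diameters at the origin it acts on the
  two-dimensional part of \<open>w\<^sup>\<bottom>\<close> orthogonal to the axis either by a rotation, preserving heights along the axis,
  or by a reflection, reversing them. By compactness one of the two holds for every \<open>w\<close>, by the
  absence of \<open>(u, \<pi>)\<close>-symmetries never both, so by connectedness always the same one.

  Reflections are impossible: up to the finite stabilisers their axes would define a nowhere vanishing
  section of a power of the tangent bundle of the two-sphere.
  In the case of rotations, injectivity of the Funk transform on even functions shows that the two bodies have the same
  unordered pairs of half-plane sections in opposite directions. So the rotation at \<open>w\<close> preserves these pairs for \<open>K\<close>, and
  its angle belongs to a fixed finite set. If some angle other than \<open>0\<close> and \<open>\<pi>\<close>
  occurred on an open set of \<open>w\<close>, the half-plane sections of \<open>K\<close> would be constant along a great circle. Hence the angle is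
  \<open>0\<close> for all \<open>w\<close> or \<open>\<pi>\<close> for all \<open>w\<close>.
\<close>

section \<open>Planes in three-space as complex planes\<close>

text \<open>Half-planes bounded by the axis correspond to points of the two-sphere in the orthogonal
  complement of \<zeta>. Colouring each point by the section of the body with its half-plane turns
  the problem into one about two colourings of the two-sphere that agree on each great circle up to
  a rotation, or up to a reflection combined with turning the colours upside down.

  The obstacle is that the rotation or reflection at \<open>w\<close> is determined only up to
  symmetries of the coloured circle, so no continuous choice is at hand. These symmetries form
  proper closed subgroups of the circle group, because a half-turn symmetry is excluded, and
  compactness gives one exponent \<open>N\<close> that kills all of them. Taking \<open>N\<close>-th
  powers makes reflections single valued, and it leaves finitely many angles for rotations.

  The Funk transform acts on real functions while colours encode sets; it is applied to a bump
  function of the colour. The translations in the congruences disappear because heights are measured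
  from the midpoint of the axial diameter, which does not depend on \<open>w\<close>.\<close>

lemma norm_cross3_orthogonal:
  fixes w e :: "real ^ 3"
  assumes "w \<bullet> e = 0"
  shows "norm (cross3 w e) = norm w * norm e"
proof -
  have "(norm (cross3 w e))\<^sup>2 = (norm w * norm e)\<^sup>2"
    using norm_cross_dot[of w e] assms by simp
  then show ?thesis
    by (simp add: power2_eq_iff_nonneg)
qed

text \<open>The plane orthogonal to \<open>w\<close> as the complex plane, with \<open>e\<close> as \<open>1\<close> and \<open>w \<times> e\<close> as \<open>\<i>\<close>: its rotations are
  \<open>p \<mapsto> p * z\<close>, and its reflections in lines are \<open>p \<mapsto> v * cnj p\<close> with \<open>cmod v = 1\<close>.\<close>

definition plane_point :: "real ^ 3 \<Rightarrow> real ^ 3 \<Rightarrow> complex \<Rightarrow> real ^ 3" where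
  "plane_point w e p = Re p *\<^sub>R e + Im p *\<^sub>R cross3 w e"

definition orthonormal_pair :: "real ^ 3 \<Rightarrow> real ^ 3 \<Rightarrow> bool" where
  "orthonormal_pair w e \<longleftrightarrow> norm w = 1 \<and> norm e = 1 \<and> w \<bullet> e = 0"

lemma orthonormal_pairD:
  assumes "orthonormal_pair w e"
  shows "norm w = 1" "norm e = 1" "w \<bullet> e = 0" "e \<bullet> w = 0" "w \<bullet> w = 1" "e \<bullet> e = 1"
    "norm (cross3 w e) = 1" "cross3 w e \<bullet> cross3 w e = 1"
    "cross3 w (cross3 w e) = - e"
proof -
  show *: "norm w = 1" "norm e = 1" "w \<bullet> e = 0" "e \<bullet> w = 0"
    using assms by (auto simp: orthonormal_pair_def inner_commute)
  then show **: "w \<bullet> w = 1" "e \<bullet> e = 1" by (simp_all add: dot_square_norm)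
  show "norm (cross3 w e) = 1" using * by (simp add: norm_cross3_orthogonal)
  then show "cross3 w e \<bullet> cross3 w e = 1" by (simp add: dot_square_norm)
  show "cross3 w (cross3 w e) = - e" using * ** by (simp add: Lagrange)
qed

lemma plane_point_perp: "w \<bullet> e = 0 \<Longrightarrow> w \<bullet> plane_point w e p = 0"
  by (simp add: plane_point_def inner_add_right dot_cross_self)

lemma norm_plane_point:
  assumes "orthonormal_pair w e"
  shows "norm (plane_point w e p) = cmod p"
proof -
  have "(norm (plane_point w e p))\<^sup>2 = (cmod p)\<^sup>2"
    unfolding cmod_power2 unfolding power2_norm_eq_inner using orthonormal_pairD[OF assms]
    by (simp add: plane_point_def inner_add_left inner_add_right
        dot_cross_self inner_commute power2_eq_square)
  then show ?thesis by (rule power2_eq_imp_eq) auto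
qed

lemma plane_point_mult:
  assumes "orthonormal_pair w e"
  shows "plane_point w (plane_point w e u) p = plane_point w e (u * p)"
  using orthonormal_pairD[OF assms]
  by (simp add: plane_point_def cross_add_right cross_mult_right algebra_simps)

lemma plane_point_one [simp]: "plane_point w e 1 = e"
  by (simp add: plane_point_def)

lemma plane_point_neg [simp]: "plane_point w e (- p) = - plane_point w e p"
  by (simp add: plane_point_def)

text \<open>A reversed normal reverses the orientation of the plane. The resulting conjugation is
  the source of the winding in \<open>not_all_flips\<close>.\<close>

lemma plane_point_uminus_left: "plane_point (- w) e p = plane_point w e (cnj p)"
  by (simp add: plane_point_def)

lemma orthonormal_pair_plane_point:
  assumes "orthonormal_pair w e" "cmod u = 1"
  shows "orthonormal_pair w (plane_point w e u)"
  using assms norm_plane_point[OF assms(1)] plane_point_perp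
  by (simp add: orthonormal_pair_def)

lemma plane_point_inner:
  assumes "orthonormal_pair w e"
  shows "plane_point w e p \<bullet> plane_point w e q = Re p * Re q + Im p * Im q"
  using orthonormal_pairD[OF assms]
  by (simp add: plane_point_def inner_add_left inner_add_right dot_cross_self inner_commute algebra_simps)

lemma plane_point_surj:
  assumes "orthonormal_pair w e" "w \<bullet> x = 0"
  shows "x = plane_point w e (Complex (e \<bullet> x) (cross3 w e \<bullet> x))"
proof -
  note o = orthonormal_pairD[OF assms(1)]
  let ?f = "cross3 w e"
  \<comment> \<open>One triple product is evaluated twice, from the inside and by Lagrange's
    identity; comparing the results expands \<open>x\<close> in the frame.\<close>
  have "cross3 x ?f = (x \<bullet> e) *\<^sub>R w"
    using assms(2) by (simp add: Lagrange inner_commute)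
  then have "cross3 ?f (cross3 x ?f) = (x \<bullet> e) *\<^sub>R e"
    using o by (simp add: cross_mult_right cross_skew[of "cross3 w e" w])
  moreover have "cross3 ?f (cross3 x ?f) = x - (?f \<bullet> x) *\<^sub>R ?f"
    using o Lagrange[of ?f x ?f] by simp
  ultimately have "x = (x \<bullet> e) *\<^sub>R e + (?f \<bullet> x) *\<^sub>R ?f"
    by (metis diff_add_cancel)
  then show ?thesis unfolding plane_point_def complex.sel inner_commute[of e] .
qed

lemma plane_point_ex:
  assumes "orthonormal_pair w e" "w \<bullet> x = 0"
  obtains p where "x = plane_point w e p" "cmod p = norm x"
  using plane_point_surj[OF assms] norm_plane_point[OF assms(1)] by metis

lemma orthonormal_pair_exists:
  fixes w :: "real ^ 3"
  assumes "norm w = 1"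
  obtains e where "orthonormal_pair w e"
proof -
  obtain x where x: "x \<noteq> 0" "w \<bullet> x = 0"
  proof -
    have "w \<noteq> 0" using assms by auto
    then obtain b where "cross3 w b \<noteq> 0" using cross_basis_nonzero by blast
    then show ?thesis using that dot_cross_self by blast
  qed
  have "orthonormal_pair w (x /\<^sub>R norm x)"
    using x assms by (simp add: orthonormal_pair_def)
  then show ?thesis by (rule that)
qed

lemma continuous_on_plane_point [continuous_intros]:
  fixes f g :: "'a::t2_space \<Rightarrow> real ^ 3"
  assumes "continuous_on S f" "continuous_on S g" "continuous_on S h"
  shows "continuous_on S (\<lambda>x. plane_point (f x) (g x) (h x))"
  unfolding plane_point_def
  by (intro continuous_intros continuous_on_cross assms)

section \<open>Closed subgroups of the circle\<close>

text \<open>Powers of \<open>z\<close> advance round the circle in steps of its angle, so the last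
  power that does not pass \<open>u\<close> is at most one step away. Conjugation reduces a negative
  angle to a positive one.\<close>

lemma unit_power_approx:
  fixes z u :: complex
  assumes "cmod z = 1" "z \<noteq> 1" "cmod u = 1"
  obtains k :: nat where "cmod (z ^ k - u) \<le> cmod (z - 1)"
proof -
  \<comment> \<open>Squared chord length as a function of the angle; chords are then compared by
    monotonicity of the cosine.\<close>
  have cd: "(cmod (cis a - 1))\<^sup>2 = 2 - 2 * cos a" for a
    using sin_cos_squared_add[of a]
    by (simp add: cmod_power2) (simp add: power2_eq_square algebra_simps)
  have main: "\<exists>k::nat. cmod (z ^ k - u) \<le> cmod (z - 1)"
    if z: "z = cis \<tau>" and u: "u = cis \<mu>" and \<tau>: "0 < \<tau>" "\<tau> \<le> pi" and \<mu>: "0 \<le> \<mu>" for z u \<tau> \<mu>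
  proof -
    define k where "k = nat \<lfloor>\<mu> / \<tau>\<rfloor>"
    have k: "real k \<le> \<mu> / \<tau>" "\<mu> / \<tau> < real k + 1"
      using \<tau> \<mu> unfolding k_def by (auto simp: of_nat_nat)
    then have a: "0 \<le> \<mu> - k * \<tau>" "\<mu> - k * \<tau> \<le> \<tau>"
      using \<tau> by (auto simp: field_simps)
    have "u - z ^ k = cis (k * \<tau>) * (cis (\<mu> - k * \<tau>) - 1)"
      unfolding z u by (simp add: right_diff_distrib cis_mult Complex.DeMoivre)
    then have "cmod (z ^ k - u) = cmod (cis (\<mu> - k * \<tau>) - 1)"
      unfolding norm_minus_commute[of _ u] by (simp only: norm_mult norm_cis mult_1)
    moreover have "(cmod (cis (\<mu> - k * \<tau>) - 1))\<^sup>2 \<le> (cmod (cis \<tau> - 1))\<^sup>2"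
      unfolding cd using cos_monotone_0_pi_le[OF a] \<tau> by simp
    ultimately show ?thesis
      unfolding z by (metis norm_ge_zero power2_le_imp_le)
  qed
  have cA: "v = cis (Arg2pi v)" if "cmod v = 1" for v
    unfolding cis_conv_exp using Arg2pi_eq[of v] that by (metis mult_1 of_real_1)
  have "z \<noteq> 0" using assms(1) by auto
  then have "cis (Arg z) = z" using cis_Arg[of z] assms(1) by (simp add: sgn_div_norm)
  then have zu: "z = cis (Arg z)" "u = cis (Arg2pi u)"
    using cA[OF assms(3)] by metis+
  show ?thesis
  proof (cases "Arg z > 0")
    case True
    then show ?thesis
      using main[OF zu True] Arg_le_pi Arg2pi_ge_0 that by blast
  next
    case False
    have "Arg z \<noteq> 0" using zu(1) assms(2) by (metis cis_zero)
    then have *: "0 < - Arg z" "- Arg z \<le> pi"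
      using False Arg_bounded[of z] by linarith+
    have zu': "cnj z = cis (- Arg z)" "cnj u = cis (Arg2pi (cnj u))"
      using cA[of "cnj u"] assms(3) zu(1) by (metis cis_cnj, metis complex_mod_cnj)
    obtain k :: nat where "cmod (cnj z ^ k - cnj u) \<le> cmod (cnj z - 1)"
      using main[OF zu' *] Arg2pi_ge_0 by blast
    then have "cmod (cnj (z ^ k - u)) \<le> cmod (cnj (z - 1))" by simp
    then show ?thesis using that unfolding complex_mod_cnj by blast
  qed
qed

text \<open>Powers of \<open>z\<close> come as close to any \<open>u\<close> on the circle as
  \<open>z\<close> is to 1. If nontrivial \<open>z\<close> accumulated at 1, compactness of
  \<open>B\<close> would give a limit fibre containing the whole circle.\<close>

lemma closed_subgroups_gap:
  fixes R :: "('b::metric_space \<times> complex) set"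
  assumes cpt: "compact B" and clo: "closed R" and sub: "R \<subseteq> B \<times> sphere 0 1"
    and pow: "\<And>b z k. (b, z) \<in> R \<Longrightarrow> (b, z ^ k) \<in> R"
    and proper: "\<And>b. b \<in> B \<Longrightarrow> \<exists>u\<in>sphere 0 1. (b, u) \<notin> R"
  shows "\<exists>\<delta>>0. \<forall>b z. (b, z) \<in> R \<longrightarrow> cmod (z - 1) < \<delta> \<longrightarrow> z = 1"
proof (rule ccontr)
  assume "\<not> ?thesis"
  then have "\<forall>n. \<exists>b z. (b, z) \<in> R \<and> cmod (z - 1) < inverse (Suc n) \<and> z \<noteq> 1"
    by (metis inverse_positive_iff_positive of_nat_0_less_iff zero_less_Suc)
  then obtain b z where bz: "\<And>n. (b n, z n) \<in> R" "\<And>n. cmod (z n - 1) < inverse (Suc n)"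
    "\<And>n. z n \<noteq> 1"
    by metis
  have bB: "b n \<in> B" and z1: "cmod (z n) = 1" for n using bz(1)[of n] sub by auto
  obtain l r where l: "l \<in> B" "strict_mono (r :: nat \<Rightarrow> nat)" "(b \<circ> r) \<longlonglongrightarrow> l"
    using cpt bB unfolding compact_def by metis
  \<comment> \<open>The missing \<open>u\<close> belongs to the fibre over the limit
    \<open>l\<close>; it is chosen only now and then approximated by powers in the fibres over
    \<open>b n\<close>.\<close>
  obtain u where u: "u \<in> sphere 0 1" "(l, u) \<notin> R" using proper l(1) by blast
  have "\<exists>k. cmod (z n ^ k - u) \<le> cmod (z n - 1)" for n
    using unit_power_approx[OF z1 bz(3)] u(1) by (metis dist_0_norm mem_sphere)
  then obtain k where k: "\<And>n. cmod (z n ^ k n - u) \<le> cmod (z n - 1)" by metis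
  have "(\<lambda>n. z n ^ k n) \<longlonglongrightarrow> u"
  proof (rule LIM_zero_cancel, rule Lim_null_comparison)
    show "\<forall>\<^sub>F n in sequentially. cmod (z n ^ k n - u) \<le> inverse (Suc n)"
      using k bz(2) by (intro always_eventually allI) (meson less_imp_le order_trans)
    show "(\<lambda>n. inverse (real (Suc n))) \<longlonglongrightarrow> 0" by (rule LIMSEQ_inverse_real_of_nat)
  qed
  then have "((\<lambda>n. z n ^ k n) \<circ> r) \<longlonglongrightarrow> u" by (rule LIMSEQ_subseq_LIMSEQ[OF _ l(2)])
  then have "(\<lambda>n. ((b \<circ> r) n, ((\<lambda>n. z n ^ k n) \<circ> r) n)) \<longlonglongrightarrow> (l, u)"
    by (intro tendsto_Pair l(3))
  then have "(l, u) \<in> R"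
    by (rule closed_sequentially[OF clo, rotated]) (use pow[OF bz(1)] in auto)
  with u show False by simp
qed

text \<open>Pigeonhole on a finite net \<open>C\<close>: two of the powers with exponents up to
  \<open>card C\<close> share a ball, and their quotient is a power so close to 1 that it equals 1.
  Orders are thus at most \<open>card C\<close>, and its factorial is a common exponent.\<close>

lemma finite_order_uniform:
  fixes R :: "('b::metric_space \<times> complex) set"
  assumes cpt: "compact B" and clo: "closed R" and sub: "R \<subseteq> B \<times> sphere 0 1"
    and pow: "\<And>b z k. (b, z) \<in> R \<Longrightarrow> (b, z ^ k) \<in> R"
    and proper: "\<And>b. b \<in> B \<Longrightarrow> \<exists>u\<in>sphere 0 1. (b, u) \<notin> R"
  shows "\<exists>N::nat. N > 0 \<and> (\<forall>b z. (b, z) \<in> R \<longrightarrow> z ^ N = 1)"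
proof -
  obtain \<delta> where \<delta>: "\<delta> > 0" "\<And>b z. (b, z) \<in> R \<Longrightarrow> cmod (z - 1) < \<delta> \<Longrightarrow> z = 1"
    using closed_subgroups_gap[OF assms] by blast
  have "compact (sphere (0::complex) 1)" by simp
  then obtain C where C: "finite C" "sphere (0::complex) 1 \<subseteq> (\<Union>c\<in>C. ball c (\<delta>/2))"
    using \<delta>(1) unfolding compact_eq_totally_bounded by (metis half_gt_zero)
  have "z ^ fact (card C) = 1" if bz: "(b, z) \<in> R" for b z
  proof -
    have z1: "cmod z = 1" using bz sub by auto
    have "\<forall>k. \<exists>c\<in>C. z ^ k \<in> ball c (\<delta>/2)"
    proof
      fix k
      have "z ^ k \<in> sphere 0 1" using z1 by (simp add: norm_power)
      then show "\<exists>c\<in>C. z ^ k \<in> ball c (\<delta>/2)" using C(2) by blast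
    qed
    then obtain f where f: "\<And>k. f k \<in> C" "\<And>k. z ^ k \<in> ball (f k) (\<delta>/2)" by metis
    have "\<not> inj_on f {..card C}"
    proof
      assume "inj_on f {..card C}"
      moreover have "f ` {..card C} \<subseteq> C" using f(1) by blast
      ultimately have "card {..card C} \<le> card C" using C(1) by (metis card_inj_on_le)
      then show False by simp
    qed
    then obtain i j where ij: "i < j" "j \<le> card C" "f i = f j"
      unfolding inj_on_def by (metis atMost_iff linorder_neqE_nat)
    have "dist (z ^ j) (z ^ i) < \<delta>"
      using f(2)[of i] f(2)[of j] ij(3) dist_triangle_half_r[of "f j" "z ^ j" \<delta> "z ^ i"]
      by simp
    moreover have "z ^ j - z ^ i = z ^ i * (z ^ (j - i) - 1)"
      using ij(1) by (simp add: right_diff_distrib flip: power_add)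
    ultimately have "cmod (z ^ (j - i) - 1) < \<delta>"
      using z1 by (simp add: dist_norm norm_mult norm_power)
    then have "z ^ (j - i) = 1" using \<delta>(2)[OF pow[OF bz]] by blast
    moreover have "j - i dvd fact (card C)"
      using ij by (intro dvd_fact) auto
    ultimately show ?thesis by (metis dvdE power_mult power_one)
  qed
  then show ?thesis by (metis fact_gt_zero)
qed

section \<open>The Funk transform\<close>

lemma integral_periodic_shift:
  fixes f :: "real \<Rightarrow> real"
  assumes cont: "continuous_on UNIV f" and per: "\<And>x. f (x + T) = f x" and "0 \<le> a" "0 \<le> T"
  shows "integral {0..T} (\<lambda>x. f (x + a)) = integral {0..T} f"
proof -
  have int: "f integrable_on {c..d}" for c d
    using cont by (intro integrable_continuous_real continuous_on_subset[OF cont]) auto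
  have shift: "integral {c..d} (\<lambda>x. f (x + b)) = integral {c+b..d+b} f" for b c d
    using has_integral_shift_Icc_real[of f b "integral {c+b..d+b} f" c d] integrable_integral[OF int]
    by (intro integral_unique) (simp add: o_def add.commute)
  have "integral {0..T} f + integral {T..T+a} f = integral {0..T+a} f"
    using assms(3,4) by (intro Henstock_Kurzweil_Integration.integral_combine int) auto
  moreover have "integral {0..a} f + integral {a..T+a} f = integral {0..T+a} f"
    using assms(3,4) by (intro Henstock_Kurzweil_Integration.integral_combine int) auto
  moreover have "integral {T..T+a} f = integral {0..a} f"
    using shift[of 0 a T] per by (simp add: add.commute)
  ultimately show ?thesis using shift[of 0 T a] by simp
qed

section \<open>Wallis integrals and an integral equation of Abel type\<close>

lemma integral_sin_power_rec:
  fixes a b :: real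
  assumes "a \<le> b"
  shows "(n + 2) * integral {a..b} (\<lambda>x. sin x ^ (n + 2)) =
    (n + 1) * integral {a..b} (\<lambda>x. sin x ^ n) + cos a * sin a ^ (n + 1) - cos b * sin b ^ (n + 1)"
proof -
  let ?g = "\<lambda>x::real. - cos x * sin x ^ (n + 1)"
  have d: "((\<lambda>x. (n + 2) * sin x ^ (n + 2) - (n + 1) * sin x ^ n) has_integral ?g b - ?g a) {a..b}"
  proof (rule fundamental_theorem_of_calculus[OF assms])
    fix x :: real
    have "sin x ^ (n + 2) - (n + 1) * (cos x)\<^sup>2 * sin x ^ n = (n + 2) * sin x ^ (n + 2) - (n + 1) * sin x ^ n"
      unfolding cos_squared_eq by (simp add: algebra_simps power2_eq_square)
    moreover have "(?g has_real_derivative sin x ^ (n + 2) - (n + 1) * (cos x)\<^sup>2 * sin x ^ n) (at x)"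
      by (rule DERIV_cong[OF DERIV_mult[OF DERIV_minus[OF DERIV_cos] DERIV_power[OF DERIV_sin]]])
        (simp add: power2_eq_square algebra_simps)
    ultimately show "(?g has_vector_derivative (n + 2) * sin x ^ (n + 2) - (n + 1) * sin x ^ n) (at x within {a..b})"
      unfolding has_real_derivative_iff_has_vector_derivative[symmetric]
      by (simp only: has_field_derivative_at_within)
  qed
  have "integral {a..b} (\<lambda>x. (n + 2) * sin x ^ (n + 2) - (n + 1) * sin x ^ n) =
    (n + 2) * integral {a..b} (\<lambda>x. sin x ^ (n + 2)) - (n + 1) * integral {a..b} (\<lambda>x. sin x ^ n)"
    by (subst integral_diff) (auto intro!: integrable_continuous_real continuous_intros)
  with integral_unique[OF d] show ?thesis by (simp add: add.commute)
qed

text \<open>Each factor has a different form for even and odd \<open>n\<close>, but in the product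
  the Wallis recursions telescope: a step of two multiplies it by \<open>(n + 1) / (n + 3)\<close>.
  The factor \<open>1 - (-1) ^ (n + 1)\<close> also arises from integrating a power over a symmetric
  interval, which is how \<open>hat_box_power\<close> uses it.\<close>

lemma integral_sin_power_product:
  "integral {0..2*pi} (\<lambda>x. sin x ^ n) * integral {0..pi/2} (\<lambda>x. sin x ^ (n + 1)) =
    pi * (1 - (-1) ^ (n + 1)) / (n + 1)"
proof (induction n rule: induct_nat_012)
  case 0
  have "(sin has_integral (- cos (pi/2) - (- cos 0))) {0..pi/2}"
    by (rule fundamental_theorem_of_calculus)
      (auto intro!: derivative_eq_intros simp flip: has_real_derivative_iff_has_vector_derivative)
  then have "integral {0..pi/2} sin = (1::real)" by (simp add: integral_unique)
  then show ?case by simp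
next
  case 1
  have "(sin has_integral (- cos (2*pi) - (- cos 0))) {0..2*pi}"
    by (rule fundamental_theorem_of_calculus)
      (auto intro!: derivative_eq_intros simp flip: has_real_derivative_iff_has_vector_derivative)
  then have "integral {0..2*pi} sin = (0::real)" by (simp add: integral_unique)
  then show ?case by simp
next
  case (ge2 n)
  let ?A = "\<lambda>n. integral {0..2*pi} (\<lambda>x::real. sin x ^ n)"
  let ?B = "\<lambda>n. integral {0..pi/2} (\<lambda>x::real. sin x ^ n)"
  have A: "(n + 2) * ?A (n + 2) = (n + 1) * ?A n"
    using integral_sin_power_rec[of 0 "2*pi" n] by (simp add: add.commute)
  have B: "(n + 3) * ?B (n + 3) = (n + 2) * ?B (n + 1)"
    using integral_sin_power_rec[of 0 "pi/2" "n + 1"] by (simp add: algebra_simps numeral_3_eq_3)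
  have "real (n + 2) * (real (n + 3) * (?A (n + 2) * ?B (n + 3))) =
      (real (n + 2) * ?A (n + 2)) * (real (n + 3) * ?B (n + 3))" by (simp only: mult_ac)
  also have "\<dots> = real (n + 2) * (real (n + 1) * (?A n * ?B (n + 1)))"
    unfolding A B by (simp only: mult_ac)
  finally have "real (n + 3) * (?A (n + 2) * ?B (n + 3)) = real (n + 1) * (?A n * ?B (n + 1))"
    by simp
  also have "\<dots> = pi * (1 - (-1) ^ (n + 1))" unfolding ge2(1) by simp
  finally have "?A (n + 2) * ?B (n + 3) = pi * (1 - (-1) ^ (n + 1)) / (n + 3)"
    by (simp add: field_simps)
  then show ?case by (simp add: numeral_3_eq_3 numeral_2_eq_2)
qed

text \<open>The moment form of Archimedes' hat-box theorem: \<open>sin s sin t\<close> is a Cartesian coordinate on the sphere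
  and \<open>sin s\<close> the area density.\<close>

lemma hat_box_power:
  fixes r :: real
  assumes "0 \<le> r"
  shows "r * integral {0..pi/2} (\<lambda>s. sin s * integral {0..2*pi} (\<lambda>t. (r * sin s * sin t) ^ n)) =
    pi * integral {-r..r} (\<lambda>u. u ^ n)"
proof -
  have "((\<lambda>u. u ^ n) has_integral (r ^ (n+1) / (n+1) - (-r) ^ (n+1) / (n+1))) {-r..r}"
    using assms by (intro fundamental_theorem_of_calculus)
      (auto intro!: derivative_eq_intros simp flip: has_real_derivative_iff_has_vector_derivative
        simp del: power_Suc of_nat_Suc)
  then have "integral {-r..r} (\<lambda>u. u ^ n) = r ^ (n+1) / (n+1) - (-r) ^ (n+1) / (n+1)"
    by (rule integral_unique)
  also have "\<dots> = r ^ (n+1) * ((1 - (-1) ^ (n+1)) / (n+1))"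
    unfolding power_minus[of r]
    by (simp only: diff_divide_distrib right_diff_distrib mult_1_right times_divide_eq_right mult.commute)
  finally have R: "pi * integral {-r..r} (\<lambda>u. u ^ n) = r ^ (n+1) * (pi * (1 - (-1) ^ (n+1)) / (n+1))"
    by simp
  have "sin s * integral {0..2*pi} (\<lambda>t. (r * sin s * sin t) ^ n) =
    r ^ n * integral {0..2*pi} (\<lambda>t. sin t ^ n) * sin s ^ (n + 1)" for s
    by (simp add: power_mult_distrib)
  then have "integral {0..pi/2} (\<lambda>s. sin s * integral {0..2*pi} (\<lambda>t. (r * sin s * sin t) ^ n)) =
    r ^ n * integral {0..2*pi} (\<lambda>t. sin t ^ n) * integral {0..pi/2} (\<lambda>s. sin s ^ (n + 1))"
    by (simp only: integral_mult_right)
  then show ?thesis unfolding R integral_sin_power_product[symmetric] by simp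
qed

lemma hat_box_polynomial:
  fixes r :: real
  assumes "0 \<le> r" and p: "p = (\<lambda>x. \<Sum>i\<le>n. a i * x ^ i)"
  shows "r * integral {0..pi/2} (\<lambda>s. sin s * integral {0..2*pi} (\<lambda>t. p (r * sin s * sin t))) =
    pi * integral {-r..r} p"
proof -
  have in1: "integral {0..2*pi} (\<lambda>t. p (c * sin t)) = (\<Sum>i\<le>n. a i * integral {0..2*pi} (\<lambda>t. (c * sin t) ^ i))" for c
    unfolding p by (subst integral_sum) (auto intro!: integrable_continuous_real continuous_intros)
  have in2: "integral {-r..r} p = (\<Sum>i\<le>n. a i * integral {-r..r} (\<lambda>t. t ^ i))"
    unfolding p by (subst integral_sum) (auto intro!: integrable_continuous_real continuous_intros)
  have cI: "integral {0..2*pi} (\<lambda>t. (r * sin s * sin t) ^ i) = (r * sin s) ^ i * integral {0..2*pi} (\<lambda>t. sin t ^ i)" for s i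
    by (simp add: power_mult_distrib)
  have "integral {0..pi/2} (\<lambda>s. sin s * integral {0..2*pi} (\<lambda>t. p (r * sin s * sin t))) =
    integral {0..pi/2} (\<lambda>s. \<Sum>i\<le>n. a i * (sin s * integral {0..2*pi} (\<lambda>t. (r * sin s * sin t) ^ i)))"
    unfolding in1 by (simp add: sum_distrib_left mult_ac)
  also have "\<dots> = (\<Sum>i\<le>n. a i * integral {0..pi/2} (\<lambda>s. sin s * integral {0..2*pi} (\<lambda>t. (r * sin s * sin t) ^ i)))"
    unfolding cI by (subst integral_sum) (auto intro!: integrable_continuous_real continuous_intros)
  finally have "r * integral {0..pi/2} (\<lambda>s. sin s * integral {0..2*pi} (\<lambda>t. p (r * sin s * sin t))) =
    (\<Sum>i\<le>n. a i * (r * integral {0..pi/2} (\<lambda>s. sin s * integral {0..2*pi} (\<lambda>t. (r * sin s * sin t) ^ i))))"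
    by (simp add: sum_distrib_left mult_ac)
  also have "\<dots> = pi * integral {-r..r} p"
    unfolding hat_box_power[OF assms(1)] in2 by (simp add: sum_distrib_left mult_ac)
  finally show ?thesis .
qed

text \<open>The hat-box identity expresses the integral over \<open>{-r..r}\<close> by the integrals
  assumed to vanish. It is at hand for polynomials, so \<open>f\<close> is replaced by a uniformly
  close one.\<close>

lemma abel_integral_vanish:
  fixes f :: "real \<Rightarrow> real"
  assumes cont: "continuous_on {-1..1} f"
    and vanish: "\<And>c. 0 \<le> c \<Longrightarrow> c \<le> 1 \<Longrightarrow> integral {0..2*pi} (\<lambda>t. f (c * sin t)) = 0"
    and r: "0 \<le> r" "r \<le> 1"
  shows "integral {-r..r} f = 0"
proof -
  \<comment> \<open>\<open>pi * e\<close> bounds the integral of the polynomial,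
    \<open>2 * e\<close> the error of replacing \<open>f\<close> by it on an interval of length at
    most 2.\<close>
  have bound: "\<bar>integral {-r..r} f\<bar> \<le> (pi + 2) * e" if e: "e > 0" for e
  proof -
    obtain p where p: "real_polynomial_function p" "\<And>x. x \<in> {-1..1} \<Longrightarrow> \<bar>f x - p x\<bar> < e"
      using Stone_Weierstrass_real_polynomial_function[OF compact_Icc cont e] by blast
    obtain a n where pa: "p = (\<lambda>x. \<Sum>i\<le>n. a i * x ^ i)"
      using p(1) real_polynomial_function_iff_sum by blast
    have pc: "continuous_on S p" for S unfolding pa by (intro continuous_intros)
    have sc: "\<bar>c * sin t\<bar> \<le> 1" if "0 \<le> c" "c \<le> 1" for c t :: real
      using that abs_sin_le_one[of t] by (simp add: abs_mult mult_le_one)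
    have in1: "\<bar>integral {0..2*pi} (\<lambda>t. p (c * sin t))\<bar> \<le> 2 * pi * e" if c: "0 \<le> c" "c \<le> 1" for c
    proof -
      have ran: "(\<lambda>t. c * sin t) ` {0..2*pi} \<subseteq> {-1..1}" using sc[OF c] by (auto simp: abs_le_iff)
      have i1: "(\<lambda>t. f (c * sin t)) integrable_on {0..2*pi}"
        by (intro integrable_continuous_real continuous_on_compose2[OF cont _ ran] continuous_intros)
      have i2: "(\<lambda>t. p (c * sin t)) integrable_on {0..2*pi}"
        by (intro integrable_continuous_real continuous_on_compose2[OF pc[of UNIV]] continuous_intros) auto
      have "integral {0..2*pi} (\<lambda>t. p (c * sin t)) = integral {0..2*pi} (\<lambda>t. p (c * sin t) - f (c * sin t))"
        using vanish[OF c] by (simp add: integral_diff[OF i2 i1])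
      also have "norm \<dots> \<le> e * (2 * pi - 0)"
      proof (rule integral_bound)
        show "continuous_on {0..2*pi} (\<lambda>t. p (c * sin t) - f (c * sin t))"
          by (intro continuous_on_compose2[OF cont _ ran] continuous_on_compose2[OF pc[of UNIV]] continuous_intros) auto
        show "norm (p (c * sin t) - f (c * sin t)) \<le> e" for t
          using p(2)[of "c * sin t"] sc[OF c, of t] by (auto simp: abs_le_iff)
      qed simp
      finally show ?thesis by (simp add: mult_ac)
    qed
    let ?I = "\<lambda>s. sin s * integral {0..2*pi} (\<lambda>t. p (r * sin s * sin t))"
    have "norm (integral {0..pi/2} ?I) \<le> (2 * pi * e) * (pi/2 - 0)"
    proof (rule integral_bound)
      have "continuous_on {0..pi/2} (\<lambda>s. integral (cbox 0 (2*pi)) (\<lambda>t. p (r * sin s * sin t)))"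
        by (intro integral_continuous_on_param)
          (auto simp: split_beta intro!: continuous_on_compose2[OF pc[of UNIV]] continuous_intros)
      then show "continuous_on {0..pi/2} ?I" by (intro continuous_intros) simp
      fix s assume s: "s \<in> {0..pi/2}"
      have ss: "0 \<le> sin s" "sin s \<le> 1" using s by (auto intro: sin_ge_zero)
      then have "0 \<le> r * sin s" "r * sin s \<le> 1" using r by (auto intro: mult_le_one)
      then have "\<bar>integral {0..2*pi} (\<lambda>t. p (r * sin s * sin t))\<bar> \<le> 2 * pi * e" by (rule in1)
      then show "norm (?I s) \<le> 2 * pi * e"
        using ss mult_mono[of "\<bar>sin s\<bar>" 1 "\<bar>integral {0..2*pi} (\<lambda>t. p (r * sin s * sin t))\<bar>" "2 * pi * e"]
        by (simp add: abs_mult)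
    qed simp
    then have "\<bar>integral {0..pi/2} ?I\<bar> \<le> pi * (pi * e)" by (simp add: mult_ac)
    then have "\<bar>r * integral {0..pi/2} ?I\<bar> \<le> pi * (pi * e)"
      using r mult_mono[of r 1 "\<bar>integral {0..pi/2} ?I\<bar>" "pi * (pi * e)"] by (simp add: abs_mult)
    then have "pi * \<bar>integral {-r..r} p\<bar> \<le> pi * (pi * e)"
      unfolding hat_box_polynomial[OF r(1) pa] by (simp add: abs_mult)
    then have P: "\<bar>integral {-r..r} p\<bar> \<le> pi * e" by simp
    have cr: "continuous_on {-r..r} f" using r by (intro continuous_on_subset[OF cont]) auto
    have "norm (integral {-r..r} (\<lambda>x. f x - p x)) \<le> e * (r - (-r))"
      using r p(2) by (intro integral_bound continuous_intros cr pc) (auto intro!: less_imp_le)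
    also have "\<dots> \<le> e * 2" using r e by simp
    finally have "\<bar>integral {-r..r} f - integral {-r..r} p\<bar> \<le> 2 * e"
      by (subst (asm) integral_diff) (auto intro!: integrable_continuous_real cr pc)
    then show ?thesis using P by (simp add: algebra_simps)
  qed
  show ?thesis
  proof (rule ccontr)
    assume "integral {-r..r} f \<noteq> 0"
    then have p: "\<bar>integral {-r..r} f\<bar> > 0" by simp
    have pp: "pi + 2 > 0" using pi_gt_zero by linarith
    have "(pi + 2) * (\<bar>integral {-r..r} f\<bar> / (2 * (pi + 2))) = \<bar>integral {-r..r} f\<bar> / 2"
      using pp by (simp add: field_simps)
    then show False using bound[of "\<bar>integral {-r..r} f\<bar> / (2 * (pi + 2))"] p pp by simp
  qed
qed

text \<open>The integral of \<open>f x + f (- x)\<close> from 0 to \<open>r\<close> vanishes for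
  every \<open>r\<close> up to 1, hence so does its one-sided derivative at the right end.\<close>

lemma abel_endpoint_vanish:
  fixes f :: "real \<Rightarrow> real"
  assumes cont: "continuous_on {-1..1} f"
    and vanish: "\<And>c. 0 \<le> c \<Longrightarrow> c \<le> 1 \<Longrightarrow> integral {0..2*pi} (\<lambda>t. f (c * sin t)) = 0"
  shows "f 1 + f (-1) = 0"
proof -
  let ?g = "\<lambda>x. f x + f (- x)"
  have cn: "continuous_on {0..1} (\<lambda>x. f (- x))"
    by (rule continuous_on_compose2[OF cont]) (auto intro!: continuous_intros)
  have cf: "continuous_on {0..1} f" by (rule continuous_on_subset[OF cont]) auto
  have z: "integral {0..r} ?g = 0" if r: "r \<in> {0..1}" for r
  proof -
    have i: "f integrable_on {a..b}" if "-1 \<le> a" "b \<le> 1" for a b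
      using that by (intro integrable_continuous_real continuous_on_subset[OF cont]) auto
    have "integral {0..r} ?g = integral {0..r} f + integral {0..r} (\<lambda>x. f (- x))"
      using r cn cf by (intro integral_add integrable_continuous_real) (auto elim: continuous_on_subset)
    also have "integral {0..r} (\<lambda>x. f (- x)) = integral {-r..0} f"
      using Henstock_Kurzweil_Integration.integral_reflect_real[where a="-r" and b=0 and f=f] by simp
    also have "integral {0..r} f + integral {-r..0} f = integral {-r..r} f"
      using Henstock_Kurzweil_Integration.integral_combine[of "-r" 0 r f] r i[of "-r" r] by simp
    also have "\<dots> = 0" using abel_integral_vanish[OF assms] r by simp
    finally show ?thesis .
  qed
  have "((\<lambda>u. integral {0..u} ?g) has_vector_derivative ?g 1) (at 1 within {0..1})"
    by (intro integral_has_vector_derivative continuous_intros cf cn) auto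
  then have "((\<lambda>u. 0) has_vector_derivative ?g 1) (at 1 within {0..1})"
    by (rule has_vector_derivative_transform[rotated 2]) (use z in auto)
  moreover have "((\<lambda>u. 0::real) has_vector_derivative 0) (at 1 within {0..1::real})" by simp
  ultimately have "?g 1 = 0"
    by (rule vector_derivative_unique_within[rotated])
      (simp add: trivial_limit_within islimpt_Icc)
  then show ?thesis by simp
qed

text \<open>Injectivity of the Funk transform on even functions. Averaging \<open>h\<close> over the rotations
  about \<open>x\<close> reduces the claim to the zonal integral equation solved by \<open>abel_endpoint_vanish\<close>.\<close>

lemma funk_transform_injective:
  fixes h :: "real ^ 3 \<Rightarrow> real"
  assumes cont: "continuous_on (sphere 0 1) h"
    and circ: "\<And>w e. orthonormal_pair w e \<Longrightarrow> integral {0..2*pi} (\<lambda>t. h (plane_point w e (cis t))) = 0"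
    and x: "norm x = 1"
  shows "h x + h (- x) = 0"
proof -
  obtain e where xe: "orthonormal_pair x e" using orthonormal_pair_exists[OF x] by blast
  note o = orthonormal_pairD[OF xe]
  define P where "P = (\<lambda>p u. plane_point x e p + u *\<^sub>R x)"
  have xP: "x \<bullet> plane_point x e p = 0" "plane_point x e p \<bullet> x = 0" for p
    using plane_point_perp[of x e p] o by (auto simp: inner_commute)
  have nP: "norm (P p u) = 1" if "(cmod p)\<^sup>2 + u\<^sup>2 = 1" for p u
  proof -
    have "(norm (P p u))\<^sup>2 = (norm (plane_point x e p))\<^sup>2 + u\<^sup>2"
      unfolding power2_norm_eq_inner P_def
      using xP[of p] o by (simp add: inner_add_left inner_add_right power2_eq_square)
    then have "(norm (P p u))\<^sup>2 = 1\<^sup>2" using that norm_plane_point[OF xe] by simp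
    then show ?thesis by (rule power2_eq_imp_eq) auto
  qed
  have cP: "continuous_on S (\<lambda>s. P (f s) (g s))"
    if "continuous_on S f" "continuous_on S g" for S :: "'z::t2_space set" and f g
    unfolding P_def by (intro continuous_intros that)
  have chP: "continuous_on S (\<lambda>s. h (P (f s) (g s)))"
    if "continuous_on S f" "continuous_on S g" "\<And>s. s \<in> S \<Longrightarrow> (cmod (f s))\<^sup>2 + (g s)\<^sup>2 = 1"
    for S :: "'z::t2_space set" and f g
    by (rule continuous_on_compose2[OF cont cP]) (use that nP in auto)
  \<comment> \<open>The integral of \<open>h\<close> over the parallel at height \<open>u\<close>
    with respect to the pole \<open>x\<close>. At heights 1 and -1 the parallel shrinks to a point,
    so the endpoint values recover \<open>h x\<close> and \<open>h (- x)\<close>.\<close>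
  define \<Phi> where "\<Phi> u = integral {0..2*pi} (\<lambda>b. h (P (of_real (sqrt (1 - u\<^sup>2)) * cis b) u))" for u
  have sq: "1 - u\<^sup>2 \<ge> 0" if "u \<in> {-1..1}" for u :: real
    using that abs_square_le_1[of u] by (auto simp: abs_le_iff)
  have c\<Phi>: "continuous_on {-1..1} \<Phi>"
  proof -
    have "continuous_on {-1..1} (\<lambda>u. integral (cbox 0 (2*pi)) (\<lambda>b. h (P (of_real (sqrt (1 - u\<^sup>2)) * cis b) u)))"
      by (rule integral_continuous_on_param, unfold split_beta, rule chP)
        (use sq in \<open>auto intro!: continuous_intros simp: norm_mult\<close>)
    then show ?thesis unfolding \<Phi>_def by simp
  qed
  have van: "integral {0..2*pi} (\<lambda>t. \<Phi> (c * sin t)) = 0" if c: "0 \<le> c" "c \<le> 1" for c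
  proof -
    define d where "d = sqrt (1 - c\<^sup>2)"
    have d2: "d\<^sup>2 = 1 - c\<^sup>2" unfolding d_def using sq[of c] c by simp
    \<comment> \<open>A great circle whose highest point has height \<open>c\<close>:
      \<open>q t\<close> is its projection along \<open>x\<close>, an ellipse with semi-axes 1 and
      \<open>d\<close>, and \<open>c * sin t\<close> is the height.\<close>
    define q where "q = (\<lambda>t. Complex (cos t) (d * sin t))"
    have nq: "(cmod (q t))\<^sup>2 = 1 - (c * sin t)\<^sup>2" for t
      using sin_cos_squared_add[of t] unfolding q_def
      by (simp add: cmod_power2 power_mult_distrib d2 algebra_simps)
    have q_sqrt: "cmod (q t) = sqrt (1 - (c * sin t)\<^sup>2)" for t
      using nq[of t] by (metis norm_ge_zero real_sqrt_unique)
    have cq: "continuous_on S (\<lambda>s. q (f s))" if "continuous_on S f" for S :: "'z::t2_space set" and f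
      unfolding q_def complex_eq by (intro continuous_intros that)
    have inner_t: "integral {0..2*pi} (\<lambda>t. h (P (cis b * q t) (c * sin t))) = 0" for b
    proof -
      define e' where "e' = plane_point x e (cis b)"
      define g where "g = d *\<^sub>R plane_point x e (\<i> * cis b) + c *\<^sub>R x"
      have ee: "e' \<bullet> e' = 1" and xe': "x \<bullet> e' = 0" "e' \<bullet> x = 0"
        unfolding e'_def using plane_point_inner[OF xe, of "cis b" "cis b"] xP[of "cis b"] by (auto simp: inner_commute
            simp flip: power2_eq_square)
      have e'i: "e' \<bullet> plane_point x e (\<i> * cis b) = 0"
        unfolding e'_def plane_point_inner[OF xe] by simp
      have eg: "e' \<bullet> g = 0" unfolding g_def by (simp add: inner_add_right e'i xe')
      have gg: "g \<bullet> g = 1"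
        unfolding g_def using xP[of "\<i> * cis b"] o plane_point_inner[OF xe, of "\<i> * cis b" "\<i> * cis b"] d2
        by (simp add: inner_add_left inner_add_right flip: power2_eq_square)
      have wg: "cross3 (cross3 e' g) e' = g"
        using Lagrange[of e' e' g] eg ee cross_skew[of "cross3 e' g" e'] by simp
      have "norm (cross3 e' g) = 1"
        using norm_cross3_orthogonal[OF eg] ee gg by (simp add: norm_eq_sqrt_inner)
      then have op: "orthonormal_pair (cross3 e' g) e'"
        using ee by (simp add: orthonormal_pair_def norm_eq_sqrt_inner dot_cross_self)
      have "plane_point (cross3 e' g) e' (cis t) = P (cis b * q t) (c * sin t)" for t
        unfolding plane_point_def[of "cross3 e' g"] wg unfolding P_def q_def g_def e'_def
        by (simp add: plane_point_def algebra_simps)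
      then show ?thesis using circ[OF op] by simp
    qed
    have inner_b: "integral {0..2*pi} (\<lambda>b. h (P (cis b * q t) (c * sin t))) = \<Phi> (c * sin t)" for t
    proof -
      let ?f = "\<lambda>b. h (P (of_real (cmod (q t)) * cis b) (c * sin t))"
      have "integral {0..2*pi} (\<lambda>b. ?f (b + Arg2pi (q t))) = integral {0..2*pi} ?f"
      proof (rule integral_periodic_shift)
        show "continuous_on UNIV ?f"
          by (rule chP) (auto intro!: continuous_intros simp: norm_mult nq)
        show "?f (b + 2 * pi) = ?f b" for b by (simp flip: cis_mult)
      qed (auto simp: Arg2pi_ge_0)
      moreover have "of_real (cmod (q t)) * cis (b + Arg2pi (q t)) = cis b * q t" for b
        by (subst (3) Arg2pi_eq) (simp add: cis_conv_exp algebra_simps exp_add)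
      ultimately show ?thesis unfolding \<Phi>_def q_sqrt[symmetric] by simp
    qed
    \<comment> \<open>For fixed \<open>b\<close> the variable \<open>t\<close> runs along a great
      circle, which gives 0; for fixed \<open>t\<close> the variable \<open>b\<close> runs along a
      parallel, which gives \<open>\<Phi>\<close>. Fubini compares the two.\<close>
    have "integral (cbox 0 (2*pi)) (\<lambda>b. integral (cbox 0 (2*pi)) (\<lambda>t. h (P (cis b * q t) (c * sin t)))) =
      integral (cbox 0 (2*pi)) (\<lambda>t. integral (cbox 0 (2*pi)) (\<lambda>b. h (P (cis b * q t) (c * sin t))))"
      by (rule integral_swap_continuous, unfold split_beta, rule chP)
        (auto intro!: continuous_intros cq simp: norm_mult nq)
    then show ?thesis by (simp add: inner_t inner_b)
  qed
  have "\<Phi> 1 + \<Phi> (-1) = 0" by (rule abel_endpoint_vanish[OF c\<Phi> van])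
  moreover have "\<Phi> 1 = 2 * pi * h x" "\<Phi> (-1) = 2 * pi * h (- x)"
    unfolding \<Phi>_def P_def by (simp_all add: plane_point_def)
  ultimately have "2 * pi * (h x + h (- x)) = 0" by (simp add: distrib_left)
  then show ?thesis by simp
qed

section \<open>Level sets of functions invariant under rotations by a fixed angle\<close>

text \<open>Within the plane bisecting \<open>y\<close> and \<open>y'\<close> the coefficient along
  \<open>y + y'\<close> is forced by the inner product \<open>c\<close>, and unit length determines
  \<open>l\<close> up to sign. The hypothesis on \<open>l\<close> is this length condition, left as
  an equation so that the sign stays free.\<close>

lemma equidistant_point:
  fixes y y' :: "real ^ 3"
  assumes "y \<bullet> y = 1" "y' \<bullet> y' = 1" and k: "k = y \<bullet> y'" "\<bar>k\<bar> < 1"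
    and l: "l\<^sup>2 * (1 - k\<^sup>2) = 1 - 2 * c\<^sup>2 / (1 + k)"
  defines "x \<equiv> (c / (1 + k)) *\<^sub>R (y + y') + l *\<^sub>R cross3 y y'"
  shows "x \<bullet> y = c" "x \<bullet> y' = c" "x \<bullet> x = 1"
proof -
  have kk: "1 + k \<noteq> 0" using k(2) by linarith
  have cc: "cross3 y y' \<bullet> cross3 y y' = 1 - k\<^sup>2"
    using norm_cross_dot[of y y'] assms(1,2) k(1) by (simp add: power_mult_distrib power2_norm_eq_inner)
  have yk: "(y + y') \<bullet> y = 1 + k" "(y + y') \<bullet> y' = 1 + k"
    using assms(1,2) k(1) by (simp_all add: inner_add_left inner_commute[of y' y])
  show xy: "x \<bullet> y = c" "x \<bullet> y' = c"
    unfolding x_def using yk kk by (simp_all add: inner_add_left[of "_ *\<^sub>R _"] dot_cross_self)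
  have xc: "x \<bullet> cross3 y y' = l * (1 - k\<^sup>2)"
    unfolding x_def by (simp add: inner_add_left dot_cross_self cc)
  have "x \<bullet> x = (c / (1 + k)) * (x \<bullet> y + x \<bullet> y') + l * (x \<bullet> cross3 y y')"
    by (subst (2) x_def) (simp add: inner_add_right distrib_left)
  also have "\<dots> = 2 * c\<^sup>2 / (1 + k) + l\<^sup>2 * (1 - k\<^sup>2)"
    unfolding xy xc by (simp add: power2_eq_square)
  finally show "x \<bullet> x = 1" using l by simp
qed

text \<open>The cross product has length \<open>\<bar>Im z\<bar>\<close>. Dividing by
  \<open>Im z\<close> with its sign orients the normal so that \<open>x\<close> is turned to
  \<open>y\<close> by \<open>z\<close> and not by its conjugate.\<close>

lemma rotation_between:
  fixes x y :: "real ^ 3"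
  assumes "x \<bullet> x = 1" "y \<bullet> y = 1" "x \<bullet> y = Re z" and z: "cmod z = 1" "Im z \<noteq> 0"
  defines "w \<equiv> (1 / Im z) *\<^sub>R cross3 x y"
  shows "norm w = 1" "w \<bullet> x = 0" "plane_point w x z = y"
proof -
  have zz: "(Re z)\<^sup>2 + (Im z)\<^sup>2 = 1" using z(1) cmod_power2[of z] by simp
  have "(norm (cross3 x y))\<^sup>2 = (Im z)\<^sup>2"
    using norm_cross_dot[of x y] assms(1-3) zz by (simp add: power_mult_distrib power2_norm_eq_inner)
  then have "norm (cross3 x y) = \<bar>Im z\<bar>" by (metis abs_norm_cancel power2_eq_iff_nonneg abs_ge_zero power2_abs)
  then show "norm w = 1" unfolding w_def using z(2) by simp
  show "w \<bullet> x = 0" unfolding w_def by (simp add: dot_cross_self)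
  have "cross3 (cross3 x y) x = y - Re z *\<^sub>R x"
    using Lagrange[of x x y] assms(1,3) cross_skew[of "cross3 x y" x] by simp
  then show "plane_point w x z = y"
    unfolding plane_point_def w_def using z(2) by (simp add: cross_mult_left)
qed

lemma norm_cross3_le: "norm (cross3 x y) \<le> norm x * norm y"
  using norm_cross_dot[of x y]
  by (metis (no_types, opaque_lifting) abs_norm_cancel abs_mult power2_le_imp_le le_add_same_cancel1
      zero_le_power2 mult_nonneg_nonneg norm_ge_zero)

text \<open>The arcs of circles about \<open>x\<close> on which \<open>F\<close> takes the value \<open>G x\<close> cross the great circle
  \<open>w\<^sub>0\<^sup>\<bottom>\<close> in a whole cone of directions; two of them join a point \<open>y'\<close> off the great circle
  to any two nearby points on it.\<close>

lemma rotation_level_locally_constant: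
  fixes F G :: "real ^ 3 \<Rightarrow> 'c"
  assumes z: "cmod z = 1" "Im z \<noteq> 0" and "\<epsilon> > 0" and wp: "orthonormal_pair w\<^sub>0 p"
    and rot: "\<And>w x. norm w = 1 \<Longrightarrow> dist w w\<^sub>0 < \<epsilon> \<Longrightarrow> norm x = 1 \<Longrightarrow> w \<bullet> x = 0 \<Longrightarrow> F (plane_point w x z) = G x"
  shows "\<forall>\<^sub>F t in nhds 0. F (plane_point w\<^sub>0 p (cis t)) = F p"
proof -
  note o = orthonormal_pairD[OF wp]
  define c s where "c = Re z" and "s = Im z"
  have s0: "s \<noteq> 0" and cs: "c\<^sup>2 + s\<^sup>2 = 1"
    using z cmod_power2[of z] by (auto simp: c_def s_def)
  define y where "y = (\<lambda>t. plane_point w\<^sub>0 p (cis t))"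
  \<comment> \<open>\<open>y t\<close> runs along the great circle, while \<open>y' \<sigma>\<close>
    leaves it at a right angle in the direction of \<open>w\<^sub>0\<close>; \<open>k\<close> is
    their inner product.\<close>
  define y' where "y' = (\<lambda>\<sigma>. cos \<sigma> *\<^sub>R p + sin \<sigma> *\<^sub>R w\<^sub>0)"
  define k where "k = (\<lambda>t \<sigma>. cos t * cos \<sigma> :: real)"
  define D where "D = (\<lambda>t \<sigma>. 1 - 2 * c\<^sup>2 / (1 + k t \<sigma>))"
  \<comment> \<open>Of the two equidistant points, the sign of \<open>s\<close> selects the one
    whose rotation normal is near \<open>w\<^sub>0\<close> rather than near its antipode.\<close>
  define l where "l = (\<lambda>t \<sigma>. sgn s * sqrt (D t \<sigma> / (1 - (k t \<sigma>)\<^sup>2)))"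
  define w where "w = (\<lambda>t \<sigma>. (1 / s) *\<^sub>R ((c / (1 + k t \<sigma>)) *\<^sub>R cross3 (y' \<sigma>) (y t) + l t \<sigma> *\<^sub>R (y' \<sigma> - k t \<sigma> *\<^sub>R y t)))"
  define good where "good = (\<lambda>t \<sigma>. D t \<sigma> > 0 \<and> k t \<sigma> < 1 \<and> -1 < k t \<sigma> \<and> dist (w t \<sigma>) w\<^sub>0 < \<epsilon> / 2 \<and> norm (y' \<sigma> - y t) / \<bar>s\<bar> < \<epsilon> / 2)"
  have yy: "y t \<bullet> y t = 1" for t
    unfolding y_def plane_point_inner[OF wp] by (simp flip: power2_eq_square)
  have yy': "y' \<sigma> \<bullet> y' \<sigma> = 1" for \<sigma>
    unfolding y'_def using o by (simp add: inner_add_left inner_add_right flip: power2_eq_square)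
  have kyy': "k t \<sigma> = y t \<bullet> y' \<sigma>" for t \<sigma>
    unfolding y'_def y_def k_def plane_point_def using o
    by (simp add: inner_add_left inner_add_right dot_cross_self)
  have good: "F (y t) = F (y' \<sigma>)" if g: "good t \<sigma>" for t \<sigma>
  proof -
    have D: "D t \<sigma> > 0" and k1: "\<bar>k t \<sigma>\<bar> < 1" and d1: "dist (w t \<sigma>) w\<^sub>0 < \<epsilon> / 2"
      and d2: "norm (y' \<sigma> - y t) / \<bar>s\<bar> < \<epsilon> / 2"
      using g unfolding good_def by auto
    have k2: "1 - (k t \<sigma>)\<^sup>2 > 0" using k1 by (simp add: abs_square_less_1)
    have "(sgn s)\<^sup>2 = 1" using s0 by (simp add: sgn_if)
    then have l: "(l t \<sigma>)\<^sup>2 * (1 - (k t \<sigma>)\<^sup>2) = 1 - 2 * c\<^sup>2 / (1 + k t \<sigma>)"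
      using D k2 unfolding l_def by (simp add: power_mult_distrib D_def)
    define x where "x = (c / (1 + k t \<sigma>)) *\<^sub>R (y t + y' \<sigma>) + l t \<sigma> *\<^sub>R cross3 (y t) (y' \<sigma>)"
    note x = equidistant_point[OF yy[of t] yy'[of \<sigma>] kyy' k1 l, folded x_def, unfolded c_def]
    have nx: "norm x = 1" using x(3) by (simp add: norm_eq_sqrt_inner)
    note r1 = rotation_between[OF x(3) yy x(1) z] and r2 = rotation_between[OF x(3) yy' x(2) z]
    have "cross3 (cross3 (y t) (y' \<sigma>)) (y t) = y' \<sigma> - k t \<sigma> *\<^sub>R y t"
      using Lagrange[of "y t" "y t" "y' \<sigma>"] yy[of t] kyy'[of t \<sigma>]
        cross_skew[of "cross3 (y t) (y' \<sigma>)" "y t"] by simp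
    then have w1: "(1 / Im z) *\<^sub>R cross3 x (y t) = w t \<sigma>"
      unfolding w_def x_def s_def by (simp add: cross_add_left cross_mult_left)
    have "(1 / Im z) *\<^sub>R cross3 x (y' \<sigma>) - w t \<sigma> = (1 / s) *\<^sub>R cross3 x (y' \<sigma> - y t)"
      unfolding w1[symmetric] s_def by (simp add: Cross3.right_diff_distrib scaleR_diff_right)
    then have "dist ((1 / Im z) *\<^sub>R cross3 x (y' \<sigma>)) (w t \<sigma>) \<le> norm (y' \<sigma> - y t) / \<bar>s\<bar>"
      using norm_cross3_le[of x "y' \<sigma> - y t"] nx by (simp add: dist_norm divide_right_mono)
    then have d3: "dist ((1 / Im z) *\<^sub>R cross3 x (y' \<sigma>)) w\<^sub>0 < \<epsilon>"
      using d1 d2 dist_triangle[of "(1 / Im z) *\<^sub>R cross3 x (y' \<sigma>)" w\<^sub>0 "w t \<sigma>"] by linarith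
    have "F (y t) = G x" using rot[OF r1(1) _ nx r1(2)] d1 \<open>\<epsilon> > 0\<close> r1(3) unfolding w1 by simp
    moreover have "F (y' \<sigma>) = G x" using rot[OF r2(1) d3 nx r2(2)] unfolding r2(3) .
    ultimately show ?thesis by simp
  qed
  have y0: "y 0 = p" unfolding y_def by simp
  have "\<forall>\<^sub>F \<sigma> in at_right 0. good 0 \<sigma>"
  proof -
    \<comment> \<open>The expression for \<open>w 0 \<sigma>\<close> is formally 0/0 at
      \<open>\<sigma> = 0\<close>; \<open>m\<close> is the same vector after cancelling
      \<open>sin \<sigma>\<close>, and its limit is \<open>w\<^sub>0\<close>.\<close>
    define m where "m = (\<lambda>\<sigma>. (1 / s) *\<^sub>R ((c / (1 + cos \<sigma>) * sin \<sigma>) *\<^sub>R cross3 w\<^sub>0 p + (sgn s * sqrt (1 - 2 * c\<^sup>2 / (1 + cos \<sigma>))) *\<^sub>R w\<^sub>0))"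
    have sc: "1 - c\<^sup>2 = s\<^sup>2" using cs by simp
    have D0: "1 - 2 * c\<^sup>2 / (1 + 1) = s\<^sup>2" using cs by simp
    have "(m \<longlongrightarrow> (1 / s) *\<^sub>R ((c / (1 + cos 0) * sin 0) *\<^sub>R cross3 w\<^sub>0 p + (sgn s * sqrt (1 - 2 * c\<^sup>2 / (1 + cos 0))) *\<^sub>R w\<^sub>0)) (at_right 0)"
      unfolding m_def by (intro tendsto_intros) auto
    also have "(1 / s) *\<^sub>R ((c / (1 + cos 0) * sin 0) *\<^sub>R cross3 w\<^sub>0 p + (sgn s * sqrt (1 - 2 * c\<^sup>2 / (1 + cos 0))) *\<^sub>R w\<^sub>0) = w\<^sub>0"
      using s0 unfolding cos_zero D0 by (simp add: mult_sgn_abs)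
    finally have m: "\<forall>\<^sub>F \<sigma> in at_right 0. dist (m \<sigma>) w\<^sub>0 < \<epsilon> / 2"
      using \<open>\<epsilon> > 0\<close> by (intro tendstoD) auto
    have "((\<lambda>\<sigma>. norm (y' \<sigma> - p) / \<bar>s\<bar>) \<longlongrightarrow> norm ((cos 0 *\<^sub>R p + sin 0 *\<^sub>R w\<^sub>0) - p) / \<bar>s\<bar>) (at_right 0)"
      unfolding y'_def using s0 by (intro tendsto_intros) auto
    then have n: "\<forall>\<^sub>F \<sigma> in at_right 0. norm (y' \<sigma> - p) / \<bar>s\<bar> < \<epsilon> / 2"
      using \<open>\<epsilon> > 0\<close> by (intro order_tendstoD(2)) auto
    have "((\<lambda>\<sigma>. D 0 \<sigma>) \<longlongrightarrow> 1 - 2 * c\<^sup>2 / (1 + cos 0 * cos 0)) (at_right 0)"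
      unfolding D_def k_def by (intro tendsto_intros) auto
    then have d: "\<forall>\<^sub>F \<sigma> in at_right 0. D 0 \<sigma> > 0"
      using s0 D0 by (intro order_tendstoD(1)) auto
    have "\<forall>\<^sub>F \<sigma> in at_right 0. 0 < \<sigma> \<and> \<sigma> < pi/2"
      by (intro eventually_conj eventually_at_right_less eventually_at_rightI[of 0 "pi/2"]) auto
    with m n d show ?thesis
    proof eventually_elim
      case (elim \<sigma>)
      then have sp: "sin \<sigma> > 0" "cos \<sigma> > 0" by (auto intro!: sin_gt_zero cos_gt_zero)
      then have c1: "cos \<sigma> < 1" by (metis sin_cos_squared_add less_le cos_le_one power_one
            add_right_cancel cos_one_sin_zero less_irrefl)
      have "1 - (cos \<sigma>)\<^sup>2 = (sin \<sigma>)\<^sup>2" by (simp add: sin_squared_eq)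
      then have "sqrt (D 0 \<sigma> / (1 - (k 0 \<sigma>)\<^sup>2)) * sin \<sigma> = sqrt (D 0 \<sigma>)"
        using sp unfolding k_def by (simp add: real_sqrt_divide)
      then have ls: "l 0 \<sigma> * sin \<sigma> = sgn s * sqrt (D 0 \<sigma>)" unfolding l_def by simp
      have "cross3 (y' \<sigma>) (y 0) = sin \<sigma> *\<^sub>R cross3 w\<^sub>0 p" "y' \<sigma> - k 0 \<sigma> *\<^sub>R y 0 = sin \<sigma> *\<^sub>R w\<^sub>0"
        unfolding y0 y'_def k_def by (simp_all add: cross_add_left cross_mult_left)
      then have "w 0 \<sigma> = m \<sigma>"
        unfolding w_def m_def using ls by (simp add: k_def D_def)
      then show ?case unfolding good_def using elim sp c1 y0 by (simp add: k_def)
    qed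
  qed
  then have "\<exists>\<sigma>. good 0 \<sigma>" by (intro eventually_happens'[of "at_right (0::real)"]) auto
  then obtain \<sigma> where \<sigma>: "good 0 \<sigma>" by blast
  \<comment> \<open>With \<open>\<sigma>\<close> fixed the denominators are nonzero, so all
    conditions persist for small \<open>t\<close>; the value at \<open>y' \<sigma>\<close> then
    links \<open>F (y t)\<close> with \<open>F p\<close>.\<close>
  have kpos: "1 + k 0 \<sigma> \<noteq> 0" "1 - (k 0 \<sigma>)\<^sup>2 \<noteq> 0" using \<sigma> unfolding good_def
    by (auto simp: power2_eq_1_iff)
  have cy: "isCont y 0"
    unfolding y_def plane_point_def by simp
  have ck: "isCont (\<lambda>t. k t \<sigma>) 0" unfolding k_def by (intro continuous_intros)
  have cD: "isCont (\<lambda>t. D t \<sigma>) 0" unfolding D_def using kpos by (intro continuous_intros ck)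
  have cw: "isCont (\<lambda>t. w t \<sigma>) 0"
    unfolding w_def l_def using kpos by (intro continuous_intros continuous_cross ck cy cD) auto
  have "\<forall>\<^sub>F t in nhds 0. good t \<sigma>"
    unfolding good_def
  proof (intro eventually_conj)
    have ev: "\<forall>\<^sub>F t in nhds 0. f t < b" if "isCont f 0" "f 0 < b" for f :: "real \<Rightarrow> real" and b
      using that unfolding isCont_def tendsto_at_iff_tendsto_nhds by (rule order_tendstoD(2))
    have ev': "\<forall>\<^sub>F t in nhds 0. b < f t" if "isCont f 0" "b < f 0" for f :: "real \<Rightarrow> real" and b
      using that unfolding isCont_def tendsto_at_iff_tendsto_nhds by (rule order_tendstoD(1))
    note g = \<sigma>[unfolded good_def]
    show "\<forall>\<^sub>F t in nhds 0. D t \<sigma> > 0" using g by (intro ev' cD) auto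
    show "\<forall>\<^sub>F t in nhds 0. k t \<sigma> < 1" using g by (intro ev ck) auto
    show "\<forall>\<^sub>F t in nhds 0. -1 < k t \<sigma>" using g by (intro ev' ck) auto
    show "\<forall>\<^sub>F t in nhds 0. dist (w t \<sigma>) w\<^sub>0 < \<epsilon> / 2" using g by (intro ev continuous_intros cw) auto
    show "\<forall>\<^sub>F t in nhds 0. norm (y' \<sigma> - y t) / \<bar>s\<bar> < \<epsilon> / 2"
      using g s0 by (intro ev continuous_intros cy) auto
  qed
  then show ?thesis
  proof eventually_elim
    case (elim t)
    then show ?case using good[OF elim] good[OF \<sigma>] unfolding y0 by (simp add: y_def)
  qed
qed

text \<open>Local constancy holds at each point of the great circle, so the derivative along it is
  zero and the values half a turn apart agree.\<close>

lemma rotation_level_even: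
  fixes F G :: "real ^ 3 \<Rightarrow> real"
  assumes z: "cmod z = 1" "Im z \<noteq> 0" and "\<epsilon> > 0" and wp: "orthonormal_pair w\<^sub>0 p"
    and rot: "\<And>w x. norm w = 1 \<Longrightarrow> dist w w\<^sub>0 < \<epsilon> \<Longrightarrow> norm x = 1 \<Longrightarrow> w \<bullet> x = 0 \<Longrightarrow> F (plane_point w x z) = G x"
  shows "F (- p) = F p"
proof -
  let ?f = "\<lambda>t. F (plane_point w\<^sub>0 p (cis t))"
  have "(?f has_real_derivative 0) (at t)" for t
  proof -
    have op: "orthonormal_pair w\<^sub>0 (plane_point w\<^sub>0 p (cis t))"
      using orthonormal_pair_plane_point[OF wp] by simp
    have "\<forall>\<^sub>F h in nhds 0. F (plane_point w\<^sub>0 (plane_point w\<^sub>0 p (cis t)) (cis h)) = ?f t"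
      by (rule rotation_level_locally_constant[where F = F and G = G, OF z \<open>\<epsilon> > 0\<close> op rot])
    then have "\<forall>\<^sub>F h in nhds 0. ?f (t + h) = ?f t"
      unfolding plane_point_mult[OF wp] by (simp add: cis_mult)
    moreover have "((\<lambda>s. s - t) \<longlongrightarrow> t - t) (nhds t)"
      by (intro tendsto_intros filterlim_ident)
    ultimately have "\<forall>\<^sub>F s in nhds t. ?f (t + (s - t)) = ?f t"
      unfolding diff_self by (rule eventually_compose_filterlim)
    then have "\<forall>\<^sub>F s in nhds t. ?f s = ?f t" by simp
    then show ?thesis
      by (subst DERIV_cong_ev[OF refl _ refl]) auto
  qed
  then have "?f 0 = ?f pi" by (intro DERIV_isconst_all) auto
  then show ?thesis by (simp add: cis_pi)
qed

section \<open>Sections over the two-sphere\<close>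

lemma sphere3_cover_closed:
  fixes A B :: "(real ^ 3) set"
  assumes "closed A" "closed B" "sphere 0 1 \<subseteq> A \<union> B" "A \<inter> B \<inter> sphere 0 1 = {}"
  shows "sphere 0 1 \<subseteq> A \<or> sphere 0 1 \<subseteq> B"
proof -
  have "connected (sphere (0 :: real ^ 3) 1)" by (intro connected_sphere) simp
  from connected_closedD[OF this assms(4,3,1,2)] show ?thesis using assms(3) by blast
qed

text \<open>A finite Baire argument: either \<open>U\<close> lies in one of the closed sets, or
  removing that set leaves a nonempty open set covered by fewer of them.\<close>

lemma finite_closed_cover_interior:
  assumes "finite Z" "\<And>z. z \<in> Z \<Longrightarrow> closed (C z)" "openin (top_of_set S) U" "U \<noteq> {}" "U \<subseteq> (\<Union>z\<in>Z. C z)"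
  shows "\<exists>z\<in>Z. \<exists>V. openin (top_of_set S) V \<and> V \<noteq> {} \<and> V \<subseteq> U \<inter> C z"
  using assms
proof (induction Z arbitrary: U)
  case (insert a Z)
  show ?case
  proof (cases "U \<subseteq> C a")
    case True
    then show ?thesis using insert.prems by blast
  next
    case False
    have "openin (top_of_set S) (U - C a)"
      using insert.prems by (metis Diff_eq insertI1 open_Compl openin_Int_open)
    moreover have "U - C a \<noteq> {}" "U - C a \<subseteq> (\<Union>z\<in>Z. C z)"
      using False insert.prems by auto
    ultimately obtain z V where "z \<in> Z" "openin (top_of_set S) V" "V \<noteq> {}" "V \<subseteq> (U - C a) \<inter> C z"
      using insert.IH[of "U - C a"] insert.prems(1) by blast
    then show ?thesis by blast
  qed
qed auto

text \<open>Agreement is a closed condition for each probe \<open>p\<close> and coordinate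
  \<open>q\<close>. With \<open>t\<close> ranging over frames and angles, projecting this compact
  set shows that the existence of a suitable angle is a closed condition on the normal.\<close>

lemma compact_agreement_set:
  fixes H H' :: "real ^ 3 \<Rightarrow> 'q \<Rightarrow> real" and B :: "'t::t2_space set"
  assumes H: "\<And>q. continuous_on (sphere 0 1) (\<lambda>x. H x q)" and H': "\<And>q. continuous_on (sphere 0 1) (\<lambda>x. H' x q)"
    and B: "compact B"
    and a: "\<And>p. p \<in> I \<Longrightarrow> continuous_on B (a p)" "\<And>p t. p \<in> I \<Longrightarrow> t \<in> B \<Longrightarrow> norm (a p t) = 1"
    and b: "\<And>p. p \<in> I \<Longrightarrow> continuous_on B (b p)" "\<And>p t. p \<in> I \<Longrightarrow> t \<in> B \<Longrightarrow> norm (b p t) = 1"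
  shows "compact {t \<in> B. \<forall>p\<in>I. H (a p t) = H' (b p t)}"
proof -
  have "closed (B \<inter> (\<lambda>t. H (a p t) q - H' (b p t) q) -` {0})" if "p \<in> I" for p q
    by (intro continuous_closed_preimage compact_imp_closed B continuous_intros
        continuous_on_compose2[OF H a(1)] continuous_on_compose2[OF H' b(1)]) (use that a b in auto)
  then have "closed (\<Inter>p\<in>I. \<Inter>q. B \<inter> (\<lambda>t. H (a p t) q - H' (b p t) q) -` {0})"
    by (intro closed_INT) blast
  then have "compact (B \<inter> (\<Inter>p\<in>I. \<Inter>q. B \<inter> (\<lambda>t. H (a p t) q - H' (b p t) q) -` {0}))"
    by (rule compact_Int_closed[OF B])
  also have "B \<inter> (\<Inter>p\<in>I. \<Inter>q. B \<inter> (\<lambda>t. H (a p t) q - H' (b p t) q) -` {0}) =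
    {t \<in> B. \<forall>p\<in>I. H (a p t) = H' (b p t)}"
    by (auto simp: fun_eq_iff)
  finally show ?thesis .
qed

lemma compact_orthonormal_pairs: "compact {(w, e). orthonormal_pair w e}"
proof -
  have "closed (UNIV \<inter> (\<lambda>(w :: real ^ 3, e). w \<bullet> e) -` {0})"
    by (intro continuous_closed_preimage) (auto simp: split_beta intro!: continuous_intros)
  then have "compact ((sphere 0 1 \<times> sphere 0 1) \<inter> (UNIV \<inter> (\<lambda>(w :: real ^ 3, e). w \<bullet> e) -` {0}))"
    by (intro compact_Int_closed compact_Times) auto
  also have "(sphere 0 1 \<times> sphere 0 1) \<inter> (UNIV \<inter> (\<lambda>(w :: real ^ 3, e). w \<bullet> e) -` {0}) = {(w, e). orthonormal_pair w e}"
    by (auto simp: orthonormal_pair_def)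
  finally show ?thesis .
qed

text \<open>Rotating a great circle does not change the integral of a real function of the colour
  along it. By injectivity of the Funk transform such functions have equal sums over antipodal
  pairs, and a bump at the colour \<open>H x\<close> detects whether that colour occurs in the pair
  of \<open>H'\<close>.\<close>

lemma colour_agree_antipodal:
  fixes H H' :: "real ^ 3 \<Rightarrow> 'q \<Rightarrow> real"
  assumes H: "\<And>q. continuous_on (sphere 0 1) (\<lambda>x. H x q)" and H': "\<And>q. continuous_on (sphere 0 1) (\<lambda>x. H' x q)"
    and rot: "\<And>w. norm w = 1 \<Longrightarrow> \<exists>z. cmod z = 1 \<and> (\<forall>x. norm x = 1 \<longrightarrow> w \<bullet> x = 0 \<longrightarrow> H (plane_point w x z) = H' x)"
    and x: "norm x = 1"
  shows "H x = H' x \<or> H x = H' (- x)"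
proof (rule ccontr)
  assume "\<not> ?thesis"
  then obtain q\<^sub>1 q\<^sub>2 where q: "H x q\<^sub>1 \<noteq> H' x q\<^sub>1" "H x q\<^sub>2 \<noteq> H' (- x) q\<^sub>2" by (auto simp: fun_eq_iff)
  define \<epsilon> where "\<epsilon> = min \<bar>H' x q\<^sub>1 - H x q\<^sub>1\<bar> \<bar>H' (- x) q\<^sub>2 - H x q\<^sub>2\<bar>"
  have \<epsilon>: "\<epsilon> > 0" using q unfolding \<epsilon>_def by auto
  \<comment> \<open>A tent of height \<epsilon> at the colour \<open>H x\<close>. Each of
    \<open>H' x\<close> and \<open>H' (- x)\<close> differs from it by at least \<epsilon> in one of
    the two recorded coordinates, so the tent vanishes at both.\<close>
  define \<psi> where "\<psi> c = max 0 (\<epsilon> - (\<bar>c q\<^sub>1 - H x q\<^sub>1\<bar> + \<bar>c q\<^sub>2 - H x q\<^sub>2\<bar>))" for c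
  have cont: "continuous_on (sphere 0 1) (\<lambda>x. \<psi> (H x))" "continuous_on (sphere 0 1) (\<lambda>x. \<psi> (H' x))"
    unfolding \<psi>_def by (intro continuous_intros H H')+
  have "(\<psi> (H x) - \<psi> (H' x)) + (\<psi> (H (- x)) - \<psi> (H' (- x))) = 0"
  proof (rule funk_transform_injective[OF _ _ x])
    show "continuous_on (sphere 0 1) (\<lambda>x. \<psi> (H x) - \<psi> (H' x))"
      by (intro continuous_intros cont)
    fix w e assume we: "orthonormal_pair w e"
    obtain z where z: "cmod z = 1" "\<And>x. norm x = 1 \<Longrightarrow> w \<bullet> x = 0 \<Longrightarrow> H (plane_point w x z) = H' x"
      using rot[OF orthonormal_pairD(1)[OF we]] by blast
    define a where "a = Arg2pi z"
    have za: "z = cis a" unfolding a_def cis_conv_exp using Arg2pi_eq[of z] z(1) by (metis mult_1 of_real_1)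
    have sph: "plane_point w e (cis t) \<in> sphere 0 1" for t
      using norm_plane_point[OF we] by simp
    have H'H: "H' (plane_point w e (cis t)) = H (plane_point w e (cis (t + a)))" for t
      using z(2)[of "plane_point w e (cis t)"] norm_plane_point[OF we] plane_point_perp[OF orthonormal_pairD(3)[OF we]]
      unfolding plane_point_mult[OF we] za by (simp add: cis_mult)
    have c: "continuous_on UNIV (\<lambda>t. \<psi> (H (plane_point w e (cis t))))"
      "continuous_on UNIV (\<lambda>t. \<psi> (H' (plane_point w e (cis t))))"
      by (rule continuous_on_compose2[OF cont(1)] continuous_on_compose2[OF cont(2)];
          use sph in \<open>auto intro!: continuous_intros\<close>)+
    have "integral {0..2*pi} (\<lambda>t. \<psi> (H' (plane_point w e (cis t)))) = integral {0..2*pi} (\<lambda>t. \<psi> (H (plane_point w e (cis t))))"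
      unfolding H'H by (rule integral_periodic_shift[OF c(1)])
        (auto simp: a_def Arg2pi_ge_0 simp flip: cis_mult)
    then show "integral {0..2*pi} (\<lambda>t. \<psi> (H (plane_point w e (cis t))) - \<psi> (H' (plane_point w e (cis t)))) = 0"
      by (subst integral_diff) (auto intro!: integrable_continuous_real continuous_on_subset[OF c(1)] continuous_on_subset[OF c(2)])
  qed
  moreover have "\<psi> (H x) = \<epsilon>" "\<psi> (H (- x)) \<ge> 0" "\<psi> (H' x) = 0" "\<psi> (H' (- x)) = 0"
    using \<epsilon> by (auto simp: \<psi>_def \<epsilon>_def)
  ultimately show False using \<epsilon> by linarith
qed

text \<open>The image of the first basis vector under the least rotation taking the third one to \<open>w\<close>.\<close>

definition polar_frame :: "real ^ 3 \<Rightarrow> real ^ 3" where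
  "polar_frame w = axis 1 1 - (w $ 1 / (1 + w $ 3)) *\<^sub>R (axis 3 1 + w)"

text \<open>The closed upper hemisphere as a graph over the unit disc; it avoids the south pole,
  where \<open>polar_frame\<close> is singular.\<close>

definition hemisphere_point :: "complex \<Rightarrow> real ^ 3" where
  "hemisphere_point u = Re u *\<^sub>R axis 1 1 + Im u *\<^sub>R axis 2 1 + sqrt (1 - (cmod u)\<^sup>2) *\<^sub>R axis 3 1"

lemma hemisphere_point_nth:
  "hemisphere_point u $ 1 = Re u" "hemisphere_point u $ 2 = Im u" "hemisphere_point u $ 3 = sqrt (1 - (cmod u)\<^sup>2)"
  by (simp_all add: hemisphere_point_def axis_def)

lemma norm_hemisphere_point:
  assumes "cmod u \<le> 1"
  shows "norm (hemisphere_point u) = 1"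
proof -
  have "(cmod u)\<^sup>2 \<le> 1" using assms by (simp add: power_le_one)
  then have "hemisphere_point u \<bullet> hemisphere_point u = 1"
    unfolding inner_vec_def sum_3 hemisphere_point_nth inner_real_def
    by (simp add: cmod_power2) (simp add: power2_eq_square)
  then show ?thesis by (simp add: norm_eq_sqrt_inner)
qed

lemma orthonormal_polar_frame:
  fixes w :: "real ^ 3"
  assumes "norm w = 1" "w $ 3 \<noteq> -1"
  shows "orthonormal_pair w (polar_frame w)"
proof -
  have ww: "w \<bullet> w = 1" using assms(1) by (simp add: dot_square_norm)
  have ax: "w \<bullet> axis 1 1 = w $ 1" "w \<bullet> axis 3 1 = w $ 3" "axis 3 1 \<bullet> w = w $ 3" "axis 1 1 \<bullet> w = w $ 1"
    "axis 1 1 \<bullet> (axis 3 1 :: real ^ 3) = 0" "axis 3 1 \<bullet> (axis 1 1 :: real ^ 3) = 0"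
    "axis 3 1 \<bullet> (axis 3 1 :: real ^ 3) = 1" "axis 1 1 \<bullet> (axis 1 1 :: real ^ 3) = 1"
    by (simp_all add: inner_axis inner_axis_axis inner_commute) (simp_all add: axis_def)
  have n0: "1 + w $ 3 \<noteq> 0" using assms(2) by linarith
  have wE: "w \<bullet> polar_frame w = 0"
    unfolding polar_frame_def by (simp add: inner_diff_right inner_add_right ax ww n0 add.commute)
  have "polar_frame w \<bullet> polar_frame w = axis 1 1 \<bullet> polar_frame w - (w $ 1 / (1 + w $ 3)) * (axis 3 1 \<bullet> polar_frame w + w \<bullet> polar_frame w)"
    by (subst (1) polar_frame_def) (simp add: inner_diff_left inner_add_left)
  also have "\<dots> = 1"
    unfolding wE unfolding polar_frame_def by (simp add: inner_diff_right inner_add_right ax n0)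
  finally show ?thesis using wE assms(1) by (simp add: orthonormal_pair_def norm_eq_sqrt_inner)
qed

text \<open>Against the tangent \<tau> of the equator the polar frame turns once as \<open>u\<close>
  goes round. At the antipode both the tangent and \<open>u\<close> change sign, so the same \<tau>
  and the same factor serve there and the two frames can be compared.\<close>

lemma polar_frame_equator:
  assumes "cmod u = 1"
  defines "w \<equiv> hemisphere_point u" and "\<tau> \<equiv> - Im u *\<^sub>R axis 1 1 + Re u *\<^sub>R axis 2 1 :: real ^ 3"
  shows "orthonormal_pair w \<tau>" "polar_frame w = plane_point w \<tau> (- \<i> * cnj u)"
    "hemisphere_point (- u) = - w" "polar_frame (- w) = plane_point (- w) \<tau> (- \<i> * cnj u)"
proof -
  have u: "(Re u)\<^sup>2 + (Im u)\<^sup>2 = 1" using assms(1) by (simp flip: cmod_power2)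
  have w: "w = Re u *\<^sub>R axis 1 1 + Im u *\<^sub>R axis 2 1"
    unfolding w_def hemisphere_point_def using assms(1) by simp
  have nth: "w $ 1 = Re u" "w $ 2 = Im u" "w $ 3 = 0" "\<tau> $ 1 = - Im u" "\<tau> $ 2 = Re u" "\<tau> $ 3 = 0"
    unfolding w \<tau>_def by (simp_all add: axis_def)
  have wt: "cross3 w \<tau> = axis 3 1"
    unfolding vec_eq_iff forall_3 cross_components nth using u by (simp add: axis_def power2_eq_square)
  show "orthonormal_pair w \<tau>"
    using u unfolding orthonormal_pair_def norm_eq_sqrt_inner inner_vec_def sum_3 nth inner_real_def
    by (simp add: power2_eq_square add.commute)
  show "polar_frame w = plane_point w \<tau> (- \<i> * cnj u)"
    unfolding polar_frame_def plane_point_def wt vec_eq_iff forall_3 using u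
    by (simp add: nth axis_def power2_eq_square algebra_simps)
  show "hemisphere_point (- u) = - w" unfolding w_def hemisphere_point_def using assms(1) by simp
  show "polar_frame (- w) = plane_point (- w) \<tau> (- \<i> * cnj u)"
    unfolding polar_frame_def plane_point_def cross_minus_left wt vec_eq_iff forall_3 using u
    by (simp add: nth axis_def power2_eq_square algebra_simps)
qed

text \<open>A continuous unimodular function on the closed disc has a continuous logarithm, so the
  product of its values at antipodal boundary points cannot wind.\<close>

lemma no_antipodal_winding:
  fixes f :: "complex \<Rightarrow> complex"
  assumes cont: "continuous_on (cball 0 1) f" and nz: "\<And>u. u \<in> cball 0 1 \<Longrightarrow> f u \<noteq> 0"
    and bd: "\<And>u. cmod u = 1 \<Longrightarrow> f u * f (- u) = u ^ n"
  shows "n = 0"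
proof -
  obtain g where g: "continuous_on (cball 0 1) g" "\<And>u. u \<in> cball 0 1 \<Longrightarrow> f u = exp (g u)"
    using continuous_logarithm_on_cball[OF cont nz] by blast
  \<comment> \<open>\<open>k\<close> takes values in a discrete set, hence is constant. At 0 and
    \<open>pi\<close> the same two logarithms occur, so equality of these values isolates the term
    with \<open>n\<close>.\<close>
  define k where "k t = g (cis t) + g (- cis t) - of_nat n * (\<i> * of_real t)" for t
  have k1: "exp (k t) = 1" for t
  proof -
    have "exp (g (cis t) + g (- cis t)) = cis t ^ n"
      using g(2)[of "cis t"] g(2)[of "- cis t"] bd[of "cis t"] by (simp add: exp_add)
    moreover have "cis t ^ n = exp (of_nat n * (\<i> * of_real t))"
      by (simp add: cis_conv_exp exp_of_nat_mult)
    ultimately show ?thesis unfolding k_def by (simp add: exp_diff)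
  qed
  have ck: "continuous_on UNIV k"
    unfolding k_def by (intro continuous_intros continuous_on_compose2[OF g(1)]) auto
  have "k constant_on UNIV"
  proof (rule continuous_discrete_range_constant[OF connected_UNIV ck])
    fix x :: real
    show "\<exists>e>0. \<forall>y. y \<in> UNIV \<and> k y \<noteq> k x \<longrightarrow> e \<le> norm (k y - k x)"
    proof (intro exI[of _ 1] conjI allI impI)
      fix y assume ne: "y \<in> UNIV \<and> k y \<noteq> k x"
      obtain m :: int where m: "k y = k x + of_int (2 * m) * of_real pi * \<i>"
        using k1[of x] k1[of y] exp_eq[of "k y" "k x"] by auto
      then have "m \<noteq> 0" using ne by auto
      then have "1 \<le> \<bar>real_of_int m\<bar>" by linarith
      then have "1 * 1 \<le> \<bar>real_of_int m\<bar> * (2 * pi)" using pi_gt3 by (intro mult_mono) auto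
      then show "1 \<le> norm (k y - k x)" unfolding m by (simp add: norm_mult)
    qed simp
  qed
  then have "k 0 = k pi" unfolding constant_on_def by auto
  then show ?thesis unfolding k_def by (simp add: cis_pi)
qed

section \<open>Colourings with congruent restrictions to great circles\<close>

text \<open>A colour is a function on \<open>'q\<close>, and \<iota> acts on colours as the reversal
  of the axis. \<open>no_half_turn\<close> and \<open>no_flip\<close> stand for the absence of
  symmetries about \<zeta> and about directions orthogonal to it.\<close>

locale congruent_colourings =
  fixes F G :: "real ^ 3 \<Rightarrow> 'q \<Rightarrow> real" and \<iota> :: "'q \<Rightarrow> 'q"
  assumes continuous_F: "\<And>q. continuous_on (sphere 0 1) (\<lambda>x. F x q)"
    and continuous_G: "\<And>q. continuous_on (sphere 0 1) (\<lambda>x. G x q)"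
    and no_half_turn: "\<And>w. norm w = 1 \<Longrightarrow> \<exists>x. norm x = 1 \<and> w \<bullet> x = 0 \<and> F (- x) \<noteq> F x"
    and no_flip: "\<And>w e v. orthonormal_pair w e \<Longrightarrow> cmod v = 1 \<Longrightarrow>
      \<exists>p. cmod p = 1 \<and> F (plane_point w e (v * cnj p)) \<noteq> F (plane_point w e p) \<circ> \<iota>"
begin

definition rotates :: "real ^ 3 \<Rightarrow> complex \<Rightarrow> bool" where
  "rotates w z \<longleftrightarrow> (\<forall>x. norm x = 1 \<longrightarrow> w \<bullet> x = 0 \<longrightarrow> F (plane_point w x z) = G x)"

definition flips :: "real ^ 3 \<Rightarrow> real ^ 3 \<Rightarrow> complex \<Rightarrow> bool" where
  "flips w e v \<longleftrightarrow> (\<forall>p. cmod p = 1 \<longrightarrow> F (plane_point w e (v * cnj p)) = G (plane_point w e p) \<circ> \<iota>)"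

lemma rotates_frame:
  assumes "orthonormal_pair w e"
  shows "rotates w z \<longleftrightarrow> (\<forall>p. cmod p = 1 \<longrightarrow> F (plane_point w e (p * z)) = G (plane_point w e p))"
proof
  assume r: "rotates w z"
  show "\<forall>p. cmod p = 1 \<longrightarrow> F (plane_point w e (p * z)) = G (plane_point w e p)"
    using r norm_plane_point[OF assms] plane_point_perp[OF orthonormal_pairD(3)[OF assms]]
    unfolding rotates_def by (metis plane_point_mult[OF assms])
next
  assume r: "\<forall>p. cmod p = 1 \<longrightarrow> F (plane_point w e (p * z)) = G (plane_point w e p)"
  show "rotates w z"
    unfolding rotates_def
  proof (intro allI impI)
    fix x assume "norm x = 1" "w \<bullet> x = 0"
    then obtain p where "x = plane_point w e p" "cmod p = 1" using plane_point_ex[OF assms] by metis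
    then show "F (plane_point w x z) = G x" using r by (simp add: plane_point_mult[OF assms])
  qed
qed

text \<open>A reflection determines the line of its axis, and its parameter is the square of a unit
  vector on that line; hence a change of frame enters squared, unlike for rotations, whose parameter
  is independent of the frame.\<close>

lemma flips_plane_point:
  assumes "orthonormal_pair w e" "cmod b = 1" "flips w (plane_point w e b) v"
  shows "flips w e (b\<^sup>2 * v)"
  unfolding flips_def
proof (intro allI impI)
  fix p :: complex assume p: "cmod p = 1"
  have bb: "b * cnj b = 1" using assms(2) complex_norm_square[of b] by simp
  have "cmod (cnj b * p) = 1" using assms(2) p by (simp add: norm_mult)
  then have "F (plane_point w (plane_point w e b) (v * cnj (cnj b * p))) = G (plane_point w (plane_point w e b) (cnj b * p)) \<circ> \<iota>"
    using assms(3) unfolding flips_def by blast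
  then have "F (plane_point w e (b * (v * cnj (cnj b * p)))) = G (plane_point w e (b * (cnj b * p))) \<circ> \<iota>"
    unfolding plane_point_mult[OF assms(1)] .
  moreover have "b * (v * cnj (cnj b * p)) = b\<^sup>2 * v * cnj p" by (simp add: power2_eq_square)
  moreover have "b * (cnj b * p) = p" using bb by (simp add: mult.assoc[symmetric])
  ultimately show "F (plane_point w e (b\<^sup>2 * v * cnj p)) = G (plane_point w e p) \<circ> \<iota>" by (simp only:)
qed

lemma flips_uminus:
  assumes "flips (- w) e v"
  shows "flips w e (cnj v)"
  unfolding flips_def
proof (intro allI impI)
  fix p :: complex assume "cmod p = 1"
  then have "cmod (cnj p) = 1" by simp
  then show "F (plane_point w e (cnj v * cnj p)) = G (plane_point w e p) \<circ> \<iota>"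
    using assms unfolding flips_def plane_point_uminus_left by fastforce
qed

lemma continuous_G_flip: "continuous_on (sphere 0 1) (\<lambda>x. (G x \<circ> \<iota>) q)"
  using continuous_G[of "\<iota> q"] by simp

lemma closed_rotates: "closed {w. norm w = 1 \<and> rotates w z}" if "cmod z = 1"
proof -
  let ?B = "{(w, e). orthonormal_pair w e}"
  have "compact {t \<in> ?B. \<forall>p\<in>{p. cmod p = 1}.
    F (plane_point (fst t) (snd t) (p * z)) = G (plane_point (fst t) (snd t) p)}"
    by (rule compact_agreement_set[OF continuous_F continuous_G compact_orthonormal_pairs])
      (use that in \<open>auto intro!: continuous_intros simp: norm_plane_point norm_mult\<close>)
  then have "compact (fst ` {t \<in> ?B. \<forall>p\<in>{p. cmod p = 1}.
    F (plane_point (fst t) (snd t) (p * z)) = G (plane_point (fst t) (snd t) p)})"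
    by (intro compact_continuous_image continuous_intros)
  also have "fst ` {t \<in> ?B. \<forall>p\<in>{p. cmod p = 1}.
    F (plane_point (fst t) (snd t) (p * z)) = G (plane_point (fst t) (snd t) p)} = {w. norm w = 1 \<and> rotates w z}"
    using rotates_frame by (auto simp: image_iff dest: orthonormal_pairD(1)) (metis orthonormal_pair_exists)
  finally show ?thesis by (rule compact_imp_closed)
qed

lemma closed_ex_rotates: "closed {w. norm w = 1 \<and> (\<exists>z. cmod z = 1 \<and> rotates w z)}"
proof -
  let ?B = "{(w, e). orthonormal_pair w e} \<times> sphere 0 1"
  let ?S = "{t \<in> ?B. \<forall>p\<in>{p. cmod p = 1}.
    F (plane_point (fst (fst t)) (snd (fst t)) (p * snd t)) = G (plane_point (fst (fst t)) (snd (fst t)) p)}"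
  have "compact ?S"
    by (rule compact_agreement_set[OF continuous_F continuous_G compact_Times[OF compact_orthonormal_pairs compact_sphere]])
      (auto intro!: continuous_intros simp: norm_plane_point norm_mult)
  then have "compact ((\<lambda>t. fst (fst t)) ` ?S)"
    by (intro compact_continuous_image continuous_intros)
  also have "(\<lambda>t. fst (fst t)) ` ?S = {w. norm w = 1 \<and> (\<exists>z. cmod z = 1 \<and> rotates w z)}"
  proof safe
    fix w z assume w: "norm w = 1" "cmod z = 1" "rotates w z"
    obtain e where e: "orthonormal_pair w e" using orthonormal_pair_exists[OF w(1)] .
    then have "((w, e), z) \<in> ?S" using w rotates_frame[OF e] by auto
    then show "w \<in> (\<lambda>t. fst (fst t)) ` ?S" by force
  qed (use rotates_frame orthonormal_pairD(1) in auto)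
  finally show ?thesis by (rule compact_imp_closed)
qed

lemma closed_ex_flips: "closed {w. \<exists>e v. orthonormal_pair w e \<and> cmod v = 1 \<and> flips w e v}"
proof -
  let ?B = "{(w, e). orthonormal_pair w e} \<times> sphere 0 1"
  let ?S = "{t \<in> ?B. \<forall>p\<in>{p. cmod p = 1}.
    F (plane_point (fst (fst t)) (snd (fst t)) (snd t * cnj p)) = G (plane_point (fst (fst t)) (snd (fst t)) p) \<circ> \<iota>}"
  have "compact ?S"
    by (rule compact_agreement_set[where H' = "\<lambda>x. G x \<circ> \<iota>",
          OF continuous_F continuous_G_flip compact_Times[OF compact_orthonormal_pairs compact_sphere]])
      (auto intro!: continuous_intros simp: norm_plane_point norm_mult)
  then have "compact ((\<lambda>t. fst (fst t)) ` ?S)"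
    by (intro compact_continuous_image continuous_intros)
  also have "(\<lambda>t. fst (fst t)) ` ?S = {w. \<exists>e v. orthonormal_pair w e \<and> cmod v = 1 \<and> flips w e v}"
  proof safe
    fix w e v assume w: "orthonormal_pair w e" "cmod v = 1" "flips w e v"
    then have "((w, e), v) \<in> ?S" by (auto simp: flips_def)
    then show "w \<in> (\<lambda>t. fst (fst t)) ` ?S" by force
  qed (auto simp: flips_def)
  finally show ?thesis by (rule compact_imp_closed)
qed

text \<open>Eliminating \<open>G\<close> between the two relations leaves a reflection symmetry of
  \<open>F\<close> with parameter \<open>v * z\<close>, which \<open>no_flip\<close>
  forbids.\<close>

lemma not_rotates_and_flips:
  assumes "orthonormal_pair w e" "cmod z = 1" "cmod v = 1" "rotates w z" "flips w e v"
  shows False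
proof -
  have zz: "z * cnj z = 1" using assms(2) complex_norm_square[of z] by simp
  obtain p where p: "cmod p = 1" "F (plane_point w e (v * z * cnj p)) \<noteq> F (plane_point w e p) \<circ> \<iota>"
    using no_flip[OF assms(1), of "v * z"] assms(2,3) by (auto simp: norm_mult)
  have n: "cmod (p * cnj z) = 1" using p(1) assms(2) by (simp add: norm_mult)
  have "F (plane_point w e (v * cnj (p * cnj z))) = G (plane_point w e (p * cnj z)) \<circ> \<iota>"
    using assms(5) n unfolding flips_def by blast
  moreover have "F (plane_point w e (p * cnj z * z)) = G (plane_point w e (p * cnj z))"
    using assms(4) n unfolding rotates_frame[OF assms(1)] by blast
  moreover have "p * cnj z * z = p" using zz by (simp add: mult.assoc mult.commute[of "cnj z"])
  moreover have "v * cnj (p * cnj z) = v * z * cnj p" by simp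
  ultimately show False using p(2) by metis
qed

section \<open>Rotations preserving unordered antipodal pairs of colours\<close>

text \<open>Unordered pairs let one group serve both cases: the quotient of two flips at
  \<open>w\<close> preserves \<open>F\<close> itself, while a rotation relating \<open>F\<close> to
  \<open>G\<close> is only known to preserve the pairs that the Funk transform shows them to
  share.\<close>

definition antipodal_stabiliser :: "(((real ^ 3) \<times> (real ^ 3)) \<times> complex) set" where
  "antipodal_stabiliser = {((w, e), z). orthonormal_pair w e \<and> cmod z = 1 \<and>
    (\<forall>p. cmod p = 1 \<longrightarrow> {F (plane_point w e (p * z)), F (- plane_point w e (p * z))} =
      {F (plane_point w e p), F (- plane_point w e p)})}"

lemma closed_antipodal_stabiliser: "closed antipodal_stabiliser"
proof -
  let ?B = "{(w :: real ^ 3, e). orthonormal_pair w e} \<times> sphere (0::complex) 1"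
  define P where "P t p = plane_point (fst (fst t)) (snd (fst t)) p" for t :: "((real ^ 3) \<times> (real ^ 3)) \<times> complex" and p
  have c: "compact {t \<in> ?B. \<forall>p\<in>I. F (P t (\<sigma> * p * snd t)) = F (P t (\<rho> * p))}"
    if "I \<subseteq> sphere 0 1" "cmod \<sigma> = 1" "cmod \<rho> = 1" for \<sigma> \<rho> I
    unfolding P_def
    by (rule compact_agreement_set[OF continuous_F continuous_F compact_Times[OF compact_orthonormal_pairs compact_sphere]])
      (use that in \<open>auto intro!: continuous_intros simp: norm_plane_point norm_mult\<close>)
  \<comment> \<open>The sign \<sigma> records which way the two pairs are matched; equality of
    unordered pairs is a union of two closed conditions for each \<open>p\<close>.\<close>
  define A where "A p \<sigma> = {t \<in> ?B. F (P t (p * snd t)) = F (P t (\<sigma> * p))} \<inter> {t \<in> ?B. F (P t (- p * snd t)) = F (P t (- \<sigma> * p))}" for p \<sigma>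
  have "closed (A p \<sigma>)" if p: "cmod p = 1" "cmod \<sigma> = 1" for p \<sigma>
    unfolding A_def using c[of "{p}" 1 \<sigma>] c[of "{p}" "-1" "-\<sigma>"] p
    by (intro closed_Int compact_imp_closed) auto
  then have "closed (\<Inter>p\<in>sphere 0 1. A p 1 \<union> A p (-1))"
    by (intro closed_INT ballI closed_Un) auto
  moreover have "(\<Inter>p\<in>sphere 0 1. A p 1 \<union> A p (-1)) = antipodal_stabiliser"
  proof -
    define Q where "Q w e z p \<longleftrightarrow> {F (plane_point w e (p * z)), F (- plane_point w e (p * z))} =
      {F (plane_point w e p), F (- plane_point w e p)}" for w e z p
    have mem: "((w, e), z) \<in> A p 1 \<union> A p (-1) \<longleftrightarrow> orthonormal_pair w e \<and> cmod z = 1 \<and> Q w e z p" for w e z p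
      unfolding A_def P_def Q_def by (auto simp: doubleton_eq_iff)
    have stab: "((w, e), z) \<in> antipodal_stabiliser \<longleftrightarrow> orthonormal_pair w e \<and> cmod z = 1 \<and> (\<forall>p\<in>sphere 0 1. Q w e z p)" for w e z
      unfolding antipodal_stabiliser_def Q_def[symmetric] by (simp add: Ball_def)
    have "1 \<in> sphere (0::complex) 1" by simp
    then have "((w, e), z) \<in> (\<Inter>p\<in>sphere 0 1. A p 1 \<union> A p (-1)) \<longleftrightarrow> ((w, e), z) \<in> antipodal_stabiliser" for w e z
      unfolding INT_iff mem stab by blast
    then show ?thesis unfolding set_eq_iff split_paired_All by blast
  qed
  ultimately show ?thesis by simp
qed

lemma antipodal_stabiliser_power:
  assumes "(b, z) \<in> antipodal_stabiliser"
  shows "(b, z ^ k) \<in> antipodal_stabiliser"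
proof (induction k)
  case 0
  then show ?case using assms by (auto simp: antipodal_stabiliser_def)
next
  case (Suc k)
  obtain w e where b: "b = (w, e)" by (cases b)
  have "{F (plane_point w e (p * z ^ Suc k)), F (- plane_point w e (p * z ^ Suc k))} =
    {F (plane_point w e p), F (- plane_point w e p)}" if p: "cmod p = 1" for p
  proof -
    have "cmod (p * z) = 1" using p assms by (auto simp: antipodal_stabiliser_def b norm_mult)
    then have "{F (plane_point w e (p * z * z ^ k)), F (- plane_point w e (p * z * z ^ k))} =
      {F (plane_point w e (p * z)), F (- plane_point w e (p * z))}"
      using Suc unfolding b antipodal_stabiliser_def by blast
    also have "\<dots> = {F (plane_point w e p), F (- plane_point w e p)}"
      using assms p unfolding b antipodal_stabiliser_def by blast
    finally show ?thesis by (simp add: mult.assoc)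
  qed
  then show ?case using assms unfolding b antipodal_stabiliser_def by (simp add: norm_power norm_mult)
qed

text \<open>If every rotation preserved the unordered pairs of values at antipodes, then along the circle
  \<open>F\<close> would be a continuous function with at most two values, hence constant.\<close>

lemma antipodal_stabiliser_proper:
  assumes we: "orthonormal_pair w e"
  shows "\<exists>u\<in>sphere 0 1. ((w, e), u) \<notin> antipodal_stabiliser"
proof (rule ccontr)
  assume *: "\<not> ?thesis"
  have two: "F (plane_point w e u) \<in> {F e, F (- e)}" if "cmod u = 1" for u
  proof -
    have "((w, e), u) \<in> antipodal_stabiliser" using * that by auto
    then have "{F (plane_point w e (1 * u)), F (- plane_point w e (1 * u))} = {F (plane_point w e 1), F (- plane_point w e 1)}"
      unfolding antipodal_stabiliser_def mem_Collect_eq case_prod_conv using norm_one by blast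
    then have "F (plane_point w e u) \<in> {F (plane_point w e 1), F (- plane_point w e 1)}" unfolding mult_1 by blast
    then show ?thesis unfolding plane_point_one .
  qed
  have const: "F (plane_point w e (cis s)) = F (plane_point w e (cis t))" for s t
  proof
    fix q
    have "(\<lambda>t. F (plane_point w e (cis t)) q) constant_on UNIV"
    proof (rule continuous_finite_range_constant[OF connected_UNIV])
      show "continuous_on UNIV (\<lambda>t. F (plane_point w e (cis t)) q)"
        by (rule continuous_on_compose2[OF continuous_F])
          (auto intro!: continuous_intros simp: norm_plane_point[OF we])
      have "(\<lambda>t. F (plane_point w e (cis t)) q) ` UNIV \<subseteq> {F e q, F (- e) q}"
      proof (rule image_subsetI)
        fix t show "F (plane_point w e (cis t)) q \<in> {F e q, F (- e) q}"
          using two[OF norm_cis, of t] by (elim insertE) auto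
      qed
      then show "finite ((\<lambda>t. F (plane_point w e (cis t)) q) ` UNIV)" by (rule finite_subset) auto
    qed
    then show "F (plane_point w e (cis s)) q = F (plane_point w e (cis t)) q"
      unfolding constant_on_def by auto
  qed
  obtain x where x: "norm x = 1" "w \<bullet> x = 0" "F (- x) \<noteq> F x"
    using no_half_turn orthonormal_pairD(1)[OF we] by blast
  obtain p where p: "x = plane_point w e p" "cmod p = 1" using plane_point_ex[OF we x(2)] x(1) by metis
  have "p = cis (Arg2pi p)" unfolding cis_conv_exp using Arg2pi_eq[of p] p(2) by (metis mult_1 of_real_1)
  then have "x = plane_point w e (cis (Arg2pi p))" "- x = plane_point w e (cis (Arg2pi p + pi))"
    using p(1) by (metis, metis plane_point_neg cis_mult cis_pi mult_minus1_right)
  then show False using const x(3) by metis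
qed

lemma antipodal_stabiliser_finite_order:
  obtains N :: nat where "N > 0" "\<And>b z. (b, z) \<in> antipodal_stabiliser \<Longrightarrow> z ^ N = 1"
proof -
  have "\<exists>N::nat. N > 0 \<and> (\<forall>b z. (b, z) \<in> antipodal_stabiliser \<longrightarrow> z ^ N = 1)"
  proof (rule finite_order_uniform[OF compact_orthonormal_pairs closed_antipodal_stabiliser])
    show "antipodal_stabiliser \<subseteq> {(w, e). orthonormal_pair w e} \<times> sphere 0 1"
      by (auto simp: antipodal_stabiliser_def)
    show "\<exists>u\<in>sphere 0 1. (b, u) \<notin> antipodal_stabiliser" if "b \<in> {(w, e). orthonormal_pair w e}" for b
      using that antipodal_stabiliser_proper by auto
  qed (rule antipodal_stabiliser_power)
  then show ?thesis using that by blast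
qed

text \<open>The \<open>N\<close>-th power of the flip parameter in a moving frame is single valued, so it is a continuous
  section of a line bundle over the hemisphere; flips at \<open>w\<close> and \<open>- w\<close> coincide, which
  forces it to wind along the equator.\<close>

lemma not_all_flips:
  assumes fl: "\<And>w. norm w = 1 \<Longrightarrow> \<exists>e v. orthonormal_pair w e \<and> cmod v = 1 \<and> flips w e v"
  shows False
proof -
  obtain N :: nat where N: "N > 0" "\<And>b z. (b, z) \<in> antipodal_stabiliser \<Longrightarrow> z ^ N = 1"
    using antipodal_stabiliser_finite_order by blast
  have ex: "\<exists>v. cmod v = 1 \<and> flips w e v" if we: "orthonormal_pair w e" for w e
  proof -
    obtain e' v where e': "orthonormal_pair w e'" "cmod v = 1" "flips w e' v"
      using fl orthonormal_pairD(1)[OF we] by blast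
    obtain b where b: "e' = plane_point w e b" "cmod b = 1"
      using plane_point_ex[OF we] orthonormal_pairD[OF e'(1)] by metis
    have "flips w e (b\<^sup>2 * v)" "cmod (b\<^sup>2 * v) = 1"
      using flips_plane_point[OF we b(2), of v] e' b by (auto simp: norm_mult norm_power)
    then show ?thesis by blast
  qed
  \<comment> \<open>Two flip parameters in one frame differ by a symmetry of \<open>F\<close>, which
    the exponent \<open>N\<close> kills.\<close>
  have uniq: "v ^ N = v' ^ N"
    if we: "orthonormal_pair w e" and v: "cmod v = 1" "flips w e v" "cmod v' = 1" "flips w e v'" for w e v v'
  proof -
    have vv: "v' * cnj v' = 1" using v(3) complex_norm_square[of v'] by simp
    have "F (plane_point w e (p * (cnj v' * v))) = F (plane_point w e p)" if p: "cmod p = 1" for p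
    proof -
      have "cmod (v' * cnj p) = 1" using p v by (simp add: norm_mult)
      then have "F (plane_point w e (v * cnj (v' * cnj p))) = F (plane_point w e (v' * cnj (v' * cnj p)))"
        using v(2,4) unfolding flips_def by metis
      moreover have "v' * cnj (v' * cnj p) = p" using vv by (simp add: mult.assoc[symmetric])
      moreover have "v * cnj (v' * cnj p) = p * (cnj v' * v)" by simp
      ultimately show ?thesis by metis
    qed
    from this this[of "- _"] have "((w, e), cnj v' * v) \<in> antipodal_stabiliser"
      using we v unfolding antipodal_stabiliser_def by (simp add: norm_mult)
    then have "(cnj v' * v) ^ N = 1" by (rule N(2))
    then have "v' ^ N * (cnj v' * v) ^ N = v' ^ N" by simp
    then have "(v' * cnj v' * v) ^ N = v' ^ N" by (simp add: power_mult_distrib mult_ac)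
    then show ?thesis using vv by simp
  qed
  let ?h = hemisphere_point
  define E where "E u = polar_frame (?h u)" for u
  have op: "orthonormal_pair (?h u) (E u)" if "cmod u \<le> 1" for u
    unfolding E_def
  proof (rule orthonormal_polar_frame[OF norm_hemisphere_point[OF that]])
    have "?h u $ 3 \<ge> 0" using that unfolding hemisphere_point_nth by (simp add: power_le_one)
    then show "?h u $ 3 \<noteq> - 1" by linarith
  qed
  obtain \<nu> where \<nu>: "\<And>u. cmod u \<le> 1 \<Longrightarrow> cmod (\<nu> u) = 1 \<and> flips (?h u) (E u) (\<nu> u)"
    using ex[OF op] by metis
  define f where "f u = \<nu> u ^ N" for u
  have "continuous_on (cball 0 1) f"
  \<comment> \<open>The choice \<nu> need not be continuous. The graph of its power \<open>f\<close>
    is the image of the compact set of all admissible parameters, and a closed graph with compact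
    range gives continuity.\<close>
  proof (rule continuous_from_closed_graph[of "sphere 0 1"])
    show "f \<in> cball 0 1 \<rightarrow> sphere 0 1" using \<nu> by (auto simp: f_def norm_power)
    let ?B = "cball (0::complex) 1 \<times> sphere (0::complex) 1"
    let ?S = "{t \<in> ?B. \<forall>p\<in>{p. cmod p = 1}. F (plane_point (?h (fst t)) (E (fst t)) (snd t * cnj p)) =
      G (plane_point (?h (fst t)) (E (fst t)) p) \<circ> \<iota>}"
    have ch: "continuous_on (cball 0 1) ?h"
      unfolding hemisphere_point_def by (intro continuous_intros)
    have cE: "continuous_on (cball 0 1) E"
      unfolding polar_frame_def E_def
    proof (intro continuous_intros ch ballI)
      fix u :: complex assume "u \<in> cball 0 1"
      then have "?h u $ 3 \<ge> 0" unfolding hemisphere_point_nth by (simp add: power_le_one)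
      then show "1 + ?h u $ 3 \<noteq> 0" by linarith
    qed
    have c: "continuous_on ?B (\<lambda>t. ?h (fst t))" "continuous_on ?B (\<lambda>t. E (fst t))"
      by (rule continuous_on_compose2[OF ch] continuous_on_compose2[OF cE];
          auto intro!: continuous_on_fst continuous_on_id)+
    have "compact ?S"
    proof (rule compact_agreement_set[where H' = "\<lambda>x. G x \<circ> \<iota>",
          OF continuous_F continuous_G_flip compact_Times[OF compact_cball compact_sphere]])
      show "continuous_on ?B (\<lambda>t. plane_point (?h (fst t)) (E (fst t)) (snd t * cnj p))"
        "continuous_on ?B (\<lambda>t. plane_point (?h (fst t)) (E (fst t)) p)" for p
        by (intro continuous_on_plane_point c continuous_intros)+
    qed (auto simp: norm_plane_point[OF op] norm_mult)
    then have "compact ((\<lambda>t. (fst t, snd t ^ N)) ` ?S)"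
      by (intro compact_continuous_image continuous_intros)
    also have "(\<lambda>t. (fst t, snd t ^ N)) ` ?S = (\<lambda>u. (u, f u)) ` cball 0 1"
    proof safe
      fix u v assume u: "u \<in> cball (0::complex) 1" "v \<in> sphere (0::complex) 1" and
        S: "\<forall>p\<in>{p. cmod p = 1}. F (plane_point (?h (fst (u, v))) (E (fst (u, v))) (snd (u, v) * cnj p)) =
          G (plane_point (?h (fst (u, v))) (E (fst (u, v))) p) \<circ> \<iota>"
      then have "flips (?h u) (E u) v" unfolding flips_def by simp
      then have "v ^ N = f u" unfolding f_def using u \<nu>[of u] by (intro uniq[OF op]) auto
      then show "(fst (u, v), snd (u, v) ^ N) \<in> (\<lambda>u. (u, f u)) ` cball 0 1" using u by simp
    next
      fix u :: complex assume u: "u \<in> cball 0 1"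
      then have "(u, \<nu> u) \<in> ?S" using \<nu>[of u] by (simp add: flips_def)
      then show "(u, f u) \<in> (\<lambda>t. (fst t, snd t ^ N)) ` ?S" by (force simp: f_def)
    qed
    finally show "closed ((\<lambda>u. (u, f u)) ` cball 0 1)" by (rule compact_imp_closed)
  qed simp
  moreover have "f u \<noteq> 0" if "u \<in> cball 0 1" for u
  proof -
    have "cmod (\<nu> u) = 1" using \<nu> that by simp
    then show ?thesis unfolding f_def by auto
  qed
  \<comment> \<open>Passing from the polar frame to \<tau> costs \<open>b\<^sup>2\<close> at each of
    \<open>u\<close> and \<open>- u\<close>, and the reversed normal conjugates one side, so the
    factors accumulate to \<open>cnj b ^ 4\<close> instead of cancelling; since
    \<open>cnj b = \<i> * u\<close>, this is \<open>u ^ 4\<close>.\<close>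
  moreover have "f u * f (- u) = u ^ (4 * N)" if u: "cmod u = 1" for u
  proof -
    define \<tau> where "\<tau> = (- Im u *\<^sub>R axis 1 1 + Re u *\<^sub>R axis 2 1 :: real ^ 3)"
    define b where "b = - \<i> * cnj u"
    note pf = polar_frame_equator[OF u, folded \<tau>_def b_def]
    have cb: "cmod b = 1" using u by (simp add: b_def norm_mult)
    have o': "orthonormal_pair (- ?h u) \<tau>" using pf(1) by (simp add: orthonormal_pair_def)
    have n: "cmod (\<nu> u) = 1" "cmod (\<nu> (- u)) = 1" using \<nu>[of u] \<nu>[of "- u"] u by auto
    have "flips (?h u) \<tau> (b\<^sup>2 * \<nu> u)"
      using \<nu>[of u, unfolded E_def] u pf(2) by (intro flips_plane_point[OF pf(1) cb]) auto
    moreover have "flips (- ?h u) \<tau> (b\<^sup>2 * \<nu> (- u))"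
      using \<nu>[of "- u", unfolded E_def] u pf(3,4) by (intro flips_plane_point[OF o' cb]) auto
    ultimately have "(b\<^sup>2 * \<nu> u) ^ N = (cnj (b\<^sup>2 * \<nu> (- u))) ^ N"
      using cb n by (intro uniq[OF pf(1)] flips_uminus) (auto simp: norm_mult norm_power)
    then have e: "(b\<^sup>2) ^ N * f u = ((cnj b)\<^sup>2) ^ N * cnj (f (- u))"
      unfolding f_def by (simp add: power_mult_distrib)
    have cc: "cnj b * b = 1" "f (- u) * cnj (f (- u)) = 1"
      using cb complex_norm_square[of b] n(2) complex_norm_square[of "f (- u)"]
      by (auto simp: f_def norm_power mult.commute)
    have "((cnj b)\<^sup>2) ^ N * ((b\<^sup>2) ^ N * f u) * f (- u) = ((cnj b)\<^sup>2) ^ N * ((cnj b)\<^sup>2) ^ N * (f (- u) * cnj (f (- u)))"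
      unfolding e by (simp add: mult_ac)
    moreover have "((cnj b)\<^sup>2) ^ N * (b\<^sup>2) ^ N = 1"
      using cc(1) by (metis power_mult_distrib power_one)
    ultimately have "f u * f (- u) = ((cnj b)\<^sup>2) ^ N * ((cnj b)\<^sup>2) ^ N" using cc(2) by (simp add: mult.assoc[symmetric])
    also have "\<dots> = (cnj b ^ 4) ^ N" by (simp flip: power_mult power_add)
    also have "cnj b ^ 4 = u ^ 4" unfolding b_def by (simp add: power_mult_distrib)
    finally show ?thesis by (simp add: power_mult)
  qed
  ultimately have "4 * N = 0" by (rule no_antipodal_winding)
  then show False using N(1) by simp
qed

lemma all_rotates:
  assumes rot: "\<And>w. norm w = 1 \<Longrightarrow> \<exists>z. cmod z = 1 \<and> rotates w z"
  shows "(\<forall>x. norm x = 1 \<longrightarrow> F x = G x) \<or> (\<forall>x. norm x = 1 \<longrightarrow> F (- x) = G x)"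
proof -
  obtain N :: nat where N: "N > 0" "\<And>b z. (b, z) \<in> antipodal_stabiliser \<Longrightarrow> z ^ N = 1"
    using antipodal_stabiliser_finite_order by blast
  have FG: "F x = G x \<or> F x = G (- x)" if "norm x = 1" for x
    by (rule colour_agree_antipodal[OF continuous_F continuous_G _ that]) (use rot rotates_def in blast)
  \<comment> \<open>Both directions enter the equality of pairs: the first alone is compatible with
    \<open>F x = F (- x)\<close> while \<open>G x\<close> and \<open>G (- x)\<close> differ. Here
    the inverse rotation \<open>cnj z\<close> carries \<open>F\<close> to \<open>G\<close>.\<close>
  have GF: "G x = F x \<or> G x = F (- x)" if "norm x = 1" for x
  proof (rule colour_agree_antipodal[OF continuous_G continuous_F _ that])
    fix w :: "real ^ 3" assume "norm w = 1"
    then obtain z e where z: "cmod z = 1" "rotates w z" and we: "orthonormal_pair w e"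
      using rot orthonormal_pair_exists by metis
    have zz: "cnj z * z = 1" using z(1) complex_norm_square[of z] by (simp add: mult.commute)
    have "G (plane_point w x (cnj z)) = F x" if x: "norm x = 1" "w \<bullet> x = 0" for x
    proof -
      have wx: "orthonormal_pair w x" using x \<open>norm w = 1\<close> by (simp add: orthonormal_pair_def)
      have "F (plane_point w x (cnj z * z)) = G (plane_point w x (cnj z))"
        using z unfolding rotates_frame[OF wx] by simp
      then show ?thesis using zz by simp
    qed
    then show "\<exists>z. cmod z = 1 \<and> (\<forall>x. norm x = 1 \<longrightarrow> w \<bullet> x = 0 \<longrightarrow> G (plane_point w x z) = F x)"
      using z(1) by (intro exI[of _ "cnj z"]) simp
  qed
  have eq: "{F x, F (- x)} = {G x, G (- x)}" if "norm x = 1" for x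
    using FG[of x] FG[of "- x"] GF[of x] GF[of "- x"] that by auto
  have root: "z ^ N = 1" if we: "norm w = 1" and z: "cmod z = 1" "rotates w z" for w z
  proof -
    obtain e where e: "orthonormal_pair w e" using orthonormal_pair_exists[OF we] .
    have "((w, e), z) \<in> antipodal_stabiliser"
      unfolding antipodal_stabiliser_def
    proof (clarsimp simp: e z(1))
      fix p :: complex assume p: "cmod p = 1"
      have r: "F (plane_point w e (p * z)) = G (plane_point w e p)" if "cmod p = 1" for p
        using z(2) that unfolding rotates_frame[OF e] by blast
      show "{F (plane_point w e (p * z)), F (- plane_point w e (p * z))} = {F (plane_point w e p), F (- plane_point w e p)}"
        using eq[of "plane_point w e p"] r[OF p] r[of "- p"] p by (simp add: norm_plane_point[OF e])
    qed
    then show ?thesis by (rule N(2))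
  qed
  let ?C = "\<lambda>z. {w. norm w = 1 \<and> rotates w z}"
  have cover: "sphere 0 1 \<subseteq> ?C 1 \<union> ?C (-1)"
  proof (rule ccontr)
    assume ne: "\<not> ?thesis"
    \<comment> \<open>The normals for which neither angle 0 nor \<open>pi\<close> works. They are
      covered by finitely many closed sets, one for each root of unity, so one root fills an open
      piece.\<close>
    let ?U = "sphere 0 1 - (?C 1 \<union> ?C (-1))" and ?Z = "{z. cmod z = 1 \<and> z ^ N = 1}"
    have "finite ?Z" by (rule finite_subset[OF _ finite_roots_unity[of N]]) (use N in auto)
    moreover have "openin (top_of_set (sphere 0 1)) ?U"
    proof -
      have "open (- (?C 1 \<union> ?C (-1)))" by (intro open_Compl closed_Un closed_rotates) auto
      then have "openin (top_of_set (sphere 0 1)) (sphere 0 1 \<inter> - (?C 1 \<union> ?C (-1)))" by (rule openin_open_Int)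
      then show ?thesis by (simp only: Diff_eq)
    qed
    moreover have "?U \<noteq> {}" using ne by blast
    moreover have "?U \<subseteq> (\<Union>z\<in>?Z. ?C z)"
    proof
      fix w assume "w \<in> ?U"
      then have w: "norm w = 1" by simp
      then obtain z where "cmod z = 1" "rotates w z" using rot by blast
      then show "w \<in> (\<Union>z\<in>?Z. ?C z)" using root[OF w] w by blast
    qed
    ultimately obtain z V where z: "z \<in> ?Z" and V: "openin (top_of_set (sphere 0 1)) V" "V \<noteq> {}" "V \<subseteq> ?U \<inter> ?C z"
      using finite_closed_cover_interior[of ?Z ?C "sphere 0 1" ?U] closed_rotates by auto
    obtain w\<^sub>0 where w0: "w\<^sub>0 \<in> V" using V(2) by blast
    have "Im z \<noteq> 0"
    proof
      assume "Im z = 0"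
      moreover have "(Re z)\<^sup>2 + (Im z)\<^sup>2 = 1" using z by (simp flip: cmod_power2)
      ultimately have "z = 1 \<or> z = -1" by (auto simp: power2_eq_1_iff complex_eq_iff)
      then show False using V(3) w0 by auto
    qed
    obtain \<epsilon> where \<epsilon>: "\<epsilon> > 0" "ball w\<^sub>0 \<epsilon> \<inter> sphere 0 1 \<subseteq> V"
      using V(1) w0 openin_contains_ball by metis
    obtain x where x: "norm x = 1" "w\<^sub>0 \<bullet> x = 0" "F (- x) \<noteq> F x"
      using no_half_turn[of w\<^sub>0] V(3) w0 by auto
    have ox: "orthonormal_pair w\<^sub>0 x" using x V(3) w0 by (auto simp: orthonormal_pair_def)
    \<comment> \<open>The level set argument concerns real functions and is applied to each
      coordinate \<open>q\<close> of the colour.\<close>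
    have "F (- x) q = F x q" for q
    proof (rule rotation_level_even[where G = "\<lambda>x. G x q", OF _ \<open>Im z \<noteq> 0\<close> \<epsilon>(1) ox])
      show "cmod z = 1" using z by simp
      fix w y :: "real ^ 3" assume w: "norm w = 1" "dist w w\<^sub>0 < \<epsilon>" "norm y = 1" "w \<bullet> y = 0"
      then have "w \<in> V" using \<epsilon>(2) by (auto simp: dist_commute)
      then have "rotates w z" using V(3) by auto
      then show "F (plane_point w y z) q = G y q" using w unfolding rotates_def by simp
    qed
    then show False using x(3) by blast
  qed
  have "?C 1 \<inter> ?C (-1) \<inter> sphere 0 1 = {}"
  proof -
    have False if w: "norm w = 1" "rotates w 1" "rotates w (- 1)" for w
    proof -
      obtain x where x: "norm x = 1" "w \<bullet> x = 0" "F (- x) \<noteq> F x" using no_half_turn w(1) by blast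
      then have "F (plane_point w x 1) = F (plane_point w x (- 1))" using w unfolding rotates_def by simp
      then show False using x(3) by simp
    qed
    then show ?thesis by blast
  qed
  then have all: "sphere 0 1 \<subseteq> ?C 1 \<or> sphere 0 1 \<subseteq> ?C (-1)"
    by (intro sphere3_cover_closed closed_rotates cover) auto
  have ex: "\<exists>w. norm w = 1 \<and> w \<bullet> x = 0" if x: "norm x = 1" for x :: "real ^ 3"
    using orthonormal_pair_exists[OF x] by (metis orthonormal_pairD(2,4))
  from all show ?thesis
  proof
    assume s: "sphere 0 1 \<subseteq> ?C 1"
    have "F x = G x" if "norm x = 1" for x
    proof -
      obtain w where w: "norm w = 1" "w \<bullet> x = 0" using ex[OF \<open>norm x = 1\<close>] by blast
      then have "rotates w 1" using s by auto
      then show ?thesis using w \<open>norm x = 1\<close> unfolding rotates_def by simp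
    qed
    then show ?thesis by blast
  next
    assume s: "sphere 0 1 \<subseteq> ?C (-1)"
    have "F (- x) = G x" if "norm x = 1" for x
    proof -
      obtain w where w: "norm w = 1" "w \<bullet> x = 0" using ex[OF \<open>norm x = 1\<close>] by blast
      then have "rotates w (-1)" using s by auto
      then show ?thesis using w \<open>norm x = 1\<close> unfolding rotates_def by (metis plane_point_neg plane_point_one)
    qed
    then show ?thesis by blast
  qed
qed

theorem equal_or_antipodal:
  assumes dense: "sphere 0 1 \<subseteq> closure {w. norm w = 1 \<and>
    ((\<exists>z. cmod z = 1 \<and> rotates w z) \<or> (\<exists>e v. orthonormal_pair w e \<and> cmod v = 1 \<and> flips w e v))}"
  shows "(\<forall>x. norm x = 1 \<longrightarrow> F x = G x) \<or> (\<forall>x. norm x = 1 \<longrightarrow> F (- x) = G x)"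
proof -
  let ?A = "{w. norm w = 1 \<and> (\<exists>z. cmod z = 1 \<and> rotates w z)}"
  let ?B = "{w. \<exists>e v. orthonormal_pair w e \<and> cmod v = 1 \<and> flips w e v}"
  have "closure {w. norm w = 1 \<and>
    ((\<exists>z. cmod z = 1 \<and> rotates w z) \<or> (\<exists>e v. orthonormal_pair w e \<and> cmod v = 1 \<and> flips w e v))} \<subseteq> ?A \<union> ?B"
    by (intro closure_minimal closed_Un closed_ex_rotates closed_ex_flips) auto
  moreover have "?A \<inter> ?B \<inter> sphere 0 1 = {}" using not_rotates_and_flips by auto
  ultimately have "sphere 0 1 \<subseteq> ?A \<or> sphere 0 1 \<subseteq> ?B"
    using dense by (intro sphere3_cover_closed closed_ex_rotates closed_ex_flips) auto
  moreover have "\<not> sphere 0 1 \<subseteq> ?B"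
  proof
    assume s: "sphere 0 1 \<subseteq> ?B"
    show False
    proof (rule not_all_flips)
      fix w :: "real ^ 3" assume "norm w = 1"
      then have "w \<in> ?B" using s by auto
      then show "\<exists>e v. orthonormal_pair w e \<and> cmod v = 1 \<and> flips w e v" by blast
    qed
  qed
  ultimately have "sphere 0 1 \<subseteq> ?A" by blast
  then show ?thesis by (intro all_rotates) auto
qed

end

section \<open>Half-turns and rotations fixing a line\<close>

definition reflection :: "real ^ 'n \<Rightarrow> real ^ 'n \<Rightarrow> real ^ 'n" where
  "reflection n z = z - (2 * (n \<bullet> z)) *\<^sub>R n"

lemma linear_reflection: "linear (reflection n)"
  by (rule linearI) (simp_all add: reflection_def inner_add_right algebra_simps)

text \<open>Conjugation by an orthogonal map moves the normal to a coordinate vector, where the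
  matrix is diagonal.\<close>

lemma det_reflection:
  fixes n :: "real ^ 'n"
  assumes "norm n = 1"
  shows "det (matrix (reflection n)) = -1"
proof -
  fix k :: 'n
  let ?a = "axis k 1 :: real ^ 'n"
  obtain g where g: "orthogonal_transformation g" "g ?a = n"
    using orthogonal_transformation_exists[of ?a n] assms by auto
  have lg: "linear g" using g(1) orthogonal_transformation_linear by blast
  have "reflection n (g z) = g (reflection ?a z)" for z
  proof -
    have "n \<bullet> g z = ?a \<bullet> z" using g unfolding orthogonal_transformation_def by metis
    then show ?thesis using g(2) lg by (simp add: reflection_def linear_diff linear_scale)
  qed
  then have "reflection n \<circ> g = g \<circ> reflection ?a" by (simp add: fun_eq_iff)
  then have "matrix (reflection n) ** matrix g = matrix g ** matrix (reflection ?a)"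
    by (metis matrix_compose linear_reflection lg)
  then have "det (matrix (reflection n)) * det (matrix g) = det (matrix g) * det (matrix (reflection ?a))"
    by (metis det_mul)
  moreover have "det (matrix g) \<noteq> 0"
    using orthogonal_transformation_det[OF g(1)] by auto
  moreover have "det (matrix (reflection ?a)) = -1"
  proof -
    have m: "matrix (reflection ?a) $ i $ j = (if i = j then if i = k then -1 else 1 else 0)" for i j
      unfolding matrix_def reflection_def by (simp add: inner_axis_axis) (auto simp: axis_def)
    have "det (matrix (reflection ?a)) = (\<Prod>i\<in>UNIV. matrix (reflection ?a) $ i $ i)"
      by (rule det_diagonal) (simp add: m)
    also have "\<dots> = (\<Prod>i\<in>UNIV. if i = k then -1 else 1)" by (simp add: m)
    also have "\<dots> = -1" by simp
    finally show ?thesis .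
  qed
  ultimately show ?thesis by (metis mult.commute mult_cancel_left)
qed

text \<open>For orthonormal \<open>u\<close> and \<open>w\<close>: the identity on their span and -1
  on its complement, that is, the rotation of \<open>perp w\<close> by \<open>pi\<close> about
  \<open>u\<close>, extended by fixing \<open>w\<close> as \<open>SO_on\<close> demands.\<close>

definition half_turn :: "real ^ 4 \<Rightarrow> real ^ 4 \<Rightarrow> real ^ 4 \<Rightarrow> real ^ 4" where
  "half_turn u w z = (2 * (u \<bullet> z)) *\<^sub>R u + (2 * (w \<bullet> z)) *\<^sub>R w - z"

lemma half_turn_facts:
  assumes "norm u = 1" "norm w = 1" "u \<bullet> w = 0"
  shows "linear (half_turn u w)" "orthogonal_transformation (half_turn u w)"
    "det (matrix (half_turn u w)) = 1" "half_turn u w (half_turn u w z) = z"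
    "half_turn u w u = u" "half_turn u w w = w"
    "u \<bullet> z = 0 \<Longrightarrow> w \<bullet> z = 0 \<Longrightarrow> half_turn u w z = - z"
    "w \<bullet> half_turn u w z = w \<bullet> z"
proof -
  have o: "u \<bullet> u = 1" "w \<bullet> w = 1" "u \<bullet> w = 0" "w \<bullet> u = 0"
    using assms by (simp_all add: dot_square_norm inner_commute)
  show lin: "linear (half_turn u w)"
    by (rule linearI) (simp_all add: half_turn_def inner_add_right algebra_simps)
  have "half_turn u w v \<bullet> half_turn u w z = v \<bullet> z" for v z
    using o by (simp add: half_turn_def inner_diff_left inner_diff_right inner_add_left inner_add_right
        inner_commute algebra_simps)
  then show "orthogonal_transformation (half_turn u w)"
    unfolding orthogonal_transformation_def using lin by blast
  \<comment> \<open>The two reflections contribute -1 each, and the scalar -1 has determinant 1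
    because the dimension is even.\<close>
  have "half_turn u w = (*\<^sub>R) (-1) \<circ> (reflection u \<circ> reflection w)"
    using o by (simp add: fun_eq_iff half_turn_def reflection_def inner_diff_right algebra_simps)
  moreover have "linear ((*\<^sub>R) (-1 :: real) :: real ^ 4 \<Rightarrow> real ^ 4)" by (rule linear_scaleR)
  ultimately have "matrix (half_turn u w) = matrix ((*\<^sub>R) (-1)) ** (matrix (reflection u) ** matrix (reflection w))"
    by (simp only: matrix_compose linear_compose linear_reflection)
  then show "det (matrix (half_turn u w)) = 1"
    by (simp only: det_mul det_reflection assms det_matrix_scaleR) simp
  show "half_turn u w (half_turn u w z) = z"
    using o by (simp add: half_turn_def inner_diff_right inner_add_right algebra_simps)
  show "half_turn u w u = u" "half_turn u w w = w" "w \<bullet> half_turn u w z = w \<bullet> z"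
    using o by (simp_all add: half_turn_def inner_diff_right inner_add_right algebra_simps)
      (simp_all add: vec_eq_iff)
  show "half_turn u w z = - z" if "u \<bullet> z = 0" "w \<bullet> z = 0"
    using that by (simp add: half_turn_def)
qed

lemma half_turn_SO_on:
  assumes "norm u = 1" "norm w = 1" "u \<bullet> w = 0"
  shows "half_turn u w \<in> SO_on (perp w)"
proof -
  note h = half_turn_facts[OF assms]
  have "half_turn u w ` perp w = perp w"
  proof safe
    fix z assume "w \<bullet> z = 0"
    then show "z \<in> half_turn u w ` perp w"
      using h(4)[of z] h(8)[of z] by (intro image_eqI[of _ _ "half_turn u w z"]) auto
  qed (simp add: h(8))
  moreover have "half_turn u w x = x" if x: "x \<in> orthogonal_comp (perp w)" for x
  proof -
    define y where "y = x - (w \<bullet> x) *\<^sub>R w"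
    have "w \<bullet> y = 0" using assms(2) by (simp add: y_def inner_diff_right dot_square_norm)
    then have "y \<bullet> x = 0" "y \<bullet> w = 0" using x by (auto simp: orthogonal_comp_def orthogonal_def inner_commute)
    then have "y \<bullet> y = 0" by (subst (2) y_def) (simp add: inner_diff_right)
    then have "x = (w \<bullet> x) *\<^sub>R w" by (simp add: y_def)
    then show ?thesis using h(1,6) by (metis linear_scale)
  qed
  ultimately show ?thesis unfolding SO_on_def using h(2,3) by simp
qed

lemma pi_symmetric_in_half_turn:
  assumes "norm u = 1" "norm w = 1" "u \<bullet> w = 0" and a: "w \<bullet> a = 0"
    and D: "\<And>z. w \<bullet> z = 0 \<Longrightarrow> z \<in> D \<longleftrightarrow> half_turn u w z - a \<in> D"
  shows "pi_symmetric_in (perp w) u (D \<inter> perp w)"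
proof -
  note h = half_turn_facts[OF assms(1-3)]
  have "half_turn u w ` (D \<inter> perp w) = (\<lambda>x. x + a) ` (D \<inter> perp w)"
  proof safe
    fix z assume "z \<in> D" "w \<bullet> z = 0"
    then show "half_turn u w z \<in> (\<lambda>x. x + a) ` (D \<inter> perp w)"
      using D[of z] a h(8)[of z] by (intro image_eqI[of _ _ "half_turn u w z - a"]) (auto simp: inner_diff_right)
  next
    fix z assume z: "z \<in> D" "w \<bullet> z = 0"
    have p: "w \<bullet> half_turn u w (z + a) = 0" using z a h(8) by (simp add: inner_add_right)
    then show "z + a \<in> half_turn u w ` (D \<inter> perp w)"
      using D[OF p] z h(4)[of "z + a"] by (intro image_eqI[of _ _ "half_turn u w (z + a)"]) auto
  qed
  moreover have "\<forall>x\<in>perp w \<inter> perp u. half_turn u w x = - x" using h(7) by auto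
  ultimately show ?thesis
    unfolding pi_symmetric_in_def using half_turn_SO_on[OF assms(1-3)] h(5) a by blast
qed

lemma SO_on_perp_fixes:
  assumes "\<phi> \<in> SO_on (perp w)"
  shows "\<phi> w = w"
proof -
  have "w \<in> orthogonal_comp (perp w)" by (auto simp: orthogonal_comp_def orthogonal_def inner_commute)
  then show ?thesis using assms unfolding SO_on_def by blast
qed

section \<open>Coordinates adapted to the axis\<close>

text \<open>\<open>T\<close> identifies \<open>real ^ 3\<close>, where cross products provide
  frames, with the orthogonal complement of \<zeta>. The hyperplanes through the axis are then those
  of the form \<open>perp (T w)\<close>.\<close>

locale axis_frame =
  fixes T :: "real ^ 3 \<Rightarrow> real ^ 4" and \<zeta> :: "real ^ 4"
  assumes linear_T: "linear T" and norm_T: "norm (T x) = norm x"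
    and T_perp: "T x \<bullet> \<zeta> = 0" and norm_axis: "norm \<zeta> = 1"
    and decompose: "\<exists>x. z = T x + (z \<bullet> \<zeta>) *\<^sub>R \<zeta>"
begin

lemma inner_T: "T x \<bullet> T y = x \<bullet> y"
  unfolding dot_norm by (simp add: norm_T flip: linear_add[OF linear_T])

lemma axis_simps: "\<zeta> \<bullet> \<zeta> = 1" "\<zeta> \<bullet> T x = 0" "T x \<bullet> \<zeta> = 0"
  using norm_axis T_perp[of x] by (simp_all add: dot_square_norm inner_commute)

lemmas T_simps = linear_add[OF linear_T] linear_diff[OF linear_T] linear_scale[OF linear_T]
  linear_neg[OF linear_T] linear_0[OF linear_T]

lemma perp_decompose:
  assumes "T w \<bullet> z = 0"
  obtains x where "z = T x + (z \<bullet> \<zeta>) *\<^sub>R \<zeta>" "w \<bullet> x = 0"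
proof -
  obtain x where x: "z = T x + (z \<bullet> \<zeta>) *\<^sub>R \<zeta>" using decompose by blast
  have "T w \<bullet> z = w \<bullet> x" by (subst x) (simp add: inner_add_right inner_T axis_simps)
  then show ?thesis using that x assms by simp
qed

lemma frame_decompose:
  assumes we: "orthonormal_pair w e"
  obtains p k s where "z = T (plane_point w e p) + k *\<^sub>R T w + s *\<^sub>R \<zeta>"
proof -
  note o = orthonormal_pairD[OF we]
  obtain x where x: "z = T x + (z \<bullet> \<zeta>) *\<^sub>R \<zeta>" using decompose by blast
  have "w \<bullet> (x - (w \<bullet> x) *\<^sub>R w) = 0" using o by (simp add: inner_diff_right)
  then obtain p where "x - (w \<bullet> x) *\<^sub>R w = plane_point w e p" using plane_point_ex[OF we] by metis
  then have "x = plane_point w e p + (w \<bullet> x) *\<^sub>R w" by (simp add: algebra_simps)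
  then have "z = T (plane_point w e p) + (w \<bullet> x) *\<^sub>R T w + (z \<bullet> \<zeta>) *\<^sub>R \<zeta>"
    using x T_simps by metis
  then show ?thesis by (rule that)
qed

lemma linear_eq_frame:
  assumes we: "orthonormal_pair w e" and "linear f" "linear g"
    and "\<And>p. f (T (plane_point w e p)) = g (T (plane_point w e p))" "f (T w) = g (T w)" "f \<zeta> = g \<zeta>"
  shows "f = g"
proof
  fix z
  obtain p k s where "z = T (plane_point w e p) + k *\<^sub>R T w + s *\<^sub>R \<zeta>" using frame_decompose[OF we] .
  then show "f z = g z" using assms by (simp add: linear_add linear_scale)
qed

lemma inner_T_plane_point:
  assumes "orthonormal_pair w e"
  shows "T (plane_point w e p) \<bullet> T (plane_point w e q) = Re p * Re q + Im p * Im q"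
    "T w \<bullet> T (plane_point w e q) = 0" "norm (T (plane_point w e q)) = cmod q" "norm (T w) = 1"
  using plane_point_inner[OF assms] plane_point_perp[OF orthonormal_pairD(3)[OF assms]] norm_plane_point[OF assms]
    orthonormal_pairD(1)[OF assms]
  by (simp_all add: inner_T norm_T)

text \<open>Rotation by \<open>pi\<close> about a direction orthogonal to the axis is a reflection
  of the plane and reverses the axis; this matches the forbidden symmetries with flips.\<close>

lemma half_turn_T:
  assumes we: "orthonormal_pair w e" and b: "cmod b = 1"
  shows "half_turn (T (plane_point w e b)) (T w) (T (plane_point w e p)) = T (plane_point w e (b\<^sup>2 * cnj p))"
    "half_turn (T (plane_point w e b)) (T w) \<zeta> = - \<zeta>"
proof -
  have bb: "(Re b)\<^sup>2 + (Im b)\<^sup>2 = 1" using b by (simp flip: cmod_power2)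
  have "of_real (2 * (Re b * Re p + Im b * Im p)) * b - p = b * (b * cnj p) + (b * cnj b - 1) * p"
    by (simp add: complex_eq_iff algebra_simps power2_eq_square)
  also have "b * cnj b = 1" using b complex_norm_square[of b] by simp
  finally have *: "of_real (2 * (Re b * Re p + Im b * Im p)) * b - p = b\<^sup>2 * cnj p" by (simp add: power2_eq_square)
  have "(2 * (Re b * Re p + Im b * Im p)) *\<^sub>R plane_point w e b - plane_point w e p =
    plane_point w e (of_real (2 * (Re b * Re p + Im b * Im p)) * b - p)"
    by (simp add: plane_point_def algebra_simps)
  then show "half_turn (T (plane_point w e b)) (T w) (T (plane_point w e p)) = T (plane_point w e (b\<^sup>2 * cnj p))"
    unfolding half_turn_def inner_T_plane_point[OF we] * by (simp flip: T_simps)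
  show "half_turn (T (plane_point w e b)) (T w) \<zeta> = - \<zeta>"
    by (simp add: half_turn_def axis_simps)
qed

lemma half_turn_axis:
  "half_turn \<zeta> (T w) (T x + s *\<^sub>R \<zeta>) = - T x + s *\<^sub>R \<zeta>" if "w \<bullet> x = 0"
  using that by (simp add: half_turn_def axis_simps inner_T inner_add_right algebra_simps)
    (simp add: vec_eq_iff)

text \<open>An orthogonal map fixing \<open>T w\<close> and preserving the axis line preserves their
  common orthogonal plane, and on a plane it is a rotation or a reflection.\<close>

lemma SO_on_plane_action:
  assumes we: "orthonormal_pair w e" and phi: "\<phi> \<in> SO_on (perp (T w))" and ax: "\<phi> \<zeta> = k *\<^sub>R \<zeta>" "\<bar>k\<bar> = 1"
  obtains u where "cmod u = 1" "(\<forall>p. \<phi> (T (plane_point w e p)) = T (plane_point w e (u * p))) \<or>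
    (\<forall>p. \<phi> (T (plane_point w e p)) = T (plane_point w e (u * cnj p)))"
proof -
  have orth: "orthogonal_transformation \<phi>" using phi by (simp add: SO_on_def)
  have lin: "linear \<phi>" using orth orthogonal_transformation_linear by blast
  have inner: "\<phi> v \<bullet> \<phi> z = v \<bullet> z" for v z using orth by (simp add: orthogonal_transformation_def)
  have fw: "\<phi> (T w) = T w" by (rule SO_on_perp_fixes[OF phi])
  have img: "\<exists>q. \<phi> (T (plane_point w e p)) = T (plane_point w e q)" for p
  proof -
    let ?v = "\<phi> (T (plane_point w e p))"
    have "T w \<bullet> ?v = 0" using inner[of "T w" "T (plane_point w e p)"] fw inner_T_plane_point[OF we] by simp
    then obtain x where x: "?v = T x + (?v \<bullet> \<zeta>) *\<^sub>R \<zeta>" "w \<bullet> x = 0" using perp_decompose by blast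
    have "k * (?v \<bullet> \<zeta>) = 0" using inner[of "T (plane_point w e p)" \<zeta>] ax(1) by (simp add: axis_simps)
    then have "?v = T x" using x(1) ax(2) by auto
    then show ?thesis using plane_point_ex[OF we x(2)] by metis
  qed
  obtain u where u: "\<phi> (T (plane_point w e 1)) = T (plane_point w e u)" using img by blast
  obtain v where v: "\<phi> (T (plane_point w e \<i>)) = T (plane_point w e v)" using img by blast
  note ip = inner_T_plane_point(1)[OF we]
  have uu: "(Re u)\<^sup>2 + (Im u)\<^sup>2 = 1" "(Re v)\<^sup>2 + (Im v)\<^sup>2 = 1" "Re u * Re v + Im u * Im v = 0"
    using inner[of "T (plane_point w e 1)" "T (plane_point w e 1)"] inner[of "T (plane_point w e \<i>)" "T (plane_point w e \<i>)"]
      inner[of "T (plane_point w e 1)" "T (plane_point w e \<i>)"]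
    unfolding u v ip by (simp_all add: power2_eq_square)
  have u1: "cmod u = 1" using uu(1) by (simp add: cmod_def)
  \<comment> \<open>The determinant of \<open>\<phi>\<close> on the plane; orthogonality makes it 1
    or -1.\<close>
  define \<kappa> where "\<kappa> = Re u * Im v - Im u * Re v"
  have v\<kappa>: "v = of_real \<kappa> * (\<i> * u)"
  proof -
    have "Re v = (Re u * Re u + Im u * Im u) * Re v" "Im v = (Re u * Re u + Im u * Im u) * Im v"
      using uu(1) by (simp_all flip: power2_eq_square)
    moreover have "Re u * (Re u * Re v) = - (Re u * (Im u * Im v))" "Im u * (Re u * Re v) = - (Im u * (Im u * Im v))"
      using uu(3) by (metis add.commute eq_neg_iff_add_eq_0 mult_minus_right)+
    ultimately show ?thesis by (simp add: complex_eq_iff \<kappa>_def algebra_simps)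
  qed
  have "\<kappa>\<^sup>2 = 1"
  proof -
    have "cmod v = 1" using uu(2) by (simp add: cmod_def)
    then have "\<bar>\<kappa>\<bar> = 1" unfolding v\<kappa> using u1 by (simp add: norm_mult)
    then show ?thesis by (metis power2_abs one_power2)
  qed
  then have \<kappa>: "\<kappa> = 1 \<or> \<kappa> = -1" by (simp add: power2_eq_1_iff)
  have "plane_point w e p = Re p *\<^sub>R plane_point w e 1 + Im p *\<^sub>R plane_point w e \<i>" for p
    by (simp add: plane_point_def)
  then have "\<phi> (T (plane_point w e p)) = T (Re p *\<^sub>R plane_point w e u + Im p *\<^sub>R plane_point w e v)" for p
    using u v by (metis T_simps(1,3) linear_add[OF lin] linear_scale[OF lin])
  moreover have "Re p *\<^sub>R plane_point w e u + Im p *\<^sub>R plane_point w e v = plane_point w e (Re p * u + Im p * v)" for p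
    by (simp add: plane_point_def algebra_simps)
  ultimately have act: "\<phi> (T (plane_point w e p)) = T (plane_point w e (Re p * u + Im p * v))" for p by simp
  from \<kappa> show ?thesis
  proof
    assume "\<kappa> = 1"
    then have "Re p * u + Im p * v = u * p" for p unfolding v\<kappa> by (simp add: complex_eq_iff algebra_simps)
    then show ?thesis using that[OF u1] act by simp
  next
    assume "\<kappa> = -1"
    then have "Re p * u + Im p * v = u * cnj p" for p unfolding v\<kappa> by (simp add: complex_eq_iff algebra_simps)
    then show ?thesis using that[OF u1] act by simp
  qed
qed

text \<open>A reflection of the plane that fixes the axis would be a half-turn followed by
  \<open>reflection \<zeta>\<close>, of determinant -1. The square root of \<open>u\<close> is the
  direction of its mirror line.\<close>

lemma SO_on_plane_rotation:
  assumes we: "orthonormal_pair w e" and phi: "\<phi> \<in> SO_on (perp (T w))" and ax: "\<phi> \<zeta> = \<zeta>"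
  obtains u where "cmod u = 1" "\<And>p. \<phi> (T (plane_point w e p)) = T (plane_point w e (u * p))"
proof -
  obtain u where u: "cmod u = 1" and act: "(\<forall>p. \<phi> (T (plane_point w e p)) = T (plane_point w e (u * p))) \<or>
    (\<forall>p. \<phi> (T (plane_point w e p)) = T (plane_point w e (u * cnj p)))"
    by (rule SO_on_plane_action[OF we phi, of 1]) (use ax in auto)
  have lin: "linear \<phi>" and det: "det (matrix \<phi>) = 1"
    using phi orthogonal_transformation_linear by (auto simp: SO_on_def)
  have False if *: "\<forall>p. \<phi> (T (plane_point w e p)) = T (plane_point w e (u * cnj p))"
  proof -
    define b where "b = csqrt u"
    have b: "b\<^sup>2 = u" "cmod b = 1" using u by (simp_all add: b_def norm_csqrt)
    let ?h = "half_turn (T (plane_point w e b)) (T w)"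
    note ip = inner_T_plane_point[OF we]
    note h = half_turn_facts[of "T (plane_point w e b)" "T w", unfolded ip, OF b(2) refl]
    have hl: "linear ?h" "det (matrix ?h) = 1" using h(1,3) ip(2) by (auto simp: inner_commute)
    have "\<phi> = reflection \<zeta> \<circ> ?h"
    proof (rule linear_eq_frame[OF we lin linear_compose[OF hl(1) linear_reflection]])
      show "\<phi> (T (plane_point w e p)) = (reflection \<zeta> \<circ> ?h) (T (plane_point w e p))" for p
        using * b by (simp add: half_turn_T[OF we] reflection_def axis_simps)
      show "\<phi> (T w) = (reflection \<zeta> \<circ> ?h) (T w)"
        using SO_on_perp_fixes[OF phi] h(6) ip(2) by (simp add: inner_commute reflection_def axis_simps)
      show "\<phi> \<zeta> = (reflection \<zeta> \<circ> ?h) \<zeta>"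
        using ax b(2) by (simp add: half_turn_T[OF we] reflection_def axis_simps) (simp add: vec_eq_iff)
    qed
    then have "det (matrix \<phi>) = -1"
      by (simp only: matrix_compose[OF hl(1) linear_reflection] det_mul hl(2) det_reflection[OF norm_axis])
    then show False using det by simp
  qed
  then show ?thesis using act u that by blast
qed

text \<open>A rotation of the plane that reverses the axis would be a half-turn composed with one
  reflection, again of determinant -1.\<close>

lemma SO_on_plane_flip:
  assumes we: "orthonormal_pair w e" and phi: "\<phi> \<in> SO_on (perp (T w))" and ax: "\<phi> \<zeta> = - \<zeta>"
  obtains u where "cmod u = 1" "\<And>p. \<phi> (T (plane_point w e p)) = T (plane_point w e (u * cnj p))"
proof -
  obtain u where u: "cmod u = 1" and act: "(\<forall>p. \<phi> (T (plane_point w e p)) = T (plane_point w e (u * p))) \<or>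
    (\<forall>p. \<phi> (T (plane_point w e p)) = T (plane_point w e (u * cnj p)))"
    by (rule SO_on_plane_action[OF we phi, of "-1"]) (use ax in auto)
  have lin: "linear \<phi>" and det: "det (matrix \<phi>) = 1"
    using phi orthogonal_transformation_linear by (auto simp: SO_on_def)
  have False if *: "\<forall>p. \<phi> (T (plane_point w e p)) = T (plane_point w e (u * p))"
  proof -
    define b where "b = csqrt u"
    have b: "b\<^sup>2 = u" "cmod b = 1" using u by (simp_all add: b_def norm_csqrt)
    let ?h = "half_turn (T (plane_point w e b)) (T w)" and ?r = "reflection (T (plane_point w e \<i>))"
    note ip = inner_T_plane_point[OF we]
    note h = half_turn_facts[of "T (plane_point w e b)" "T w", unfolded ip, OF b(2) refl]
    have hl: "linear ?h" "det (matrix ?h) = 1" using h(1,3) ip(2) by (auto simp: inner_commute)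
    have r: "?r (T (plane_point w e p)) = T (plane_point w e (cnj p))" for p
    proof -
      have "plane_point w e p - (2 * Im p) *\<^sub>R plane_point w e \<i> = plane_point w e (cnj p)"
        by (simp add: plane_point_def vec_eq_iff)
      then show ?thesis unfolding reflection_def ip by (simp flip: T_simps)
    qed
    have "\<phi> = ?h \<circ> ?r"
    proof (rule linear_eq_frame[OF we lin linear_compose[OF linear_reflection hl(1)]])
      show "\<phi> (T (plane_point w e p)) = (?h \<circ> ?r) (T (plane_point w e p))" for p
        using * b by (simp add: half_turn_T[OF we] r)
      show "\<phi> (T w) = (?h \<circ> ?r) (T w)"
        using SO_on_perp_fixes[OF phi] h(6) ip(2) by (simp add: inner_commute reflection_def)
      show "\<phi> \<zeta> = (?h \<circ> ?r) \<zeta>"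
        using ax b(2) by (simp add: half_turn_T[OF we] reflection_def axis_simps)
    qed
    moreover have "norm (T (plane_point w e \<i>)) = 1" using ip by simp
    ultimately have "det (matrix \<phi>) = -1"
      by (simp only: matrix_compose[OF linear_reflection hl(1)] det_mul hl(2) det_reflection)
    then show False using det by simp
  qed
  then show ?thesis using act u that by blast
qed

end

section \<open>Sections of star bodies by half-planes\<close>

text \<open>Compactness makes the greatest multiple exist; star-shapedness supplies the smaller
  ones.\<close>

lemma scale_mem_iff_le_radial:
  fixes y :: "'a::euclidean_space"
  assumes K: "compact K" "star_shaped K" "0 \<in> K" and y: "y \<noteq> 0" and s: "0 \<le> s"
  shows "s *\<^sub>R y \<in> K \<longleftrightarrow> s \<le> radial_function K y"
proof -
  let ?C = "{c. c *\<^sub>R y \<in> K}"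
  have "continuous_on UNIV (\<lambda>c. c *\<^sub>R y)" by (intro continuous_intros)
  from closed_vimage[OF compact_imp_closed[OF K(1)] this] have "closed ?C" by (simp add: vimage_def)
  moreover have "bounded ?C"
  proof -
    obtain B where B: "\<And>x. x \<in> K \<Longrightarrow> norm x \<le> B" using compact_imp_bounded[OF K(1)] bounded_iff by blast
    have "norm c \<le> B / norm y" if "c \<in> ?C" for c
      using B[of "c *\<^sub>R y"] that y by (simp add: field_simps)
    then show ?thesis unfolding bounded_iff by blast
  qed
  ultimately have cC: "compact ?C" by (simp add: compact_eq_bounded_closed)
  have "0 \<in> ?C" using K(3) by simp
  then have "?C \<noteq> {}" by blast
  then obtain c where c: "c \<in> ?C" "\<And>d. d \<in> ?C \<Longrightarrow> d \<le> c" using compact_attains_sup[OF cC] by metis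
  have r: "radial_function K y = c" unfolding radial_function_def by (rule Greatest_equality) (use c in auto)
  have "s *\<^sub>R y \<in> K" if "s \<le> c"
  proof (cases "c = 0")
    case True
    then show ?thesis using that s K(3) by simp
  next
    case False
    then have "s *\<^sub>R y = (1 - s / c) *\<^sub>R 0 + (s / c) *\<^sub>R (c *\<^sub>R y)" "0 \<le> s / c" "s / c \<le> 1"
      using that s by auto
    then have "s *\<^sub>R y \<in> closed_segment 0 (c *\<^sub>R y)" unfolding in_segment by blast
    then show ?thesis using K(2) c(1) unfolding star_shaped_def by blast
  qed
  then show ?thesis unfolding r using c(2) by auto
qed

lemma infdist_le_of_close:
  fixes A B :: "'a::heine_borel set"
  assumes "closed A" "A \<noteq> {}" "\<And>a. a \<in> A \<Longrightarrow> \<exists>b\<in>B. dist a b \<le> e"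
  shows "infdist q B \<le> infdist q A + e"
proof -
  obtain a where a: "a \<in> A" "infdist q A = dist q a" using infdist_attains_inf[OF assms(1,2)] by metis
  obtain b where b: "b \<in> B" "dist a b \<le> e" using assms(3) a(1) by blast
  have "infdist q B \<le> dist q b" by (rule infdist_le[OF b(1)])
  also have "\<dots> \<le> dist q a + dist a b" by (rule dist_triangle)
  finally show ?thesis using a b by simp
qed

lemma star_body_facts:
  assumes "star_body K"
  shows "compact K" "star_shaped K" "0 \<in> K" "continuous_on (- {0}) (radial_function K)"
proof -
  show *: "compact K" "star_shaped K" "continuous_on (- {0}) (radial_function K)"
    using assms by (auto simp: star_body_def body_def)
  have "K \<noteq> {}" using assms interior_subset[of K] by (auto simp: star_body_def body_def)
  then show "0 \<in> K" using *(2) unfolding star_shaped_def by fastforce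
qed

context axis_frame
begin

definition half_slice :: "(real ^ 4) set \<Rightarrow> real \<Rightarrow> real ^ 3 \<Rightarrow> (real \<times> real) set" where
  "half_slice K c x = {(r, t). 0 \<le> r \<and> T (r *\<^sub>R x) + (t + c) *\<^sub>R \<zeta> \<in> K}"

text \<open>Recording a half-plane section of \<open>K\<close> by its distance function makes the dependence on \<open>x\<close> continuous
  even though the section is taken in coordinates shifted by \<open>c\<close> along the axis, in which \<open>K\<close> need not be
  star-shaped.\<close>

definition colour :: "(real ^ 4) set \<Rightarrow> real \<Rightarrow> real ^ 3 \<Rightarrow> real \<times> real \<Rightarrow> real" where
  "colour K c x q = infdist q (half_slice K c x)"

lemma half_slice_nonempty:
  assumes "star_body K"
  shows "half_slice K c x \<noteq> {}"
proof -
  have "(0, - c) \<in> half_slice K c x" using star_body_facts(3)[OF assms] by (simp add: half_slice_def T_simps)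
  then show ?thesis by blast
qed

lemma closed_half_slice:
  assumes "star_body K"
  shows "closed (half_slice K c x)"
proof -
  have cT: "continuous_on S T" for S using linear_T by (simp add: linear_continuous_on linear_linear)
  have "closed ({q. 0 \<le> fst q} \<inter> (\<lambda>q. T (fst q *\<^sub>R x) + (snd q + c) *\<^sub>R \<zeta>) -` K)"
    by (intro continuous_closed_preimage compact_imp_closed star_body_facts(1)[OF assms] closed_Collect_le
        continuous_intros continuous_on_compose2[OF cT[of UNIV]]) auto
  also have "{q. 0 \<le> fst q} \<inter> (\<lambda>q. T (fst q *\<^sub>R x) + (snd q + c) *\<^sub>R \<zeta>) -` K = half_slice K c x"
    by (auto simp: half_slice_def)
  finally show ?thesis .
qed

text \<open>A point of the slice lies on a ray from the centre of star-shapedness. The ray is moved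
  along with \<open>x\<close> and the point is cut back to the boundary in the new direction, which
  costs at most the change of the radial function.\<close>

lemma half_slice_close:
  assumes K: "star_body K"
    and \<delta>: "\<And>y y'. norm y = 1 \<Longrightarrow> norm y' = 1 \<Longrightarrow> dist y y' < \<delta> \<Longrightarrow> \<bar>radial_function K y - radial_function K y'\<bar> \<le> e"
    and "0 \<le> e" and x: "norm x = 1" "norm x' = 1" "dist x x' < \<delta>" and a: "a \<in> half_slice K c x"
  shows "\<exists>b\<in>half_slice K c x'. dist a b \<le> e"
proof -
  note kf = star_body_facts[OF K]
  obtain r s where rt: "a = (r, s - c)" "0 \<le> r" "T (r *\<^sub>R x) + s *\<^sub>R \<zeta> \<in> K"
  \<comment> \<open>The shift by \<open>c\<close> is undone here, so that polar coordinates are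
    taken about the origin.\<close>
  proof -
    obtain r t where "a = (r, t)" "0 \<le> r" "T (r *\<^sub>R x) + (t + c) *\<^sub>R \<zeta> \<in> K"
      using a by (auto simp: half_slice_def)
    then show ?thesis using that[of r "t + c"] by simp
  qed
  define R where "R = sqrt (r\<^sup>2 + s\<^sup>2)"
  show ?thesis
  proof (cases "R = 0")
    case True
    then have "r = 0" "s = 0" by (simp_all add: R_def add_nonneg_eq_0_iff)
    then have "a \<in> half_slice K c x'" using rt by (simp add: half_slice_def)
    then show ?thesis using \<open>0 \<le> e\<close> by (intro bexI[of _ a]) auto
  next
    case False
    have "R \<ge> 0" by (simp add: R_def)
    then have R: "R > 0" using False by simp
    have R2: "R\<^sup>2 = r\<^sup>2 + s\<^sup>2" by (simp add: R_def)
    define y where "y = (\<lambda>x. T ((r / R) *\<^sub>R x) + (s / R) *\<^sub>R \<zeta>)"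
    have ny: "norm (y x) = 1" if "norm x = 1" for x
    proof -
      have "(norm (y x))\<^sup>2 = (r / R)\<^sup>2 * (norm x)\<^sup>2 + (s / R)\<^sup>2"
        unfolding power2_norm_eq_inner y_def
        by (simp add: inner_add_left inner_add_right T_simps inner_T axis_simps power2_eq_square)
      also have "\<dots> = R\<^sup>2 / R\<^sup>2" unfolding that power_divide power_one mult_1_right R2 by (simp only: add_divide_distrib)
      finally have "(norm (y x))\<^sup>2 = 1\<^sup>2" using R by simp
      then show ?thesis by (rule power2_eq_imp_eq) auto
    qed
    have "y x - y x' = T ((r / R) *\<^sub>R (x - x'))"
      by (simp add: y_def T_simps algebra_simps)
    then have "dist (y x) (y x') = (r / R) * dist x x'"
      using rt(2) R by (simp add: dist_norm norm_T)
    also have "\<dots> \<le> 1 * dist x x'"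
    proof (rule mult_right_mono)
      have "r\<^sup>2 \<le> R\<^sup>2" by (simp add: R2)
      then have "r \<le> R" using \<open>R \<ge> 0\<close> by (rule power2_le_imp_le)
      then show "r / R \<le> 1" using R by simp
    qed simp
    finally have rad: "\<bar>radial_function K (y x) - radial_function K (y x')\<bar> \<le> e"
      using x by (intro \<delta> ny) auto
    have y0: "y x \<noteq> 0" "y x' \<noteq> 0" using ny x by fastforce+
    have Ry: "T (r *\<^sub>R x) + s *\<^sub>R \<zeta> = R *\<^sub>R y x"
      using R by (simp add: y_def T_simps algebra_simps)
    then have "R \<le> radial_function K (y x)"
      using scale_mem_iff_le_radial[OF kf(1-3) y0(1) \<open>R \<ge> 0\<close>] rt(3) by simp
    define R' where "R' = min R (radial_function K (y x'))"
    have "0 \<le> radial_function K (y x')"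
      using scale_mem_iff_le_radial[OF kf(1-3) y0(2), of 0] kf(3) by simp
    then have R'0: "0 \<le> R'" using R by (simp add: R'_def)
    have R': "R' \<le> R" "R - R' \<le> e" using rad \<open>R \<le> radial_function K (y x)\<close> \<open>0 \<le> e\<close> by (auto simp: R'_def)
    let ?b = "(R' / R * r, R' / R * s - c)"
    have "T ((R' / R * r) *\<^sub>R x') + (R' / R * s) *\<^sub>R \<zeta> = R' *\<^sub>R y x'"
      by (simp add: y_def T_simps algebra_simps)
    also have "\<dots> \<in> K" using scale_mem_iff_le_radial[OF kf(1-3) y0(2) R'0] by (simp add: R'_def)
    finally have "?b \<in> half_slice K c x'" using R'0 R rt(2) by (simp add: half_slice_def)
    moreover have "dist a ?b \<le> e"
    proof -
      have "r - R' / R * r = (1 - R' / R) * r" "s - c - (R' / R * s - c) = (1 - R' / R) * s"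
        by (simp_all add: algebra_simps)
      then have "dist a ?b = sqrt (((1 - R' / R) * r)\<^sup>2 + ((1 - R' / R) * s)\<^sup>2)"
        unfolding rt(1) dist_prod_def by (simp add: dist_real_def)
      also have "((1 - R' / R) * r)\<^sup>2 + ((1 - R' / R) * s)\<^sup>2 = ((1 - R' / R) * R)\<^sup>2"
        by (simp add: power_mult_distrib R2 distrib_left)
      also have "(1 - R' / R) * R = R - R'" using R by (simp add: field_simps)
      finally show ?thesis using R' by simp
    qed
    ultimately show ?thesis by blast
  qed
qed

lemma continuous_colour:
  assumes K: "star_body K"
  shows "continuous_on (sphere 0 1) (\<lambda>x. colour K c x q)"
proof -
  have "uniformly_continuous_on (sphere 0 1) (radial_function K)"
    by (intro compact_uniformly_continuous continuous_on_subset[OF star_body_facts(4)[OF K]]) auto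
  then have uc: "\<exists>\<delta>>0. \<forall>y y'. norm y = 1 \<longrightarrow> norm y' = 1 \<longrightarrow> dist y y' < \<delta> \<longrightarrow>
      \<bar>radial_function K y - radial_function K y'\<bar> \<le> e" if "e > 0" for e
  proof -
    obtain \<delta> where "\<delta> > 0" and \<delta>: "\<And>y y'. y \<in> sphere 0 1 \<Longrightarrow> y' \<in> sphere 0 1 \<Longrightarrow> dist y' y < \<delta> \<Longrightarrow>
      dist (radial_function K y') (radial_function K y) < e"
      using \<open>uniformly_continuous_on _ _\<close> \<open>e > 0\<close> unfolding uniformly_continuous_on_def by metis
    have "\<bar>radial_function K y - radial_function K y'\<bar> \<le> e"
      if "norm y = 1" "norm y' = 1" "dist y y' < \<delta>" for y y'
      using \<delta>[of y' y] that by (simp add: dist_real_def)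
    then show ?thesis using \<open>\<delta> > 0\<close> by blast
  qed
  show ?thesis
    unfolding continuous_on_iff
  proof (intro ballI allI impI)
    fix x and e :: real assume x: "x \<in> sphere (0 :: real ^ 3) 1" and e: "0 < e"
    obtain \<delta> where \<delta>: "\<delta> > 0" "\<And>y y'. norm y = 1 \<Longrightarrow> norm y' = 1 \<Longrightarrow> dist y y' < \<delta> \<Longrightarrow>
      \<bar>radial_function K y - radial_function K y'\<bar> \<le> e / 2"
      using uc[of "e / 2"] e by auto
    have le: "colour K c x' q \<le> colour K c x q + e / 2"
      if "norm x = 1" "norm x' = 1" "dist x x' < \<delta>" for x x'
      unfolding colour_def
      by (rule infdist_le_of_close[OF closed_half_slice[OF K] half_slice_nonempty[OF K]])
        (rule half_slice_close[OF K \<delta>(2) _ that], use e in auto)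
    show "\<exists>d>0. \<forall>x'\<in>sphere 0 1. dist x' x < d \<longrightarrow> dist (colour K c x' q) (colour K c x q) < e"
    proof (intro exI[of _ \<delta>] conjI ballI impI)
      fix x' assume "x' \<in> sphere (0 :: real ^ 3) 1" "dist x' x < \<delta>"
      then show "dist (colour K c x' q) (colour K c x q) < e"
        using le[of x x'] le[of x' x] x e by (simp add: dist_real_def dist_commute abs_less_iff)
    qed (rule \<delta>(1))
  qed
qed

definition mem :: "(real ^ 4) set \<Rightarrow> real \<Rightarrow> real ^ 3 \<Rightarrow> real \<Rightarrow> bool" where
  "mem K c x t \<longleftrightarrow> T x + (t + c) *\<^sub>R \<zeta> \<in> K"

lemma mem_iff: "T x + s *\<^sub>R \<zeta> \<in> K \<longleftrightarrow> mem K c x (s - c)"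
  by (simp add: mem_def)

lemma half_slice_iff: "(r, t) \<in> half_slice K c x \<longleftrightarrow> 0 \<le> r \<and> mem K c (r *\<^sub>R x) t"
  by (simp add: half_slice_def mem_def)

text \<open>A nonempty closed set is the zero set of its distance function, so the colour determines
  the slice.\<close>

lemma colour_eq_iff:
  assumes "star_body K" "star_body L"
  shows "colour K c x = colour L d y \<longleftrightarrow> (\<forall>r\<ge>0. \<forall>t. mem K c (r *\<^sub>R x) t \<longleftrightarrow> mem L d (r *\<^sub>R y) t)"
proof
  assume "colour K c x = colour L d y"
  then have "q \<in> half_slice K c x \<longleftrightarrow> q \<in> half_slice L d y" for q
    using in_closed_iff_infdist_zero[OF closed_half_slice[OF assms(1), of c x] half_slice_nonempty[OF assms(1), of c x], of q]
      in_closed_iff_infdist_zero[OF closed_half_slice[OF assms(2), of d y] half_slice_nonempty[OF assms(2), of d y], of q]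
    unfolding colour_def[symmetric] by simp
  then show "\<forall>r\<ge>0. \<forall>t. mem K c (r *\<^sub>R x) t \<longleftrightarrow> mem L d (r *\<^sub>R y) t"
    by (metis half_slice_iff)
next
  assume "\<forall>r\<ge>0. \<forall>t. mem K c (r *\<^sub>R x) t \<longleftrightarrow> mem L d (r *\<^sub>R y) t"
  then have "half_slice K c x = half_slice L d y" by (auto simp: half_slice_iff)
  then show "colour K c x = colour L d y" by (simp add: fun_eq_iff colour_def)
qed

definition turn_over :: "real \<times> real \<Rightarrow> real \<times> real" where
  "turn_over q = (fst q, - snd q)"

lemma infdist_turn_over: "infdist (turn_over q) A = infdist q (turn_over ` A)"
proof -
  have "dist q (turn_over a) = dist (turn_over q) a" for a
    by (simp add: dist_prod_def turn_over_def dist_real_def power2_eq_square algebra_simps)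
  then show ?thesis by (simp add: infdist_def image_image)
qed

lemma colour_turn_over_iff:
  assumes "star_body K" "star_body L"
  shows "colour K c x = colour L d y \<circ> turn_over \<longleftrightarrow> (\<forall>r\<ge>0. \<forall>t. mem K c (r *\<^sub>R x) t \<longleftrightarrow> mem L d (r *\<^sub>R y) (- t))"
proof
  assume "colour K c x = colour L d y \<circ> turn_over"
  then have "q \<in> half_slice K c x \<longleftrightarrow> turn_over q \<in> half_slice L d y" for q
    using in_closed_iff_infdist_zero[OF closed_half_slice[OF assms(1), of c x] half_slice_nonempty[OF assms(1), of c x], of q]
      in_closed_iff_infdist_zero[OF closed_half_slice[OF assms(2), of d y] half_slice_nonempty[OF assms(2), of d y], of "turn_over q"]
    unfolding colour_def[symmetric] by simp
  then have "(r, t) \<in> half_slice K c x \<longleftrightarrow> (r, - t) \<in> half_slice L d y" for r t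
    by (simp add: turn_over_def)
  then show "\<forall>r\<ge>0. \<forall>t. mem K c (r *\<^sub>R x) t \<longleftrightarrow> mem L d (r *\<^sub>R y) (- t)"
    unfolding half_slice_iff by blast
next
  assume "\<forall>r\<ge>0. \<forall>t. mem K c (r *\<^sub>R x) t \<longleftrightarrow> mem L d (r *\<^sub>R y) (- t)"
  then have iff: "q \<in> half_slice K c x \<longleftrightarrow> turn_over q \<in> half_slice L d y" for q
    by (cases q) (auto simp: half_slice_iff turn_over_def)
  have "turn_over (turn_over q) = q" for q by (simp add: turn_over_def)
  then have "turn_over ` half_slice L d y = {q. turn_over q \<in> half_slice L d y}"
    by (intro set_eqI iffI) (auto, metis image_eqI)
  then have "half_slice K c x = turn_over ` half_slice L d y" using iff by blast
  then show "colour K c x = colour L d y \<circ> turn_over"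
    by (simp add: fun_eq_iff colour_def infdist_turn_over)
qed

lemma colour_no_half_turn:
  assumes K: "star_body K" and w: "norm w = 1"
    and ns: "\<not> pi_symmetric_in (perp (T w)) \<zeta> (K \<inter> perp (T w))"
  shows "\<exists>x. norm x = 1 \<and> w \<bullet> x = 0 \<and> colour K c (- x) \<noteq> colour K c x"
proof (rule ccontr)
  assume *: "\<not> ?thesis"
  have sym: "mem K c (- x) t \<longleftrightarrow> mem K c x t" if x: "w \<bullet> x = 0" for x t
  proof (cases "x = 0")
    case False
    define y where "y = x /\<^sub>R norm x"
    have y: "norm y = 1" "w \<bullet> y = 0" "norm x *\<^sub>R y = x" using False x by (simp_all add: y_def)
    then have "colour K c (- y) = colour K c y" using * by blast
    then have "mem K c (norm x *\<^sub>R - y) t \<longleftrightarrow> mem K c (norm x *\<^sub>R y) t" unfolding colour_eq_iff[OF K K] by simp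
    then show ?thesis using y by simp
  qed simp
  have "pi_symmetric_in (perp (T w)) \<zeta> (K \<inter> perp (T w))"
  proof (rule pi_symmetric_in_half_turn[where a = 0])
    fix z assume "T w \<bullet> z = 0"
    then obtain x where x: "z = T x + (z \<bullet> \<zeta>) *\<^sub>R \<zeta>" "w \<bullet> x = 0" using perp_decompose by blast
    have "half_turn \<zeta> (T w) z = T (- x) + (z \<bullet> \<zeta>) *\<^sub>R \<zeta>"
      using half_turn_axis[OF x(2), of "z \<bullet> \<zeta>"] x(1) by (simp add: T_simps)
    then show "z \<in> K \<longleftrightarrow> half_turn \<zeta> (T w) z - 0 \<in> K"
      using sym[OF x(2)] x(1) mem_iff[of x _ K c] mem_iff[of "- x" _ K c] by (metis diff_zero)
  qed (use w norm_axis axis_simps norm_T in auto)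
  then show False using ns by blast
qed

lemma colour_no_flip:
  assumes K: "star_body K" and we: "orthonormal_pair w e" and v: "cmod v = 1"
    and ns: "\<And>u. u \<in> perp \<zeta> \<inter> perp (T w) \<inter> sphere 0 1 \<Longrightarrow> \<not> pi_symmetric_in (perp (T w)) u (K \<inter> perp (T w))"
  shows "\<exists>p. cmod p = 1 \<and> colour K c (plane_point w e (v * cnj p)) \<noteq> colour K c (plane_point w e p) \<circ> turn_over"
proof (rule ccontr)
  assume *: "\<not> ?thesis"
  have scale: "r *\<^sub>R plane_point w e p = plane_point w e (of_real r * p)" for r p
    by (simp add: plane_point_def algebra_simps)
  have sym: "mem K c (plane_point w e (v * cnj p)) t \<longleftrightarrow> mem K c (plane_point w e p) (- t)" for p t
  proof -
    obtain p' where p': "cmod p' = 1" "p = of_real (cmod p) * p'"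
    proof (cases "p = 0")
      case True
      then show ?thesis using that[of 1] by simp
    next
      case False
      then show ?thesis using that[of "p / of_real (cmod p)"] by (simp add: norm_divide)
    qed
    have "colour K c (plane_point w e (v * cnj p')) = colour K c (plane_point w e p') \<circ> turn_over"
      using * p'(1) by blast
    then have "mem K c (cmod p *\<^sub>R plane_point w e (v * cnj p')) t \<longleftrightarrow> mem K c (cmod p *\<^sub>R plane_point w e p') (- t)"
      unfolding colour_turn_over_iff[OF K K] by simp
    moreover have "of_real (cmod p) * (v * cnj p') = v * cnj p"
      by (subst (2) p'(2)) simp
    ultimately show ?thesis unfolding scale p'(2)[symmetric] by simp
  qed
  define b where "b = csqrt v"
  have b: "b\<^sup>2 = v" "cmod b = 1" using v by (simp_all add: b_def norm_csqrt)
  note ip = inner_T_plane_point[OF we]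
  define u where "u = T (plane_point w e b)"
  have u: "norm u = 1" "u \<bullet> T w = 0" "\<zeta> \<bullet> u = 0" using ip b by (simp_all add: u_def inner_commute axis_simps)
  have "pi_symmetric_in (perp (T w)) u (K \<inter> perp (T w))"
  \<comment> \<open>The half-turn reverses heights about the origin, the colours about height
    \<open>c\<close>; the two differ by a translation of \<open>2 * c\<close> along the
    axis.\<close>
  proof (rule pi_symmetric_in_half_turn[where a = "(- 2 * c) *\<^sub>R \<zeta>", OF u(1) ip(4) u(2)])
    show "T w \<bullet> ((- 2 * c) *\<^sub>R \<zeta>) = 0" by (simp add: axis_simps)
    fix z assume "T w \<bullet> z = 0"
    then obtain x where x: "z = T x + (z \<bullet> \<zeta>) *\<^sub>R \<zeta>" "w \<bullet> x = 0" using perp_decompose by blast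
    obtain p where p: "x = plane_point w e p" using plane_point_ex[OF we x(2)] by metis
    have lin: "linear (half_turn u (T w))" using half_turn_facts(1)[OF u(1) ip(4) u(2)] .
    have "half_turn u (T w) z = half_turn u (T w) (T x) + (z \<bullet> \<zeta>) *\<^sub>R half_turn u (T w) \<zeta>"
      by (subst x(1)) (simp add: linear_add[OF lin] linear_scale[OF lin])
    also have "\<dots> = T (plane_point w e (v * cnj p)) + (- (z \<bullet> \<zeta>)) *\<^sub>R \<zeta>"
      unfolding u_def p half_turn_T[OF we b(2)] b(1) by simp
    finally have h: "half_turn u (T w) z - (- 2 * c) *\<^sub>R \<zeta> = T (plane_point w e (v * cnj p)) + (2 * c - z \<bullet> \<zeta>) *\<^sub>R \<zeta>"
      by (simp add: algebra_simps)
    have "half_turn u (T w) z - (- 2 * c) *\<^sub>R \<zeta> \<in> K \<longleftrightarrow> mem K c (plane_point w e (v * cnj p)) (2 * c - z \<bullet> \<zeta> - c)"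
      unfolding h by (rule mem_iff)
    also have "\<dots> \<longleftrightarrow> mem K c (plane_point w e p) (z \<bullet> \<zeta> - c)" unfolding sym by simp
    also have "\<dots> \<longleftrightarrow> T x + (z \<bullet> \<zeta>) *\<^sub>R \<zeta> \<in> K" unfolding p by (rule mem_iff[symmetric])
    also have "\<dots> \<longleftrightarrow> z \<in> K" by (simp only: x(1)[symmetric])
    finally show "z \<in> K \<longleftrightarrow> half_turn u (T w) z - (- 2 * c) *\<^sub>R \<zeta> \<in> K" by simp
  qed
  moreover have "u \<in> perp \<zeta> \<inter> perp (T w) \<inter> sphere 0 1" using u by (simp add: inner_commute)
  ultimately show False using ns by blast
qed

end

section \<open>Diameters and the reduction to colourings\<close>

lemma axis_frame_exists:
  fixes \<zeta> :: "real ^ 4"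
  assumes "norm \<zeta> = 1"
  obtains T where "axis_frame T \<zeta>"
proof -
  have zz: "\<zeta> \<bullet> \<zeta> = 1" "\<zeta> \<noteq> 0" using assms by (auto simp: dot_square_norm)
  have "dim (UNIV :: (real ^ 3) set) = dim (perp \<zeta>)"
    using dim_hyperplane[OF zz(2)] by simp
  then obtain f g where f: "linear f" "f ` UNIV = perp \<zeta>" "\<And>x :: real ^ 3. norm (f x) = norm x"
    using isometries_subspaces[OF subspace_UNIV subspace_hyperplane] by (metis UNIV_I)
  have "axis_frame f \<zeta>"
  proof (rule axis_frame.intro)
    show "f x \<bullet> \<zeta> = 0" for x using f(2) by (auto simp: inner_commute)
    show "\<exists>x. z = f x + (z \<bullet> \<zeta>) *\<^sub>R \<zeta>" for z
    proof -
      have "z - (z \<bullet> \<zeta>) *\<^sub>R \<zeta> \<in> perp \<zeta>" using zz(1) by (simp add: inner_diff_right inner_commute)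
      then obtain x where "z - (z \<bullet> \<zeta>) *\<^sub>R \<zeta> = f x" using f(2) by blast
      then show ?thesis by (metis diff_add_cancel)
    qed
  qed (use f assms in auto)
  then show ?thesis by (rule that)
qed

lemma segment_forward:
  assumes "linear \<phi>" "\<phi> ` A = (\<lambda>x. x + a) ` B" "closed_segment x y \<subseteq> A"
  shows "closed_segment (\<phi> x - a) (\<phi> y - a) \<subseteq> B"
proof
  fix z assume "z \<in> closed_segment (\<phi> x - a) (\<phi> y - a)"
  then have "z \<in> closed_segment (- a + \<phi> x) (- a + \<phi> y)" by simp
  then obtain s where s: "s \<in> closed_segment x y" "z = - a + \<phi> s"
    unfolding closed_segment_translation closed_segment_linear_image[OF assms(1)] by blast
  then have "\<phi> s \<in> (\<lambda>x. x + a) ` B" using assms(2,3) by blast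
  then show "z \<in> B" using s(2) by auto
qed

lemma segment_backward:
  fixes \<phi> :: "'a::euclidean_space \<Rightarrow> 'a"
  assumes o: "orthogonal_transformation \<phi>" and eq: "\<phi> ` A = (\<lambda>x. x + a) ` B" and seg: "closed_segment x y \<subseteq> B"
  obtains x' y' where "closed_segment x' y' \<subseteq> A" "dist x' y' = dist x y"
proof -
  let ?\<psi> = "inv \<phi>"
  have bij: "bij \<phi>" using o by (rule orthogonal_transformation_bij)
  have o': "orthogonal_transformation ?\<psi>" using o by (rule orthogonal_transformation_inv)
  have lin: "linear ?\<psi>" using o' by (rule orthogonal_transformation_linear)
  have "?\<psi> ` ((\<lambda>x. x + a) ` B) = A" unfolding eq[symmetric] using bij by (simp add: image_inv_f_f bij_is_inj)
  moreover have "closed_segment (?\<psi> (x + a)) (?\<psi> (y + a)) = ?\<psi> ` ((\<lambda>x. x + a) ` closed_segment x y)"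
    unfolding closed_segment_linear_image[OF lin] using closed_segment_translation[of a x y] by (simp add: add.commute)
  ultimately have "closed_segment (?\<psi> (x + a)) (?\<psi> (y + a)) \<subseteq> A" using seg by blast
  moreover have "dist (?\<psi> (x + a)) (?\<psi> (y + a)) = dist x y"
    using o' unfolding orthogonal_transformation_isometry by simp
  ultimately show ?thesis by (rule that)
qed

lemma dense_off_hyperplanes:
  fixes V :: "(real ^ 3) set"
  assumes "countable V" "0 \<notin> V"
  shows "sphere 0 1 \<subseteq> closure {w. norm w = 1 \<and> (\<forall>v\<in>V. w \<bullet> v \<noteq> 0)}"
proof
  fix w :: "real ^ 3" assume "w \<in> sphere 0 1"
  then have w: "norm w = 1" by simp
  let ?N = "\<Union>v\<in>V. {x. v \<bullet> x = 0}"
  have "negligible ?N"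
    by (rule negligible_countable_Union) (use assms in \<open>auto intro!: negligible_hyperplane\<close>)
  show "w \<in> closure {w. norm w = 1 \<and> (\<forall>v\<in>V. w \<bullet> v \<noteq> 0)}"
    unfolding closure_approachable
  proof (intro allI impI)
    fix e :: real assume e: "e > 0"
    \<comment> \<open>Normalising back to the sphere can double the distance, hence
      \<open>e / 2\<close>; the bound 1 keeps the point away from 0.\<close>
    have "\<not> ball w (min (e / 2) 1) \<subseteq> ?N"
    proof
      assume "ball w (min (e / 2) 1) \<subseteq> ?N"
      then have "negligible (ball w (min (e / 2) 1))" by (rule negligible_subset[OF \<open>negligible ?N\<close>])
      moreover have "ball w (min (e / 2) 1) \<noteq> {}" using e by (simp add: ball_eq_empty not_le)
      ultimately show False using open_not_negligible open_ball by blast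
    qed
    then obtain x where "x \<in> ball w (min (e / 2) 1)" "x \<notin> ?N" by blast
    then have x: "dist w x < e / 2" "dist w x < 1" "x \<notin> ?N" by auto
    have x0: "x \<noteq> 0" using x(2) w by auto
    let ?y = "x /\<^sub>R norm x"
    have "dist ?y x = \<bar>1 - norm x\<bar>"
    proof -
      have "?y - x = (1 - norm x) *\<^sub>R ?y" using x0 by (simp add: algebra_simps)
      then show ?thesis using x0 by (simp add: dist_norm abs_mult)
    qed
    also have "\<dots> \<le> dist w x" using norm_triangle_ineq3[of w x] w by (simp add: dist_norm)
    finally have "dist ?y w < e" using x(1) dist_triangle[of ?y w x] by (simp add: dist_commute)
    moreover have "norm ?y = 1 \<and> (\<forall>v\<in>V. ?y \<bullet> v \<noteq> 0)"
      using x0 x(3) by (auto simp: inner_commute)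
    ultimately show "\<exists>y\<in>{w. norm w = 1 \<and> (\<forall>v\<in>V. w \<bullet> v \<noteq> 0)}. dist y w < e" by blast
  qed
qed

context axis_frame
begin

text \<open>The sign \<open>k\<close> decides between rotation and flip. The relation is read from
  the target, so the rotation enters through its inverse \<open>cnj u\<close>, whereas a reflection
  is its own inverse and keeps \<open>u\<close>.\<close>

lemma colour_related:
  assumes K: "star_body K" "star_body L" and we: "orthonormal_pair w e"
    and phi: "\<phi> \<in> SO_on (perp (T w))" and ax: "\<phi> \<zeta> = k *\<^sub>R \<zeta>" "\<bar>k\<bar> = 1"
    and rel: "\<And>x y t. w \<bullet> x = 0 \<Longrightarrow> \<phi> (T x) = T y \<Longrightarrow> mem K c x t \<longleftrightarrow> mem L d y (k * t)"
  shows "(\<exists>z. cmod z = 1 \<and> (\<forall>p. cmod p = 1 \<longrightarrow> colour K c (plane_point w e (p * z)) = colour L d (plane_point w e p))) \<or>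
    (\<exists>v. cmod v = 1 \<and> (\<forall>p. cmod p = 1 \<longrightarrow> colour K c (plane_point w e (v * cnj p)) = colour L d (plane_point w e p) \<circ> turn_over))"
proof -
  have wp: "w \<bullet> plane_point w e p = 0" for p by (rule plane_point_perp[OF orthonormal_pairD(3)[OF we]])
  have scale: "r *\<^sub>R plane_point w e p = plane_point w e (of_real r * p)" for r p
    by (simp add: plane_point_def algebra_simps)
  have "k = 1 \<or> k = -1" using ax(2) by auto
  then show ?thesis
  proof
    assume k: "k = 1"
    then obtain u where u: "cmod u = 1" "\<And>p. \<phi> (T (plane_point w e p)) = T (plane_point w e (u * p))"
      using SO_on_plane_rotation[OF we phi] ax(1) by (metis scaleR_one)
    have uu: "u * cnj u = 1" using u(1) complex_norm_square[of u] by simp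
    have "colour K c (plane_point w e (p * cnj u)) = colour L d (plane_point w e p)" for p
      unfolding colour_eq_iff[OF K] scale
    proof (intro allI impI)
      fix r t :: real
      have "mem K c (plane_point w e (of_real r * (p * cnj u))) t \<longleftrightarrow>
        mem L d (plane_point w e (u * (of_real r * (p * cnj u)))) (k * t)"
        by (rule rel[OF wp u(2)])
      moreover have "u * (of_real r * (p * cnj u)) = of_real r * p" using uu by (simp add: mult.assoc mult.left_commute[of u])
      ultimately show "mem K c (plane_point w e (of_real r * (p * cnj u))) t = mem L d (plane_point w e (of_real r * p)) t"
        using k by simp
    qed
    moreover have "cmod (cnj u) = 1" using u(1) by simp
    ultimately show ?thesis by blast
  next
    assume k: "k = -1"
    then obtain u where u: "cmod u = 1" "\<And>p. \<phi> (T (plane_point w e p)) = T (plane_point w e (u * cnj p))"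
      using SO_on_plane_flip[OF we phi] ax(1) by (metis scaleR_minus1_left)
    have uu: "u * cnj u = 1" using u(1) complex_norm_square[of u] by simp
    have "colour K c (plane_point w e (u * cnj p)) = colour L d (plane_point w e p) \<circ> turn_over" for p
      unfolding colour_turn_over_iff[OF K] scale
    proof (intro allI impI)
      fix r t :: real
      have "mem K c (plane_point w e (of_real r * (u * cnj p))) t \<longleftrightarrow>
        mem L d (plane_point w e (u * cnj (of_real r * (u * cnj p)))) (k * t)"
        by (rule rel[OF wp u(2)])
      moreover have "u * cnj (of_real r * (u * cnj p)) = (u * cnj u) * (of_real r * p)" by simp
      ultimately show "mem K c (plane_point w e (of_real r * (u * cnj p))) t = mem L d (plane_point w e (of_real r * p)) (- t)"
        using k uu by (simp only:) simp
    qed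
    then show ?thesis using u(1) by blast
  qed
qed

text \<open>Heights are measured from \<open>c\<close> in \<open>K\<close> and from \<open>d\<close>
  in \<open>L\<close>, so equal colours place the bodies a shift of \<open>c - d\<close> along the
  axis apart.\<close>

lemma equal_or_reflected:
  assumes K: "star_body K" "star_body L"
    and eq: "(\<forall>x. norm x = 1 \<longrightarrow> colour K c x = colour L d x) \<or> (\<forall>x. norm x = 1 \<longrightarrow> colour K c (- x) = colour L d x)"
  shows "\<exists>b. (\<exists>t. b = t *\<^sub>R \<zeta>) \<and>
    (K = (\<lambda>x. x + b) ` L \<or>
     (\<exists>\<O>. orthogonal_transformation \<O> \<and> (\<forall>x\<in>perp \<zeta>. \<O> x = - x) \<and> \<O> \<zeta> = \<zeta> \<and> K = (\<lambda>x. \<O> x + b) ` L))"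
proof -
  let ?b = "(c - d) *\<^sub>R \<zeta>"
  have memK: "T x + s *\<^sub>R \<zeta> \<in> K \<longleftrightarrow> mem K c x (s - c)" and memL: "T x + s *\<^sub>R \<zeta> \<in> L \<longleftrightarrow> mem L d x (s - d)" for x s
    by (rule mem_iff)+
  have unit: "\<exists>y r. norm y = 1 \<and> 0 \<le> r \<and> x = r *\<^sub>R y" for x :: "real ^ 3"
  proof (cases "x = 0")
    case True
    then show ?thesis by (intro exI[of _ "axis 1 1"] exI[of _ 0]) auto
  next
    case False
    then show ?thesis by (intro exI[of _ "x /\<^sub>R norm x"] exI[of _ "norm x"]) auto
  qed
  from eq show ?thesis
  proof
    assume *: "\<forall>x. norm x = 1 \<longrightarrow> colour K c x = colour L d x"
    have m: "mem K c x t \<longleftrightarrow> mem L d x t" for x t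
      using unit[of x] * unfolding colour_eq_iff[OF K] by metis
    have iff: "z \<in> K \<longleftrightarrow> z - ?b \<in> L" for z
    proof -
      obtain x where x: "z = T x + (z \<bullet> \<zeta>) *\<^sub>R \<zeta>" using decompose by blast
      have "z - ?b = T x + (z \<bullet> \<zeta> - (c - d)) *\<^sub>R \<zeta>" by (subst x) (simp add: algebra_simps)
      then have "z - ?b \<in> L \<longleftrightarrow> mem L d x (z \<bullet> \<zeta> - (c - d) - d)" unfolding memL[symmetric] by simp
      moreover have "z \<in> K \<longleftrightarrow> mem K c x (z \<bullet> \<zeta> - c)" unfolding memK[symmetric] x[symmetric] ..
      ultimately show ?thesis using m by simp
    qed
    have "K = (\<lambda>x. x + ?b) ` L"
    proof (intro set_eqI iffI)
      fix z assume "z \<in> K"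
      then show "z \<in> (\<lambda>x. x + ?b) ` L" unfolding iff by (rule rev_image_eqI) simp
    next
      fix z assume "z \<in> (\<lambda>x. x + ?b) ` L"
      then obtain l where "l \<in> L" "z = l + ?b" by blast
      then show "z \<in> K" unfolding iff by (metis add_diff_cancel_right')
    qed
    then show ?thesis by blast
  next
    assume *: "\<forall>x. norm x = 1 \<longrightarrow> colour K c (- x) = colour L d x"
    have m: "mem K c (- x) t \<longleftrightarrow> mem L d x t" for x t
      using unit[of x] * unfolding colour_eq_iff[OF K] by (metis scaleR_minus_right)
    define R where "R z = (2 * (\<zeta> \<bullet> z)) *\<^sub>R \<zeta> - z" for z
    have lin: "linear R" by (rule linearI) (simp_all add: R_def inner_add_right algebra_simps)
    have "R v \<bullet> R z = v \<bullet> z" for v z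
      using axis_simps by (simp add: R_def inner_diff_left inner_diff_right inner_commute)
    then have o: "orthogonal_transformation R" unfolding orthogonal_transformation_def using lin by blast
    have RR: "R (R z) = z" for z using axis_simps by (simp add: R_def inner_diff_right)
    have R\<zeta>: "R \<zeta> = \<zeta>" using axis_simps by (simp add: R_def) (simp add: vec_eq_iff)
    have RT: "R (T x) = T (- x)" for x using axis_simps by (simp add: R_def T_simps)
    have iff: "z \<in> K \<longleftrightarrow> R (z - ?b) \<in> L" for z
    proof -
      obtain x where x: "z = T x + (z \<bullet> \<zeta>) *\<^sub>R \<zeta>" using decompose by blast
      have "z - ?b = T x + (z \<bullet> \<zeta> - (c - d)) *\<^sub>R \<zeta>" by (subst x) (simp add: algebra_simps)
      then have "R (z - ?b) = T (- x) + (z \<bullet> \<zeta> - (c - d)) *\<^sub>R \<zeta>"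
        by (simp only: linear_add[OF lin] linear_scale[OF lin] RT R\<zeta>)
      then have "R (z - ?b) \<in> L \<longleftrightarrow> mem L d (- x) (z \<bullet> \<zeta> - (c - d) - d)" unfolding memL[symmetric] by simp
      moreover have "z \<in> K \<longleftrightarrow> mem K c x (z \<bullet> \<zeta> - c)" unfolding memK[symmetric] x[symmetric] ..
      ultimately show ?thesis using m[of "- x"] by simp
    qed
    have "K = (\<lambda>x. R x + ?b) ` L"
    proof (intro set_eqI iffI)
      fix z assume "z \<in> K"
      then have "R (z - ?b) \<in> L" unfolding iff .
      moreover have "z = R (R (z - ?b)) + ?b" unfolding RR by simp
      ultimately show "z \<in> (\<lambda>x. R x + ?b) ` L" by (rule rev_image_eqI)
    next
      fix z assume "z \<in> (\<lambda>x. R x + ?b) ` L"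
      then obtain l where l: "l \<in> L" "z = R l + ?b" by blast
      have "z - ?b = R l" unfolding l(2) by simp
      then show "z \<in> K" unfolding iff using l(1) RR by simp
    qed
    moreover have "\<forall>x\<in>perp \<zeta>. R x = - x" by (simp add: R_def)
    ultimately show ?thesis using o R\<zeta> by blast
  qed
qed

end

text \<open>Both points of the second pair lie between those of the first, and being
  \<open>D\<close> apart they are its endpoints.\<close>

lemma interval_midpoint_unique:
  fixes a b c d :: real
  assumes "\<bar>a - b\<bar> = D" "\<bar>c - d\<bar> = D" "\<bar>a - c\<bar> \<le> D" "\<bar>a - d\<bar> \<le> D" "\<bar>b - c\<bar> \<le> D" "\<bar>b - d\<bar> \<le> D"
  shows "a + b = c + d"
  using assms by linarith

lemma star_shaped_line_segment:
  fixes L :: "(real ^ 'n) set"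
  assumes L: "star_shaped L" and "a *\<^sub>R z \<in> L" "b *\<^sub>R z \<in> L"
  shows "closed_segment (a *\<^sub>R z) (b *\<^sub>R z) \<subseteq> L"
proof -
  have lin: "linear (\<lambda>s. s *\<^sub>R z)" by (rule linearI) (simp_all add: algebra_simps)
  have seg: "(\<lambda>s. s *\<^sub>R z) ` closed_segment 0 c \<subseteq> L" if "c *\<^sub>R z \<in> L" for c
    using L that unfolding closed_segment_linear_image[OF lin, symmetric] star_shaped_def by simp
  have "closed_segment a b \<subseteq> closed_segment 0 a \<union> closed_segment 0 (b :: real)"
    by (auto simp: closed_segment_eq_real_ivl split: if_splits)
  then have "(\<lambda>s. s *\<^sub>R z) ` closed_segment a b \<subseteq> L" using seg assms(2,3) by blast
  then show ?thesis unfolding closed_segment_linear_image[OF lin] .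
qed

lemma perp_three_exists:
  fixes a b c :: "real ^ 4"
  obtains w where "norm w = 1" "w \<bullet> a = 0" "w \<bullet> b = 0" "w \<bullet> c = 0"
proof -
  have "dim {a, b, c} \<le> card {a, b, c}" by (intro dim_le_card') auto
  also have "card {a, b, c} \<le> 3" by (simp add: card_insert_if)
  finally have "dim {a, b, c} < DIM(real ^ 4)" by simp
  then obtain x where x: "x \<noteq> 0" "\<And>y. y \<in> span {a, b, c} \<Longrightarrow> orthogonal x y"
    using orthogonal_to_subspace_exists by blast
  have "x \<bullet> a = 0" "x \<bullet> b = 0" "x \<bullet> c = 0"
    using x(2) by (auto simp: span_base simp flip: orthogonal_def)
  then show ?thesis using that[of "x /\<^sub>R norm x"] x(1) by simp
qed

theorem theorem2:
  fixes K L :: "(real ^ 4) set" and \<zeta> :: "real ^ 4"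
  assumes "star_body K" and "star_body L"
    and "countable (diameters K)" and "countable (diameters L)"
    and "\<zeta> \<in> sphere 0 1"
    and "\<exists>d. central_diameter K \<zeta> d"
    and "\<And>w. w \<in> sphere 0 1 \<Longrightarrow> \<zeta> \<in> perp w \<Longrightarrow>
           directly_congruent_in (perp w) (K \<inter> perp w) (L \<inter> perp w)"
    and "\<And>w. w \<in> sphere 0 1 \<Longrightarrow> \<zeta> \<in> perp w \<Longrightarrow>
           \<not> pi_symmetric_in (perp w) \<zeta> (K \<inter> perp w) \<and>
           \<not> pi_symmetric_in (perp w) \<zeta> (L \<inter> perp w)"
    and "\<And>w u. w \<in> sphere 0 1 \<Longrightarrow> \<zeta> \<in> perp w \<Longrightarrow> u \<in> perp \<zeta> \<inter> perp w \<inter> sphere 0 1 \<Longrightarrow>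
           \<not> pi_symmetric_in (perp w) u (K \<inter> perp w) \<and>
           \<not> pi_symmetric_in (perp w) u (L \<inter> perp w)"
  shows "\<exists>b. (\<exists>t. b = t *\<^sub>R \<zeta>) \<and>
           (K = (\<lambda>x. x + b) ` L \<or>
            (\<exists>\<O>. orthogonal_transformation \<O> \<and> (\<forall>x\<in>perp \<zeta>. \<O> x = - x) \<and> \<O> \<zeta> = \<zeta> \<and>
                 K = (\<lambda>x. \<O> x + b) ` L))"
proof -
  have n\<zeta>: "norm \<zeta> = 1" using assms(5) by simp
  obtain T where T: "axis_frame T \<zeta>" using axis_frame_exists[OF n\<zeta>] .
  interpret axis_frame T \<zeta> by (rule T)
  have sT: "T w \<in> sphere 0 1" "\<zeta> \<in> perp (T w)" if "norm w = 1" for w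
    using that by (simp_all add: norm_T axis_simps)
  have d\<zeta>: "dist (a *\<^sub>R \<zeta>) (b *\<^sub>R \<zeta>) = \<bar>a - b\<bar>" for a b
    using n\<zeta> by (simp add: dist_norm flip: scaleR_diff_left)
  have dist_iso: "dist (\<phi> x - a) (\<phi> y - a) = dist x y" if "\<phi> \<in> SO_on H" for \<phi> H and x y a :: "real ^ 4"
    using that unfolding SO_on_def orthogonal_transformation_isometry by (simp add: dist_norm)

  obtain \<alpha> \<beta> where d: "closed_segment (\<alpha> *\<^sub>R \<zeta>) (\<beta> *\<^sub>R \<zeta>) \<subseteq> K"
    and maxK: "\<And>a b. closed_segment a b \<subseteq> K \<Longrightarrow> dist a b \<le> \<bar>\<alpha> - \<beta>\<bar>"
  proof -
    obtain d where "central_diameter K \<zeta> d" using assms(6) by blast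
    then obtain z y t where dd: "d \<in> diameters K" and d0: "0 \<in> closed_segment z y" and zy: "d = closed_segment z y" "y - z = t *\<^sub>R \<zeta>"
      unfolding central_diameter_def by blast
    obtain z' y' where z'y': "d = closed_segment z' y'" "closed_segment z' y' \<subseteq> K" "\<And>a b. closed_segment a b \<subseteq> K \<Longrightarrow> dist a b \<le> dist z' y'"
      using dd unfolding diameters_def by blast
    \<comment> \<open>The maximality and the direction of \<open>d\<close> come with separate
      choices of endpoints; a segment determines its endpoints up to order.\<close>
    have "{z, y} = {z', y'}" using zy(1) z'y'(1) by simp
    then have dzy: "dist z' y' = dist z y" by (auto simp: doubleton_eq_iff dist_commute)
    obtain s where s: "0 = (1 - s) *\<^sub>R z + s *\<^sub>R y" using d0 unfolding in_segment by blast
    have "0 = z + s *\<^sub>R (y - z)" using s by (simp add: algebra_simps)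
    then have z: "z = (- s * t) *\<^sub>R \<zeta>" unfolding zy(2) by (simp add: eq_neg_iff_add_eq_0)
    have y: "y = (t - s * t) *\<^sub>R \<zeta>" using zy(2) z by (simp add: algebra_simps)
    have "dist z y = \<bar>(- s * t) - (t - s * t)\<bar>" unfolding z y by (rule d\<zeta>)
    then have "dist a b \<le> \<bar>(- s * t) - (t - s * t)\<bar>" if "closed_segment a b \<subseteq> K" for a b
      using z'y'(3)[OF that] dzy by simp
    moreover have "closed_segment z y \<subseteq> K" using z'y'(1,2) zy(1) by metis
    ultimately show ?thesis using that unfolding z y by blast
  qed
  define D where "D = \<bar>\<alpha> - \<beta>\<bar>"
  have D0: "D > 0"
  proof -
    have "interior K \<noteq> {}" using assms(1) by (simp add: star_body_def body_def)
    then obtain x r where r: "r > 0" "ball x r \<subseteq> K" using mem_interior by blast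
    have "x \<in> ball x r" "x + (r / 2) *\<^sub>R \<zeta> \<in> ball x r" using r n\<zeta> by (simp_all add: dist_norm)
    then have "closed_segment x (x + (r / 2) *\<^sub>R \<zeta>) \<subseteq> K"
      using r(2) closed_segment_subset[OF _ _ convex_ball] by blast
    then have "dist x (x + (r / 2) *\<^sub>R \<zeta>) \<le> D" using maxK D_def by blast
    then show ?thesis using r n\<zeta> by (simp add: dist_norm)
  qed
  have maxL: "dist x y \<le> D" if seg: "closed_segment x y \<subseteq> L" for x y
  proof -
    \<comment> \<open>Three vectors do not span the space, so any segment of \<open>L\<close> lies
      in a hyperplane that also contains \<zeta>, and the congruence there carries it into
      \<open>K\<close>.\<close>
    obtain w where w: "norm w = 1" "w \<bullet> x = 0" "w \<bullet> y = 0" "w \<bullet> \<zeta> = 0" using perp_three_exists .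
    have "closed_segment x y \<subseteq> perp w"
      using w by (auto simp: in_segment inner_add_right)
    then have s: "closed_segment x y \<subseteq> L \<inter> perp w" using seg by blast
    obtain \<phi> a where "\<phi> \<in> SO_on (perp w)" and eq: "\<phi> ` (K \<inter> perp w) = (\<lambda>x. x + a) ` (L \<inter> perp w)"
      using assms(7)[of w] w unfolding directly_congruent_in_def by auto
    then have "orthogonal_transformation \<phi>" by (simp add: SO_on_def)
    from segment_backward[OF this eq s] obtain x' y' where "closed_segment x' y' \<subseteq> K \<inter> perp w" "dist x' y' = dist x y" .
    then show ?thesis using maxK D_def by force
  qed

  \<comment> \<open>One point off the axis is kept from each such diameter. A hyperplane orthogonal
    to \<open>T w\<close> containing the diameter forces \<open>w\<close> onto the great circle
    orthogonal to the point's component in \<open>real ^ 3\<close>.\<close>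
  define bad where "bad = {s \<in> diameters L. \<not> s \<subseteq> range (\<lambda>t. t *\<^sub>R \<zeta>)}"
  have "\<forall>s\<in>bad. \<exists>x t. x \<noteq> 0 \<and> T x + t *\<^sub>R \<zeta> \<in> s"
  proof
    fix s assume "s \<in> bad"
    then obtain z where z: "z \<in> s" "z \<notin> range (\<lambda>t. t *\<^sub>R \<zeta>)" unfolding bad_def by blast
    obtain x where x: "z = T x + (z \<bullet> \<zeta>) *\<^sub>R \<zeta>" using decompose by blast
    then have "x \<noteq> 0" using z(2) by (metis T_simps(5) add_0 rangeI)
    then show "\<exists>x t. x \<noteq> 0 \<and> T x + t *\<^sub>R \<zeta> \<in> s" using x z(1) by metis
  qed
  then obtain X \<tau> where X: "\<And>s. s \<in> bad \<Longrightarrow> X s \<noteq> 0 \<and> T (X s) + \<tau> s *\<^sub>R \<zeta> \<in> s" by metis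
  define good where "good = {w. norm w = 1 \<and> (\<forall>v\<in>X ` bad. w \<bullet> v \<noteq> 0)}"
  have "countable bad" unfolding bad_def by (rule countable_subset[OF _ assms(4)]) auto
  then have dense: "sphere 0 1 \<subseteq> closure good"
    unfolding good_def by (intro dense_off_hyperplanes) (use X in auto)

  text \<open>For \<open>w\<close> in \<open>good\<close>, all diameters of \<open>L\<close> that lie in the hyperplane orthogonal to \<open>T w\<close>
    lie on the axis, so the congruence must carry the axis to itself.\<close>

  have axis: "\<exists>\<phi> k a \<alpha>' \<beta>'. \<phi> \<in> SO_on (perp (T w)) \<and> \<phi> \<zeta> = k *\<^sub>R \<zeta> \<and> \<bar>k\<bar> = 1 \<and> T w \<bullet> a = 0 \<and>
      \<phi> ` (K \<inter> perp (T w)) = (\<lambda>x. x + a) ` (L \<inter> perp (T w)) \<and>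
      \<phi> (\<alpha> *\<^sub>R \<zeta>) = \<alpha>' *\<^sub>R \<zeta> + a \<and> \<phi> (\<beta> *\<^sub>R \<zeta>) = \<beta>' *\<^sub>R \<zeta> + a \<and>
      \<alpha>' *\<^sub>R \<zeta> \<in> L \<and> \<beta>' *\<^sub>R \<zeta> \<in> L \<and> \<bar>\<alpha>' - \<beta>'\<bar> = D"
    if w: "w \<in> good" for w
  proof -
    have nw: "norm w = 1" using w by (simp add: good_def)
    obtain \<phi> a where phi: "\<phi> \<in> SO_on (perp (T w))" and a: "T w \<bullet> a = 0"
      and eq: "\<phi> ` (K \<inter> perp (T w)) = (\<lambda>x. x + a) ` (L \<inter> perp (T w))"
      using assms(7)[OF sT[OF nw]] unfolding directly_congruent_in_def by auto
    have lin: "linear \<phi>" using phi orthogonal_transformation_linear by (auto simp: SO_on_def)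
    let ?z = "\<phi> (\<alpha> *\<^sub>R \<zeta>) - a" and ?y = "\<phi> (\<beta> *\<^sub>R \<zeta>) - a"
    have "closed_segment (\<alpha> *\<^sub>R \<zeta>) (\<beta> *\<^sub>R \<zeta>) \<subseteq> perp (T w)"
      by (auto simp: in_segment inner_add_right axis_simps)
    then have sub: "closed_segment ?z ?y \<subseteq> L \<inter> perp (T w)"
      using d by (intro segment_forward[OF lin eq]) auto
    have dzy: "dist ?z ?y = D" unfolding dist_iso[OF phi] d\<zeta> D_def ..
    have "closed_segment ?z ?y \<in> diameters L"
      unfolding diameters_def using sub maxL dzy by blast
    moreover have "closed_segment ?z ?y \<notin> bad"
    proof
      let ?s = "closed_segment ?z ?y"
      assume b: "?s \<in> bad"
      then have "T (X ?s) + \<tau> ?s *\<^sub>R \<zeta> \<in> perp (T w)" using X sub by blast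
      then have "w \<bullet> X ?s = 0" by (simp add: inner_add_right inner_T axis_simps)
      then show False using w b unfolding good_def by blast
    qed
    ultimately have "closed_segment ?z ?y \<subseteq> range (\<lambda>t. t *\<^sub>R \<zeta>)" unfolding bad_def by blast
    then obtain \<alpha>' \<beta>' where ab: "?z = \<alpha>' *\<^sub>R \<zeta>" "?y = \<beta>' *\<^sub>R \<zeta>"
      using ends_in_segment by (metis (no_types, lifting) imageE subsetD)
    have ab': "\<phi> (\<alpha> *\<^sub>R \<zeta>) = \<alpha>' *\<^sub>R \<zeta> + a" "\<phi> (\<beta> *\<^sub>R \<zeta>) = \<beta>' *\<^sub>R \<zeta> + a"
      using ab by (metis diff_add_cancel)+
    have D': "\<bar>\<alpha>' - \<beta>'\<bar> = D" using dzy unfolding ab d\<zeta> .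
    have "(\<alpha> - \<beta>) *\<^sub>R \<phi> \<zeta> = \<phi> (\<alpha> *\<^sub>R \<zeta>) - \<phi> (\<beta> *\<^sub>R \<zeta>)"
      by (simp add: linear_scale[OF lin] scaleR_diff_left)
    also have "\<dots> = (\<alpha>' - \<beta>') *\<^sub>R \<zeta>" unfolding ab' by (simp add: algebra_simps)
    finally have eq\<zeta>: "(\<alpha> - \<beta>) *\<^sub>R \<phi> \<zeta> = (\<alpha>' - \<beta>') *\<^sub>R \<zeta>" .
    have ne: "\<alpha> - \<beta> \<noteq> 0" using D0 by (auto simp: D_def)
    have "\<phi> \<zeta> = ((\<alpha>' - \<beta>') / (\<alpha> - \<beta>)) *\<^sub>R \<zeta>"
    proof -
      have "\<phi> \<zeta> = (1 / (\<alpha> - \<beta>)) *\<^sub>R ((\<alpha> - \<beta>) *\<^sub>R \<phi> \<zeta>)" using ne by simp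
      then show ?thesis unfolding eq\<zeta> by simp
    qed
    moreover have "\<bar>(\<alpha>' - \<beta>') / (\<alpha> - \<beta>)\<bar> = 1" using D' ne by (simp add: D_def)
    moreover have "\<alpha>' *\<^sub>R \<zeta> \<in> L" "\<beta>' *\<^sub>R \<zeta> \<in> L" using sub unfolding ab by auto
    ultimately show ?thesis using phi a eq ab' D' by blast
  qed
  have "good \<noteq> {}"
  proof
    assume "good = {}"
    then have "axis 1 1 \<in> ({} :: (real ^ 3) set)" using dense by (metis closure_empty subsetD mem_sphere_0 norm_axis_1)
    then show False by simp
  qed
  then obtain w\<^sub>0 where "w\<^sub>0 \<in> good" by blast
  from axis[OF this] obtain \<alpha>\<^sub>0 \<beta>\<^sub>0 where z0: "\<alpha>\<^sub>0 *\<^sub>R \<zeta> \<in> L" "\<beta>\<^sub>0 *\<^sub>R \<zeta> \<in> L" "\<bar>\<alpha>\<^sub>0 - \<beta>\<^sub>0\<bar> = D" by blast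
  define c where "c = (\<alpha> + \<beta>) / 2"
  define c' where "c' = (\<alpha>\<^sub>0 + \<beta>\<^sub>0) / 2"
  \<comment> \<open>The endpoints come from a congruence depending on \<open>w\<close>, but maximal
    segments of \<open>L\<close> on the axis share their midpoint, so one \<open>c'\<close> serves
    all \<open>w\<close>.\<close>
  have mid: "\<alpha>' + \<beta>' = 2 * c'"
    if z: "\<alpha>' *\<^sub>R \<zeta> \<in> L" "\<beta>' *\<^sub>R \<zeta> \<in> L" "\<bar>\<alpha>' - \<beta>'\<bar> = D" for \<alpha>' \<beta>'
  proof -
    have le: "\<bar>s - t\<bar> \<le> D" if "s *\<^sub>R \<zeta> \<in> L" "t *\<^sub>R \<zeta> \<in> L" for s t
      using maxL[OF star_shaped_line_segment[OF star_body_facts(2)[OF assms(2)] that]] unfolding d\<zeta> .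
    have "\<alpha>' + \<beta>' = \<alpha>\<^sub>0 + \<beta>\<^sub>0"
      by (rule interval_midpoint_unique[OF z(3) z0(3)]) (intro le z z0)+
    then show ?thesis by (simp add: c'_def)
  qed

  interpret cc: congruent_colourings "colour K c" "colour L c'" turn_over
  proof
    show "continuous_on (sphere 0 1) (\<lambda>x. colour K c x q)" "continuous_on (sphere 0 1) (\<lambda>x. colour L c' x q)" for q
      by (intro continuous_colour assms)+
    show "\<exists>x. norm x = 1 \<and> w \<bullet> x = 0 \<and> colour K c (- x) \<noteq> colour K c x" if "norm w = 1" for w
      using colour_no_half_turn[OF assms(1) that] assms(8)[OF sT[OF that]] by blast
    show "\<exists>p. cmod p = 1 \<and> colour K c (plane_point w e (v * cnj p)) \<noteq> colour K c (plane_point w e p) \<circ> turn_over"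
      if we: "orthonormal_pair w e" and v: "cmod v = 1" for w e v
      using colour_no_flip[OF assms(1) we v] assms(9)[OF sT[OF orthonormal_pairD(1)[OF we]]] by blast
  qed
  let ?S = "{w. norm w = 1 \<and> ((\<exists>z. cmod z = 1 \<and> cc.rotates w z) \<or> (\<exists>e v. orthonormal_pair w e \<and> cmod v = 1 \<and> cc.flips w e v))}"
  have "good \<subseteq> ?S"
  proof
    fix w assume w: "w \<in> good"
    then have nw: "norm w = 1" by (simp add: good_def)
    obtain e where we: "orthonormal_pair w e" using orthonormal_pair_exists[OF nw] .
    from axis[OF w] obtain \<phi> k a \<alpha>' \<beta>' where phi: "\<phi> \<in> SO_on (perp (T w))" and k: "\<phi> \<zeta> = k *\<^sub>R \<zeta>" "\<bar>k\<bar> = 1"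
      and a: "T w \<bullet> a = 0" and eq: "\<phi> ` (K \<inter> perp (T w)) = (\<lambda>x. x + a) ` (L \<inter> perp (T w))"
      and ab: "\<phi> (\<alpha> *\<^sub>R \<zeta>) = \<alpha>' *\<^sub>R \<zeta> + a" "\<phi> (\<beta> *\<^sub>R \<zeta>) = \<beta>' *\<^sub>R \<zeta> + a"
      and L': "\<alpha>' *\<^sub>R \<zeta> \<in> L" "\<beta>' *\<^sub>R \<zeta> \<in> L" "\<bar>\<alpha>' - \<beta>'\<bar> = D" by blast
    have orth: "orthogonal_transformation \<phi>" and img: "\<phi> ` perp (T w) = perp (T w)" using phi by (simp_all add: SO_on_def)
    have lin: "linear \<phi>" and inj: "inj \<phi>"
      using orth by (simp_all add: orthogonal_transformation_linear orthogonal_transformation_inj)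
    \<comment> \<open>Adding the images of both endpoints expresses the translation by the midpoints
      alone; in heights measured from \<open>c\<close> and \<open>c'\<close> it disappears.\<close>
    have shift: "a = (k * c - c') *\<^sub>R \<zeta>"
    proof -
      have "2 *\<^sub>R a = ((\<alpha> + \<beta>) * k) *\<^sub>R \<zeta> - (\<alpha>' + \<beta>') *\<^sub>R \<zeta>"
        using ab unfolding linear_scale[OF lin] k(1) by (simp add: algebra_simps scaleR_2)
      also have "\<dots> = 2 *\<^sub>R ((k * c - c') *\<^sub>R \<zeta>)"
      proof -
        have "(\<alpha> + \<beta>) * k = 2 * (k * c)" by (simp add: c_def)
        then show ?thesis unfolding mid[OF L'] by (simp add: algebra_simps)
      qed
      finally show ?thesis unfolding scaleR_cancel_left by (simp only: zero_neq_numeral[symmetric] simp_thms)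
    qed
    have iff: "v \<in> K \<longleftrightarrow> \<phi> v - a \<in> L" if v: "T w \<bullet> v = 0" for v
    proof
      assume "v \<in> K"
      then have "\<phi> v \<in> (\<lambda>x. x + a) ` (L \<inter> perp (T w))" using eq v by blast
      then show "\<phi> v - a \<in> L" by auto
    next
      assume l: "\<phi> v - a \<in> L"
      have "\<phi> v \<in> perp (T w)" using img v by blast
      then have "\<phi> v - a \<in> perp (T w)" using a by (simp add: inner_diff_right)
      then have "\<phi> v - a + a \<in> \<phi> ` (K \<inter> perp (T w))" unfolding eq using l by blast
      then have "\<phi> v \<in> \<phi> ` (K \<inter> perp (T w))" by simp
      then show "v \<in> K" using inj by (auto dest: injD)
    qed
    have "mem K c x t \<longleftrightarrow> mem L c' y (k * t)" if x: "w \<bullet> x = 0" and y: "\<phi> (T x) = T y" for x y t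
    proof -
      have "T w \<bullet> (T x + (t + c) *\<^sub>R \<zeta>) = 0" using x by (simp add: inner_add_right inner_T axis_simps)
      moreover have "\<phi> (T x + (t + c) *\<^sub>R \<zeta>) - a = T y + (k * t + c') *\<^sub>R \<zeta>"
        unfolding shift linear_add[OF lin] linear_scale[OF lin] k(1) y by (simp add: algebra_simps)
      ultimately show ?thesis unfolding mem_def using iff by metis
    qed
    from colour_related[OF assms(1,2) we phi k this]
    show "w \<in> ?S" using nw we cc.rotates_frame[OF we] unfolding cc.flips_def by blast
  qed
  then have "sphere 0 1 \<subseteq> closure ?S" using dense closure_mono by blast
  from equal_or_reflected[OF assms(1,2) cc.equal_or_antipodal[OF this]] show ?thesis .
qed

end
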